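(* Let $H:\mathbb{A}\to\mathcal{B}$ be an $\mathcal{F}$-functor from an $\mathcal{F}$-category to a 2-category whose tight part $H_\tau:\mathcal{A}_\tau\to\mathcal{B}$ has a left (2-)adjoint. Let $T$ be the induced 2-monad on $\mathcal{B}$ and let $E:\mathcal{A}_\tau\to \text{T-Alg}_s$ be the induced Eilenberg–Moore comparison 2-functor, so that $U_sE=H_\tau$. Let $w\in\{l,p,c\}$ and suppose that $\mathbb{A}$ admits $\bar{w}$-limits of loose morphisms. Then $E$ admits a unique extension to an $\mathcal{F}$-functor $E_w:\mathbb{A}\to\text{T-}\mathbb{A}\text{lg}_w$ over $\mathcal{B}$; that is, there is a unique $\mathcal{F}$-functor $E_w:\mathbb{A}\to\text{T-}\mathbb{A}\text{lg}_w$ satisfying $E_wj=j_wE$ and $UE_w=H$.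
   Context: **$\mathcal{F}$-categories.** An $\mathcal{F}$-category $\mathbb{A}$ is a pair of 2-categories $\mathcal{A}_\tau,\mathcal{A}_\lambda$ with a 2-functor $j:\mathcal{A}_\tau\to\mathcal{A}_\lambda$ that is the identity on objects, faithful (injective on 1-cells) and locally fully faithful. The 1-cells of $\mathcal{A}_\lambda$ are the loose morphisms (written $A\rightsquigarrow B$); those coming from $\mathcal{A}_\tau$ are the tight morphisms (written $A\to B$). An $\mathcal{F}$-functor $F:\mathbb{A}\to\mathbb{B}$ is a 2-functor $F_\lambda:\mathcal{A}_\lambda\to\mathcal{B}_\lambda$ taking tight morphisms to tight morphisms; $F_\tau:\mathcal{A}_\tau\to\mathcal{B}_\tau$ is its restriction. A 2-category is viewed as an $\mathcal{F}$-category in which all morphisms are tight. Thus there is an $\mathcal{F}$-functor $j:\mathcal{A}_\tau\to\mathbb{A}$, the identity on tight morphisms and given by $j:\mathcal{A}_\tau\to\mathcal{A}_\lambda$ on loose ones. $\mathbb{A}^{co}$ is obtained by reversing 2-cells. **Limits of loose morphisms.** Put $\bar{l}=c$, $\bar{p}=p$, $\bar{c}=l$. The colax limit ($c$-limit) of a loose $f:A\rightsquigarrow B$ consists of an object $C_f$, tight morphisms $p_f:C_f\to A$, $q_f:C_f\to B$ and a 2-cell $\lambda_f:q_f\Rightarrow fp_f$ such that: (1) for every colax cone $(r:X\rightsquigarrow A,\ \alpha:s\Rightarrow fr,\ s:X\rightsquigarrow B)$ there is a unique $t:X\rightsquigarrow C_f$ with $p_ft=r$, $q_ft=s$, $\lambda_ft=\alpha$;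 (2) given colax cones $(r,\alpha,s)$, $(r',\alpha',s')$ from $X$, with induced $t,t'$, and 2-cells $\theta_r:r\Rightarrow r'$, $\theta_s:s\Rightarrow s'$ with $\alpha'\circ\theta_s=(f\theta_r)\circ\alpha$, there is a unique 2-cell $\phi:t\Rightarrow t'$ with $p_f\phi=\theta_r$, $q_f\phi=\theta_s$; (3) $t:X\rightsquigarrow C_f$ is tight just when $p_ft$ and $q_ft$ are tight. The pseudolimit ($p$-limit) is defined in the same way with $\lambda_f$ and the 2-cells $\alpha$ of all cones required invertible. The lax limit ($l$-limit) of $f$ in $\mathbb{A}$ is the colax limit of $f$ in $\mathbb{A}^{co}$. **Algebras.** Let $T=(T,\mu,\eta)$ be a 2-monad on a 2-category $\mathcal{B}$. Algebras are strict $T$-algebras $(A,a:TA\to A)$. A lax morphism $(f,\bar f):(A,a)\rightsquigarrow(B,b)$ is $f:A\to B$ with a 2-cell $\bar f:b\,Tf\Rightarrow fa$ satisfying $\bar f\mu_A=(\bar f\,Ta)\circ(b\,T\bar f)$ and $\bar f\eta_A=1_f$; it is a pseudo morphism if $\bar f$ is invertible and strict if $\bar f$ is an identity. A colax morphism has $\bar f:fa\Rightarrow b\,Tf$ satisfying the dual conditions. An algebra 2-cell $\alpha:(f,\bar f)\Rightarrow(g,\bar g)$ of lax morphisms is a 2-cell $\alpha:f\Rightarrow g$ with $(\alpha a)\circ\bar f=\bar g\circ(b\,T\alpha)$; dually for colax. For $w=s,p,l,c$ (strict, pseudo, lax, colax) $\text{T-Alg}_w$ is the 2-category of algebras, $w$-morphisms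 and algebra 2-cells, with forgetful 2-functor $U_w:\text{T-Alg}_w\to\mathcal{B}$. For $w\in\{l,p,c\}$, $\text{T-}\mathbb{A}\text{lg}_w$ is the $\mathcal{F}$-category given by the inclusion $\text{T-Alg}_s\to\text{T-Alg}_w$ (tight = strict, loose = $w$-morphisms); $j_w:\text{T-Alg}_s\to\text{T-}\mathbb{A}\text{lg}_w$ is its inclusion of tight morphisms and $U:\text{T-}\mathbb{A}\text{lg}_w\to\mathcal{B}$ the forgetful $\mathcal{F}$-functor, with $U_\tau=U_s$, $U_\lambda=U_w$. *)

theory Defs
  imports Main
begin

section \<open>Strict 2-categories\<close>

text \<open>
  A 2-category is given by sets of objects, 1-cells and 2-cells together with operations that are
  only meaningful on those sets. Compositions are written in the usual (right-to-left) order.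
\<close>

record ('o, 'm, 'c) two_cat =
  Obj :: "'o set"
  Arr :: "'m set"
  Cel :: "'c set"
  Dom :: "'m \<Rightarrow> 'o"
  Cod :: "'m \<Rightarrow> 'o"
  Src :: "'c \<Rightarrow> 'm"
  Tgt :: "'c \<Rightarrow> 'm"
  Id1 :: "'o \<Rightarrow> 'm"
  Id2 :: "'m \<Rightarrow> 'c"
  Comp :: "'m \<Rightarrow> 'm \<Rightarrow> 'm"  (infixl \<open>\<odot>\<index>\<close> 70)
  VComp :: "'c \<Rightarrow> 'c \<Rightarrow> 'c"  (infixl \<open>\<bullet>\<index>\<close> 65)
  HComp :: "'c \<Rightarrow> 'c \<Rightarrow> 'c"  (infixl \<open>\<star>\<index>\<close> 70)

definition arr :: "('o, 'm, 'c) two_cat \<Rightarrow> 'm \<Rightarrow> 'o \<Rightarrow> 'o \<Rightarrow> bool" where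
  "arr C f x y \<longleftrightarrow> f \<in> Arr C \<and> Dom C f = x \<and> Cod C f = y"

definition cell :: "('o, 'm, 'c) two_cat \<Rightarrow> 'c \<Rightarrow> 'm \<Rightarrow> 'm \<Rightarrow> bool" where
  "cell C \<alpha> f g \<longleftrightarrow> \<alpha> \<in> Cel C \<and> Src C \<alpha> = f \<and> Tgt C \<alpha> = g"

abbreviation lwhisk :: "('o, 'm, 'c) two_cat \<Rightarrow> 'm \<Rightarrow> 'c \<Rightarrow> 'c"  (infixr \<open>\<rhd>\<index>\<close> 70) where
  "f \<rhd>\<^bsub>C\<^esub> \<alpha> \<equiv> Id2 C f \<star>\<^bsub>C\<^esub> \<alpha>"

abbreviation rwhisk :: "('o, 'm, 'c) two_cat \<Rightarrow> 'c \<Rightarrow> 'm \<Rightarrow> 'c"  (infixl \<open>\<lhd>\<index>\<close> 70) where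
  "\<alpha> \<lhd>\<^bsub>C\<^esub> f \<equiv> \<alpha> \<star>\<^bsub>C\<^esub> Id2 C f"

locale two_category =
  fixes C :: "('o, 'm, 'c) two_cat" (structure)
  assumes Dom_Obj: "f \<in> Arr C \<Longrightarrow> Dom C f \<in> Obj C"
    and Cod_Obj: "f \<in> Arr C \<Longrightarrow> Cod C f \<in> Obj C"
    and Id1_arr: "x \<in> Obj C \<Longrightarrow> arr C (Id1 C x) x x"
    and Comp_arr: "\<lbrakk>arr C f x y; arr C g y z\<rbrakk> \<Longrightarrow> arr C (g \<odot> f) x z"
    and Comp_Id1: "arr C f x y \<Longrightarrow> f \<odot> Id1 C x = f"
    and Id1_Comp: "arr C f x y \<Longrightarrow> Id1 C y \<odot> f = f"
    and Comp_assoc: "\<lbrakk>arr C f x y; arr C g y z; arr C h z u\<rbrakk> \<Longrightarrow> (h \<odot> g) \<odot> f = h \<odot> (g \<odot> f)"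
    and Src_Arr: "\<alpha> \<in> Cel C \<Longrightarrow> Src C \<alpha> \<in> Arr C"
    and Tgt_Arr: "\<alpha> \<in> Cel C \<Longrightarrow> Tgt C \<alpha> \<in> Arr C"
    and Dom_Tgt: "\<alpha> \<in> Cel C \<Longrightarrow> Dom C (Tgt C \<alpha>) = Dom C (Src C \<alpha>)"
    and Cod_Tgt: "\<alpha> \<in> Cel C \<Longrightarrow> Cod C (Tgt C \<alpha>) = Cod C (Src C \<alpha>)"
    and Id2_cell: "f \<in> Arr C \<Longrightarrow> cell C (Id2 C f) f f"
    and VComp_cell: "\<lbrakk>cell C \<alpha> f g; cell C \<beta> g h\<rbrakk> \<Longrightarrow> cell C (\<beta> \<bullet> \<alpha>) f h"
    and VComp_Id2: "cell C \<alpha> f g \<Longrightarrow> \<alpha> \<bullet> Id2 C f = \<alpha>"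
    and Id2_VComp: "cell C \<alpha> f g \<Longrightarrow> Id2 C g \<bullet> \<alpha> = \<alpha>"
    and VComp_assoc: "\<lbrakk>cell C \<alpha> f g; cell C \<beta> g h; cell C \<gamma> h k\<rbrakk>
          \<Longrightarrow> (\<gamma> \<bullet> \<beta>) \<bullet> \<alpha> = \<gamma> \<bullet> (\<beta> \<bullet> \<alpha>)"
    and HComp_cell: "\<lbrakk>cell C \<alpha> f f'; cell C \<beta> g g'; Cod C f = Dom C g\<rbrakk>
          \<Longrightarrow> cell C (\<beta> \<star> \<alpha>) (g \<odot> f) (g' \<odot> f')"
    and HComp_Id: "\<lbrakk>cell C \<alpha> f f'; Dom C f = x\<rbrakk> \<Longrightarrow> \<alpha> \<star> Id2 C (Id1 C x) = \<alpha>"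
    and Id_HComp: "\<lbrakk>cell C \<alpha> f f'; Cod C f = y\<rbrakk> \<Longrightarrow> Id2 C (Id1 C y) \<star> \<alpha> = \<alpha>"
    and HComp_assoc: "\<lbrakk>cell C \<alpha> f f'; cell C \<beta> g g'; cell C \<gamma> h h';
            Cod C f = Dom C g; Cod C g = Dom C h\<rbrakk>
          \<Longrightarrow> (\<gamma> \<star> \<beta>) \<star> \<alpha> = \<gamma> \<star> (\<beta> \<star> \<alpha>)"
    and HComp_Id2: "\<lbrakk>arr C f x y; arr C g y z\<rbrakk> \<Longrightarrow> Id2 C g \<star> Id2 C f = Id2 C (g \<odot> f)"
    and interchange: "\<lbrakk>cell C \<alpha> f f'; cell C \<alpha>' f' f''; cell C \<beta> g g'; cell C \<beta>' g' g'';
            Cod C f = Dom C g\<rbrakk>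
          \<Longrightarrow> (\<beta>' \<bullet> \<beta>) \<star> (\<alpha>' \<bullet> \<alpha>) = (\<beta>' \<star> \<alpha>') \<bullet> (\<beta> \<star> \<alpha>)"

definition invertible :: "('o, 'm, 'c) two_cat \<Rightarrow> 'c \<Rightarrow> bool" where
  "invertible C \<alpha> \<longleftrightarrow> \<alpha> \<in> Cel C \<and>
     (\<exists>\<beta>. cell C \<beta> (Tgt C \<alpha>) (Src C \<alpha>) \<and>
        \<beta> \<bullet>\<^bsub>C\<^esub> \<alpha> = Id2 C (Src C \<alpha>) \<and> \<alpha> \<bullet>\<^bsub>C\<^esub> \<beta> = Id2 C (Tgt C \<alpha>))"

definition two_cat_co :: "('o, 'm, 'c) two_cat \<Rightarrow> ('o, 'm, 'c) two_cat" where
  "two_cat_co C = C\<lparr>Src := Tgt C, Tgt := Src C, VComp := (\<lambda>\<beta> \<alpha>. \<alpha> \<bullet>\<^bsub>C\<^esub> \<beta>)\<rparr>"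


section \<open>2-functors, 2-natural transformations and 2-adjunctions\<close>

record ('o, 'm, 'c, 'p, 'n, 'd) two_map =
  FObj :: "'o \<Rightarrow> 'p"
  FArr :: "'m \<Rightarrow> 'n"
  FCel :: "'c \<Rightarrow> 'd"

locale two_functor = C: two_category C + D: two_category D
  for C :: "('o, 'm, 'c) two_cat" and D :: "('p, 'n, 'd) two_cat" +
  fixes F :: "('o, 'm, 'c, 'p, 'n, 'd) two_map"
  assumes FObj_Obj: "x \<in> Obj C \<Longrightarrow> FObj F x \<in> Obj D"
    and FArr_arr: "arr C f x y \<Longrightarrow> arr D (FArr F f) (FObj F x) (FObj F y)"
    and FCel_cell: "cell C \<alpha> f g \<Longrightarrow> cell D (FCel F \<alpha>) (FArr F f) (FArr F g)"
    and FArr_Id1: "x \<in> Obj C \<Longrightarrow> FArr F (Id1 C x) = Id1 D (FObj F x)"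
    and FArr_Comp: "\<lbrakk>arr C f x y; arr C g y z\<rbrakk>
          \<Longrightarrow> FArr F (g \<odot>\<^bsub>C\<^esub> f) = FArr F g \<odot>\<^bsub>D\<^esub> FArr F f"
    and FCel_Id2: "f \<in> Arr C \<Longrightarrow> FCel F (Id2 C f) = Id2 D (FArr F f)"
    and FCel_VComp: "\<lbrakk>cell C \<alpha> f g; cell C \<beta> g h\<rbrakk>
          \<Longrightarrow> FCel F (\<beta> \<bullet>\<^bsub>C\<^esub> \<alpha>) = FCel F \<beta> \<bullet>\<^bsub>D\<^esub> FCel F \<alpha>"
    and FCel_HComp: "\<lbrakk>cell C \<alpha> f f'; cell C \<beta> g g'; Cod C f = Dom C g\<rbrakk>
          \<Longrightarrow> FCel F (\<beta> \<star>\<^bsub>C\<^esub> \<alpha>) = FCel F \<beta> \<star>\<^bsub>D\<^esub> FCel F \<alpha>"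

text \<open>
  Maps of 2-categories are total functions in HOL, so equality of 2-functors means agreement on the
  cells of the domain.
\<close>

definition two_map_eq ::
  "('o, 'm, 'c) two_cat \<Rightarrow> ('o, 'm, 'c, 'p, 'n, 'd) two_map \<Rightarrow> ('o, 'm, 'c, 'p, 'n, 'd) two_map \<Rightarrow> bool"
where
  "two_map_eq C F G \<longleftrightarrow>
     (\<forall>x\<in>Obj C. FObj F x = FObj G x) \<and>
     (\<forall>f\<in>Arr C. FArr F f = FArr G f) \<and>
     (\<forall>\<alpha>\<in>Cel C. FCel F \<alpha> = FCel G \<alpha>)"

definition two_map_id :: "('o, 'm, 'c, 'o, 'm, 'c) two_map" where
  "two_map_id = \<lparr>FObj = id, FArr = id, FCel = id\<rparr>"

definition two_map_comp ::
  "('p, 'n, 'd, 'q, 'k, 'e) two_map \<Rightarrow> ('o, 'm, 'c, 'p, 'n, 'd) two_map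
     \<Rightarrow> ('o, 'm, 'c, 'q, 'k, 'e) two_map"  (infixl \<open>\<circ>\<circ>\<close> 75)
where
  "G \<circ>\<circ> F = \<lparr>FObj = FObj G \<circ> FObj F, FArr = FArr G \<circ> FArr F, FCel = FCel G \<circ> FCel F\<rparr>"

locale two_natural = F: two_functor C D F + G: two_functor C D G
  for C :: "('o, 'm, 'c) two_cat" and D :: "('p, 'n, 'd) two_cat"
    and F G :: "('o, 'm, 'c, 'p, 'n, 'd) two_map" +
  fixes t :: "'o \<Rightarrow> 'n"
  assumes component_arr: "x \<in> Obj C \<Longrightarrow> arr D (t x) (FObj F x) (FObj G x)"
    and natural_1: "arr C f x y \<Longrightarrow> FArr G f \<odot>\<^bsub>D\<^esub> t x = t y \<odot>\<^bsub>D\<^esub> FArr F f"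
    and natural_2: "\<lbrakk>cell C \<alpha> f g; arr C f x y\<rbrakk>
          \<Longrightarrow> FCel G \<alpha> \<lhd>\<^bsub>D\<^esub> t x = t y \<rhd>\<^bsub>D\<^esub> FCel F \<alpha>"

text \<open>\<open>L\<close> is left 2-adjoint to \<open>R\<close> with unit \<open>\<eta>\<close> and counit \<open>\<epsilon>\<close>.\<close>

locale two_adjunction =
  L: two_functor B A L + R: two_functor A B R +
  unit: two_natural B B two_map_id "R \<circ>\<circ> L" \<eta> +
  counit: two_natural A A "L \<circ>\<circ> R" two_map_id \<epsilon>
  for A :: "('o, 'm, 'c) two_cat" and B :: "('p, 'n, 'd) two_cat"
    and L :: "('p, 'n, 'd, 'o, 'm, 'c) two_map" and R :: "('o, 'm, 'c, 'p, 'n, 'd) two_map"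
    and \<eta> :: "'p \<Rightarrow> 'n" and \<epsilon> :: "'o \<Rightarrow> 'm" +
  assumes triangle_L: "b \<in> Obj B \<Longrightarrow> \<epsilon> (FObj L b) \<odot>\<^bsub>A\<^esub> FArr L (\<eta> b) = Id1 A (FObj L b)"
    and triangle_R: "a \<in> Obj A \<Longrightarrow> FArr R (\<epsilon> a) \<odot>\<^bsub>B\<^esub> \<eta> (FObj R a) = Id1 B (FObj R a)"


section \<open>\<open>\<F>\<close>-categories\<close>

record ('o, 'm, 'c, 'n, 'd) f_cat =
  Tight :: "('o, 'm, 'c) two_cat"
  Loose :: "('o, 'n, 'd) two_cat"
  Incl :: "('o, 'm, 'c, 'o, 'n, 'd) two_map"

locale f_category =
  incl: two_functor "Tight A" "Loose A" "Incl A"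
  for A :: "('o, 'm, 'c, 'n, 'd) f_cat" +
  assumes Obj_eq: "Obj (Tight A) = Obj (Loose A)"
    and Incl_Obj: "x \<in> Obj (Tight A) \<Longrightarrow> FObj (Incl A) x = x"
    and Incl_faithful: "inj_on (FArr (Incl A)) (Arr (Tight A))"
    and Incl_locally_fully_faithful: "\<lbrakk>arr (Tight A) f x y; arr (Tight A) g x y\<rbrakk> \<Longrightarrow>
          bij_betw (FCel (Incl A)) {\<alpha>. cell (Tight A) \<alpha> f g}
            {\<beta>. cell (Loose A) \<beta> (FArr (Incl A) f) (FArr (Incl A) g)}"

definition tight :: "('o, 'm, 'c, 'n, 'd) f_cat \<Rightarrow> 'n \<Rightarrow> bool" where
  "tight A f \<longleftrightarrow> f \<in> FArr (Incl A) ` Arr (Tight A)"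

text \<open>An \<open>\<F>\<close>-functor is identified with its loose part.\<close>

locale f_functor =
  A: f_category A + B: f_category B + loose: two_functor "Loose A" "Loose B" F
  for A :: "('o, 'm, 'c, 'n, 'd) f_cat" and B :: "('p, 'k, 'e, 'l, 'h) f_cat"
    and F :: "('o, 'n, 'd, 'p, 'l, 'h) two_map" +
  assumes preserves_tight: "tight A f \<Longrightarrow> tight B (FArr F f)"

definition all_tight :: "('o, 'm, 'c) two_cat \<Rightarrow> ('o, 'm, 'c, 'm, 'c) f_cat" where
  "all_tight C = \<lparr>Tight = C, Loose = C, Incl = two_map_id\<rparr>"

text \<open>
  The tight part of an \<open>\<F>\<close>-functor into a 2-category: all 1-cells of the codomain being
  tight, it is the restriction along the inclusion of tight morphisms.
\<close>

definition tight_part ::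
  "('o, 'm, 'c, 'n, 'd) f_cat \<Rightarrow> ('o, 'n, 'd, 'p, 'l, 'h) two_map \<Rightarrow> ('o, 'm, 'c, 'p, 'l, 'h) two_map"
where
  "tight_part A H = H \<circ>\<circ> Incl A"

definition f_cat_co :: "('o, 'm, 'c, 'n, 'd) f_cat \<Rightarrow> ('o, 'm, 'c, 'n, 'd) f_cat" where
  "f_cat_co A = \<lparr>Tight = two_cat_co (Tight A), Loose = two_cat_co (Loose A), Incl = Incl A\<rparr>"


section \<open>Limits of loose morphisms\<close>

text \<open>
  The predicate \<open>Q\<close> restricts the 2-cells of cones: no restriction for colax limits, invertibility
  for pseudolimits.
\<close>

definition cone ::
  "('d \<Rightarrow> bool) \<Rightarrow> ('o, 'm, 'c, 'n, 'd) f_cat \<Rightarrow> 'n \<Rightarrow> 'o \<Rightarrow> 'n \<Rightarrow> 'd \<Rightarrow> 'n \<Rightarrow> bool"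
where
  "cone Q A f X r \<alpha> s \<longleftrightarrow>
     arr (Loose A) r X (Dom (Loose A) f) \<and> arr (Loose A) s X (Cod (Loose A) f) \<and>
     cell (Loose A) \<alpha> s (f \<odot>\<^bsub>Loose A\<^esub> r) \<and> Q \<alpha>"

definition induces ::
  "('o, 'm, 'c, 'n, 'd) f_cat \<Rightarrow> 'o \<Rightarrow> 'n \<Rightarrow> 'n \<Rightarrow> 'd \<Rightarrow> 'o \<Rightarrow> 'n \<Rightarrow> 'd \<Rightarrow> 'n \<Rightarrow> 'n \<Rightarrow> bool"
where
  "induces A L p q \<kappa> X r \<alpha> s t \<longleftrightarrow>
     arr (Loose A) t X L \<and> p \<odot>\<^bsub>Loose A\<^esub> t = r \<and> q \<odot>\<^bsub>Loose A\<^esub> t = s \<and> \<kappa> \<lhd>\<^bsub>Loose A\<^esub> t = \<alpha>"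

definition is_limit ::
  "('d \<Rightarrow> bool) \<Rightarrow> ('o, 'm, 'c, 'n, 'd) f_cat \<Rightarrow> 'n \<Rightarrow> 'o \<Rightarrow> 'n \<Rightarrow> 'n \<Rightarrow> 'd \<Rightarrow> bool"
where
  "is_limit Q A f L p q \<kappa> \<longleftrightarrow>
     tight A p \<and> tight A q \<and> cone Q A f L p \<kappa> q \<and>
     (\<forall>X r \<alpha> s. cone Q A f X r \<alpha> s \<longrightarrow> (\<exists>!t. induces A L p q \<kappa> X r \<alpha> s t)) \<and>
     (\<forall>X r \<alpha> s r' \<alpha>' s' t t' \<theta>r \<theta>s.
        cone Q A f X r \<alpha> s \<and> cone Q A f X r' \<alpha>' s' \<and>
        induces A L p q \<kappa> X r \<alpha> s t \<and> induces A L p q \<kappa> X r' \<alpha>' s' t' \<and>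
        cell (Loose A) \<theta>r r r' \<and> cell (Loose A) \<theta>s s s' \<and>
        \<alpha>' \<bullet>\<^bsub>Loose A\<^esub> \<theta>s = (f \<rhd>\<^bsub>Loose A\<^esub> \<theta>r) \<bullet>\<^bsub>Loose A\<^esub> \<alpha>
        \<longrightarrow> (\<exists>!\<phi>. cell (Loose A) \<phi> t t' \<and>
                p \<rhd>\<^bsub>Loose A\<^esub> \<phi> = \<theta>r \<and> q \<rhd>\<^bsub>Loose A\<^esub> \<phi> = \<theta>s)) \<and>
     (\<forall>X t. arr (Loose A) t X L \<longrightarrow>
        (tight A t \<longleftrightarrow> tight A (p \<odot>\<^bsub>Loose A\<^esub> t) \<and> tight A (q \<odot>\<^bsub>Loose A\<^esub> t)))"

definition is_colax_limit ::
  "('o, 'm, 'c, 'n, 'd) f_cat \<Rightarrow> 'n \<Rightarrow> 'o \<Rightarrow> 'n \<Rightarrow> 'n \<Rightarrow> 'd \<Rightarrow> bool"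
where
  "is_colax_limit A = is_limit (\<lambda>_. True) A"

definition is_pseudo_limit ::
  "('o, 'm, 'c, 'n, 'd) f_cat \<Rightarrow> 'n \<Rightarrow> 'o \<Rightarrow> 'n \<Rightarrow> 'n \<Rightarrow> 'd \<Rightarrow> bool"
where
  "is_pseudo_limit A = is_limit (invertible (Loose A)) A"

definition is_lax_limit ::
  "('o, 'm, 'c, 'n, 'd) f_cat \<Rightarrow> 'n \<Rightarrow> 'o \<Rightarrow> 'n \<Rightarrow> 'n \<Rightarrow> 'd \<Rightarrow> bool"
where
  "is_lax_limit A = is_colax_limit (f_cat_co A)"

datatype weakness = Strict | Pseudo | Lax | Colax

text \<open>The case \<open>Strict\<close> is never used for limits, and is left unspecified.\<close>

fun dual_weakness :: "weakness \<Rightarrow> weakness" where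
  "dual_weakness Lax = Colax"
| "dual_weakness Pseudo = Pseudo"
| "dual_weakness Colax = Lax"

fun is_weak_limit ::
  "weakness \<Rightarrow> ('o, 'm, 'c, 'n, 'd) f_cat \<Rightarrow> 'n \<Rightarrow> 'o \<Rightarrow> 'n \<Rightarrow> 'n \<Rightarrow> 'd \<Rightarrow> bool"
where
  "is_weak_limit Lax A = is_lax_limit A"
| "is_weak_limit Pseudo A = is_pseudo_limit A"
| "is_weak_limit Colax A = is_colax_limit A"

definition has_limits_of_loose_morphisms :: "weakness \<Rightarrow> ('o, 'm, 'c, 'n, 'd) f_cat \<Rightarrow> bool" where
  "has_limits_of_loose_morphisms v A \<longleftrightarrow>
     (\<forall>f \<in> Arr (Loose A). \<exists>L p q \<kappa>. is_weak_limit v A f L p q \<kappa>)"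


section \<open>2-monads and their algebras\<close>

record ('o, 'm, 'c) monad_data =
  Base :: "('o, 'm, 'c) two_cat"
  Fun :: "('o, 'm, 'c, 'o, 'm, 'c) two_map"
  Mult :: "'o \<Rightarrow> 'm"
  Unit :: "'o \<Rightarrow> 'm"

locale two_monad =
  mult: two_natural "Base T" "Base T" "Fun T \<circ>\<circ> Fun T" "Fun T" "Mult T" +
  unit: two_natural "Base T" "Base T" two_map_id "Fun T" "Unit T"
  for T :: "('o, 'm, 'c) monad_data" +
  assumes Mult_assoc: "x \<in> Obj (Base T) \<Longrightarrow>
            Mult T x \<odot>\<^bsub>Base T\<^esub> FArr (Fun T) (Mult T x)
              = Mult T x \<odot>\<^bsub>Base T\<^esub> Mult T (FObj (Fun T) x)"
    and Mult_Unit: "x \<in> Obj (Base T) \<Longrightarrow>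
            Mult T x \<odot>\<^bsub>Base T\<^esub> Unit T (FObj (Fun T) x) = Id1 (Base T) (FObj (Fun T) x)"
    and Mult_Fun_Unit: "x \<in> Obj (Base T) \<Longrightarrow>
            Mult T x \<odot>\<^bsub>Base T\<^esub> FArr (Fun T) (Unit T x) = Id1 (Base T) (FObj (Fun T) x)"

definition induced_monad ::
  "('p, 'n, 'd) two_cat \<Rightarrow> ('p, 'n, 'd, 'o, 'm, 'c) two_map \<Rightarrow> ('o, 'm, 'c, 'p, 'n, 'd) two_map
     \<Rightarrow> ('p \<Rightarrow> 'n) \<Rightarrow> ('o \<Rightarrow> 'm) \<Rightarrow> ('p, 'n, 'd) monad_data"
where
  "induced_monad B L R \<eta> \<epsilon> =
     \<lparr>Base = B, Fun = R \<circ>\<circ> L, Mult = (\<lambda>b. FArr R (\<epsilon> (FObj L b))), Unit = \<eta>\<rparr>"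

lemma (in two_adjunction) two_monad_induced: "two_monad (induced_monad B L R \<eta> \<epsilon>)"
proof -
  let ?T = "induced_monad B L R \<eta> \<epsilon>"
  have arr_Obj: "FObj L b \<in> Obj A" "FObj R (FObj L b) \<in> Obj B" if "b \<in> Obj B" for b
    using that L.FObj_Obj R.FObj_Obj by auto
  have eps: "arr A (\<epsilon> a) (FObj L (FObj R a)) a" if "a \<in> Obj A" for a
    using counit.component_arr[OF that] by (simp add: two_map_comp_def two_map_id_def)
  have eta: "arr B (\<eta> b) b (FObj R (FObj L b))" if "b \<in> Obj B" for b
    using unit.component_arr[OF that] by (simp add: two_map_comp_def two_map_id_def)
  have eps_nat: "f \<odot>\<^bsub>A\<^esub> \<epsilon> x = \<epsilon> y \<odot>\<^bsub>A\<^esub> FArr L (FArr R f)" if "arr A f x y" for f x y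
    using counit.natural_1[OF that] by (simp add: two_map_comp_def two_map_id_def)
  have eps_nat2: "\<alpha> \<lhd>\<^bsub>A\<^esub> \<epsilon> x = \<epsilon> y \<rhd>\<^bsub>A\<^esub> FCel L (FCel R \<alpha>)"
    if "cell A \<alpha> f g" "arr A f x y" for f x y \<alpha> g
    using counit.natural_2[OF that] by (simp add: two_map_comp_def two_map_id_def)
  have TT: "two_functor B B ((R \<circ>\<circ> L) \<circ>\<circ> (R \<circ>\<circ> L))"
  proof (intro two_functor.intro two_functor_axioms.intro L.C.two_category_axioms)
    let ?F = "R \<circ>\<circ> L" and ?G = "(R \<circ>\<circ> L) \<circ>\<circ> (R \<circ>\<circ> L)"
    have o: "FObj ?G x = FObj ?F (FObj ?F x)" "FArr ?G f = FArr ?F (FArr ?F f)"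
        "FCel ?G \<alpha> = FCel ?F (FCel ?F \<alpha>)" for x f \<alpha>
      by (simp_all add: two_map_comp_def)
    note [simp] = o
    show "FObj ?G x \<in> Obj B" if "x \<in> Obj B" for x
      using that unit.G.FObj_Obj by simp
    show "arr B (FArr ?G f) (FObj ?G x) (FObj ?G y)" if "arr B f x y" for f x y
      using that unit.G.FArr_arr by simp
    show "cell B (FCel ?G \<alpha>) (FArr ?G f) (FArr ?G g)" if "cell B \<alpha> f g" for f g \<alpha>
      using that unit.G.FCel_cell by simp
    show "FArr ?G (Id1 B x) = Id1 B (FObj ?G x)" if "x \<in> Obj B" for x
      using that unit.G.FArr_Id1 unit.G.FObj_Obj by simp
    show "FArr ?G (g \<odot>\<^bsub>B\<^esub> f) = FArr ?G g \<odot>\<^bsub>B\<^esub> FArr ?G f"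
      if "arr B f x y" "arr B g y z" for f g x y z
      unfolding o using unit.G.FArr_Comp[OF that] unit.G.FArr_Comp[OF unit.G.FArr_arr unit.G.FArr_arr, OF that] by simp
    show "FCel ?G (Id2 B f) = Id2 B (FArr ?G f)" if "f \<in> Arr B" for f
      using that unit.G.FCel_Id2 unit.G.FArr_arr by (simp add: arr_def)
    show "FCel ?G (\<beta> \<bullet>\<^bsub>B\<^esub> \<alpha>) = FCel ?G \<beta> \<bullet>\<^bsub>B\<^esub> FCel ?G \<alpha>"
      if "cell B \<alpha> f g" "cell B \<beta> g h" for f g h \<alpha> \<beta>
      unfolding o using unit.G.FCel_VComp[OF that] unit.G.FCel_VComp[OF unit.G.FCel_cell unit.G.FCel_cell, OF that]
      by simp
    show "FCel ?G (\<beta> \<star>\<^bsub>B\<^esub> \<alpha>) = FCel ?G \<beta> \<star>\<^bsub>B\<^esub> FCel ?G \<alpha>"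
      if "cell B \<alpha> f f'" "cell B \<beta> g g'" "Cod B f = Dom B g" for f f' g g' \<alpha> \<beta>
    proof -
      have "arr B f (Dom B f) (Cod B f)" "arr B g (Dom B g) (Cod B g)"
        using that L.C.Src_Arr by (auto simp: arr_def cell_def)
      from this[THEN unit.G.FArr_arr] have "Cod B (FArr ?F f) = Dom B (FArr ?F g)"
        using that(3) by (simp add: arr_def)
      with unit.G.FCel_HComp[OF that]
        unit.G.FCel_HComp[OF unit.G.FCel_cell unit.G.FCel_cell, OF that(1,2)] show ?thesis
        by simp
    qed
  qed
  have mult: "two_natural B B ((R \<circ>\<circ> L) \<circ>\<circ> (R \<circ>\<circ> L)) (R \<circ>\<circ> L) (\<lambda>b. FArr R (\<epsilon> (FObj L b)))"
  proof (intro two_natural.intro two_natural_axioms.intro TT unit.G.two_functor_axioms)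
    show "arr B (FArr R (\<epsilon> (FObj L x))) (FObj ((R \<circ>\<circ> L) \<circ>\<circ> (R \<circ>\<circ> L)) x) (FObj (R \<circ>\<circ> L) x)"
      if "x \<in> Obj B" for x
      using R.FArr_arr[OF eps[OF arr_Obj(1)[OF that]]] by (simp add: two_map_comp_def)
    show "FArr (R \<circ>\<circ> L) f \<odot>\<^bsub>B\<^esub> FArr R (\<epsilon> (FObj L x))
        = FArr R (\<epsilon> (FObj L y)) \<odot>\<^bsub>B\<^esub> FArr ((R \<circ>\<circ> L) \<circ>\<circ> (R \<circ>\<circ> L)) f"
      if f: "arr B f x y" for f x y
    proof -
      have xy: "FObj L x \<in> Obj A" "FObj L y \<in> Obj A"
        using f L.C.Dom_Obj L.C.Cod_Obj arr_Obj(1) by (auto simp: arr_def)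
      have Lf: "arr A (FArr L f) (FObj L x) (FObj L y)" using L.FArr_arr[OF f] .
      show ?thesis
        using arg_cong[OF eps_nat[OF Lf], of "FArr R"] R.FArr_Comp[OF eps[OF xy(1)] Lf]
          R.FArr_Comp[OF L.FArr_arr[OF R.FArr_arr[OF Lf]] eps[OF xy(2)]]
        by (simp add: two_map_comp_def)
    qed
    show "FCel (R \<circ>\<circ> L) \<alpha> \<lhd>\<^bsub>B\<^esub> FArr R (\<epsilon> (FObj L x))
        = FArr R (\<epsilon> (FObj L y)) \<rhd>\<^bsub>B\<^esub> FCel ((R \<circ>\<circ> L) \<circ>\<circ> (R \<circ>\<circ> L)) \<alpha>"
      if \<alpha>: "cell B \<alpha> f g" and f: "arr B f x y" for f g x y \<alpha>
    proof -
      have xy: "FObj L x \<in> Obj A" "FObj L y \<in> Obj A"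
        using f L.C.Dom_Obj L.C.Cod_Obj arr_Obj(1) by (auto simp: arr_def)
      have Lf: "arr A (FArr L f) (FObj L x) (FObj L y)" using L.FArr_arr[OF f] .
      have La: "cell A (FCel L \<alpha>) (FArr L f) (FArr L g)" using L.FCel_cell[OF \<alpha>] .
      have e: "\<epsilon> (FObj L x) \<in> Arr A" "\<epsilon> (FObj L y) \<in> Arr A"
        using eps xy by (auto simp: arr_def)
      have "FCel R (FCel L \<alpha> \<lhd>\<^bsub>A\<^esub> \<epsilon> (FObj L x)) = FCel R (FCel L \<alpha>) \<lhd>\<^bsub>B\<^esub> FArr R (\<epsilon> (FObj L x))"
        using R.FCel_HComp[OF L.D.Id2_cell[OF e(1)] La] R.FCel_Id2[OF e(1)] eps[OF xy(1)] Lf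
        by (simp add: arr_def)
      moreover have "FCel R (\<epsilon> (FObj L y) \<rhd>\<^bsub>A\<^esub> FCel L (FCel R (FCel L \<alpha>)))
          = FArr R (\<epsilon> (FObj L y)) \<rhd>\<^bsub>B\<^esub> FCel R (FCel L (FCel R (FCel L \<alpha>)))"
        using R.FCel_HComp[OF L.FCel_cell[OF R.FCel_cell[OF La]] L.D.Id2_cell[OF e(2)]]
          R.FCel_Id2[OF e(2)] eps[OF xy(2)] L.FArr_arr[OF R.FArr_arr[OF Lf]]
        by (simp add: arr_def)
      ultimately show ?thesis
        using eps_nat2[OF La Lf] by (simp add: two_map_comp_def)
    qed
  qed
  show ?thesis
  proof (intro two_monad.intro two_monad_axioms.intro)
    show "two_natural (Base ?T) (Base ?T) (Fun ?T \<circ>\<circ> Fun ?T) (Fun ?T) (Mult ?T)"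
      using mult by (simp add: induced_monad_def)
    show "two_natural (Base ?T) (Base ?T) two_map_id (Fun ?T) (Unit ?T)"
      using unit.two_natural_axioms by (simp add: induced_monad_def)
    fix x assume "x \<in> Obj (Base ?T)"
    then have x: "x \<in> Obj B" by (simp add: induced_monad_def)
    have e: "arr A (\<epsilon> (FObj L x)) (FObj L (FObj R (FObj L x))) (FObj L x)"
      using eps arr_Obj(1)[OF x] by blast
    show "Mult ?T x \<odot>\<^bsub>Base ?T\<^esub> FArr (Fun ?T) (Mult ?T x)
        = Mult ?T x \<odot>\<^bsub>Base ?T\<^esub> Mult ?T (FObj (Fun ?T) x)"
      using arg_cong[OF eps_nat[OF e], of "FArr R"]
        R.FArr_Comp[OF eps e] R.FArr_Comp[OF L.FArr_arr[OF R.FArr_arr[OF e]] e]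
        arr_Obj[OF arr_Obj(2)[OF x]]
      by (simp add: induced_monad_def two_map_comp_def)
    show "Mult ?T x \<odot>\<^bsub>Base ?T\<^esub> Unit ?T (FObj (Fun ?T) x) = Id1 (Base ?T) (FObj (Fun ?T) x)"
      using triangle_R[OF arr_Obj(1)[OF x]] by (simp add: induced_monad_def two_map_comp_def)
    show "Mult ?T x \<odot>\<^bsub>Base ?T\<^esub> FArr (Fun ?T) (Unit ?T x) = Id1 (Base ?T) (FObj (Fun ?T) x)"
      using arg_cong[OF triangle_L[OF x], of "FArr R"] R.FArr_Comp[OF L.FArr_arr[OF eta[OF x]] e]
        R.FArr_Id1[OF arr_Obj(1)[OF x]]
      by (simp add: induced_monad_def two_map_comp_def)
  qed
qed

type_synonym ('o, 'm) alg = "'o \<times> 'm"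

definition is_alg :: "('o, 'm, 'c) monad_data \<Rightarrow> ('o, 'm) alg \<Rightarrow> bool" where
  "is_alg T = (\<lambda>(x, a).
     x \<in> Obj (Base T) \<and> arr (Base T) a (FObj (Fun T) x) x \<and>
     a \<odot>\<^bsub>Base T\<^esub> FArr (Fun T) a = a \<odot>\<^bsub>Base T\<^esub> Mult T x \<and>
     a \<odot>\<^bsub>Base T\<^esub> Unit T x = Id1 (Base T) x)"

text \<open>
  A morphism of algebras records its domain, its codomain, its underlying 1-cell and its
  structure 2-cell; an algebra 2-cell records its source, target and underlying 2-cell.
\<close>

datatype ('o, 'm, 'c) alg_mor =
  AlgMor (alg_dom: "('o, 'm) alg") (alg_cod: "('o, 'm) alg") (und_arr: 'm) (str_cell: 'c)

datatype ('o, 'm, 'c) alg_cell =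
  AlgCell (alg_src: "('o, 'm, 'c) alg_mor") (alg_tgt: "('o, 'm, 'c) alg_mor") (und_cell: 'c)

fun lax_mor :: "('o, 'm, 'c) monad_data \<Rightarrow> ('o, 'm, 'c) alg_mor \<Rightarrow> bool" where
  "lax_mor T (AlgMor (x, a) (y, b) f f') \<longleftrightarrow>
     is_alg T (x, a) \<and> is_alg T (y, b) \<and> arr (Base T) f x y \<and>
     cell (Base T) f' (b \<odot>\<^bsub>Base T\<^esub> FArr (Fun T) f) (f \<odot>\<^bsub>Base T\<^esub> a) \<and>
     f' \<lhd>\<^bsub>Base T\<^esub> Mult T x
       = (f' \<lhd>\<^bsub>Base T\<^esub> FArr (Fun T) a) \<bullet>\<^bsub>Base T\<^esub> (b \<rhd>\<^bsub>Base T\<^esub> FCel (Fun T) f') \<and>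
     f' \<lhd>\<^bsub>Base T\<^esub> Unit T x = Id2 (Base T) f"

fun colax_mor :: "('o, 'm, 'c) monad_data \<Rightarrow> ('o, 'm, 'c) alg_mor \<Rightarrow> bool" where
  "colax_mor T (AlgMor (x, a) (y, b) f f') \<longleftrightarrow>
     is_alg T (x, a) \<and> is_alg T (y, b) \<and> arr (Base T) f x y \<and>
     cell (Base T) f' (f \<odot>\<^bsub>Base T\<^esub> a) (b \<odot>\<^bsub>Base T\<^esub> FArr (Fun T) f) \<and>
     f' \<lhd>\<^bsub>Base T\<^esub> Mult T x
       = (b \<rhd>\<^bsub>Base T\<^esub> FCel (Fun T) f') \<bullet>\<^bsub>Base T\<^esub> (f' \<lhd>\<^bsub>Base T\<^esub> FArr (Fun T) a) \<and>
     f' \<lhd>\<^bsub>Base T\<^esub> Unit T x = Id2 (Base T) f"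

fun weak_mor :: "weakness \<Rightarrow> ('o, 'm, 'c) monad_data \<Rightarrow> ('o, 'm, 'c) alg_mor \<Rightarrow> bool" where
  "weak_mor Lax T u \<longleftrightarrow> lax_mor T u"
| "weak_mor Pseudo T u \<longleftrightarrow> lax_mor T u \<and> invertible (Base T) (str_cell u)"
| "weak_mor Strict T u \<longleftrightarrow> lax_mor T u \<and> str_cell u \<in> Id2 (Base T) ` Arr (Base T)"
| "weak_mor Colax T u \<longleftrightarrow> colax_mor T u"

fun weak_cell :: "weakness \<Rightarrow> ('o, 'm, 'c) monad_data \<Rightarrow> ('o, 'm, 'c) alg_cell \<Rightarrow> bool" where
  "weak_cell w T (AlgCell u v \<alpha>) \<longleftrightarrow>
     weak_mor w T u \<and> weak_mor w T v \<and> alg_dom u = alg_dom v \<and> alg_cod u = alg_cod v \<and>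
     cell (Base T) \<alpha> (und_arr u) (und_arr v) \<and>
     (let a = snd (alg_dom u); b = snd (alg_cod u) in
      if w = Colax then
        str_cell v \<bullet>\<^bsub>Base T\<^esub> (\<alpha> \<lhd>\<^bsub>Base T\<^esub> a)
          = (b \<rhd>\<^bsub>Base T\<^esub> FCel (Fun T) \<alpha>) \<bullet>\<^bsub>Base T\<^esub> str_cell u
      else
        (\<alpha> \<lhd>\<^bsub>Base T\<^esub> a) \<bullet>\<^bsub>Base T\<^esub> str_cell u
          = str_cell v \<bullet>\<^bsub>Base T\<^esub> (b \<rhd>\<^bsub>Base T\<^esub> FCel (Fun T) \<alpha>))"

definition alg_mor_comp ::
  "weakness \<Rightarrow> ('o, 'm, 'c) monad_data \<Rightarrow> ('o, 'm, 'c) alg_mor \<Rightarrow> ('o, 'm, 'c) alg_mor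
     \<Rightarrow> ('o, 'm, 'c) alg_mor"
where
  "alg_mor_comp w T v u =
     AlgMor (alg_dom u) (alg_cod v) (und_arr v \<odot>\<^bsub>Base T\<^esub> und_arr u)
       (let \<sigma> = und_arr v \<rhd>\<^bsub>Base T\<^esub> str_cell u;
            \<tau> = str_cell v \<lhd>\<^bsub>Base T\<^esub> FArr (Fun T) (und_arr u)
        in if w = Colax then \<tau> \<bullet>\<^bsub>Base T\<^esub> \<sigma> else \<sigma> \<bullet>\<^bsub>Base T\<^esub> \<tau>)"

definition alg_mor_id :: "('o, 'm, 'c) monad_data \<Rightarrow> ('o, 'm) alg \<Rightarrow> ('o, 'm, 'c) alg_mor" where
  "alg_mor_id T X = AlgMor X X (Id1 (Base T) (fst X)) (Id2 (Base T) (snd X))"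

definition TAlg ::
  "weakness \<Rightarrow> ('o, 'm, 'c) monad_data
     \<Rightarrow> (('o, 'm) alg, ('o, 'm, 'c) alg_mor, ('o, 'm, 'c) alg_cell) two_cat"
where
  "TAlg w T =
     \<lparr>Obj = {X. is_alg T X},
      Arr = {u. weak_mor w T u},
      Cel = {\<theta>. weak_cell w T \<theta>},
      Dom = alg_dom,
      Cod = alg_cod,
      Src = alg_src,
      Tgt = alg_tgt,
      Id1 = alg_mor_id T,
      Id2 = (\<lambda>u. AlgCell u u (Id2 (Base T) (und_arr u))),
      Comp = alg_mor_comp w T,
      VComp = (\<lambda>\<theta> \<psi>. AlgCell (alg_src \<psi>) (alg_tgt \<theta>) (und_cell \<theta> \<bullet>\<^bsub>Base T\<^esub> und_cell \<psi>)),
      HComp = (\<lambda>\<theta> \<psi>. AlgCell (alg_mor_comp w T (alg_src \<theta>) (alg_src \<psi>))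
                       (alg_mor_comp w T (alg_tgt \<theta>) (alg_tgt \<psi>))
                       (und_cell \<theta> \<star>\<^bsub>Base T\<^esub> und_cell \<psi>))\<rparr>"

text \<open>
  A strict morphism is also a colax one with the same data, its structure 2-cell being an identity,
  so that the inclusion of \<open>TAlg Strict T\<close> is the identity on cells also for \<open>w = Colax\<close>.
\<close>

definition TAlg_F ::
  "weakness \<Rightarrow> ('o, 'm, 'c) monad_data
     \<Rightarrow> (('o, 'm) alg, ('o, 'm, 'c) alg_mor, ('o, 'm, 'c) alg_cell,
         ('o, 'm, 'c) alg_mor, ('o, 'm, 'c) alg_cell) f_cat"
where
  "TAlg_F w T = \<lparr>Tight = TAlg Strict T, Loose = TAlg w T, Incl = two_map_id\<rparr>"

definition forgetful ::
  "(('o, 'm) alg, ('o, 'm, 'c) alg_mor, ('o, 'm, 'c) alg_cell, 'o, 'm, 'c) two_map"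
where
  "forgetful = \<lparr>FObj = fst, FArr = und_arr, FCel = und_cell\<rparr>"

text \<open>
  The Eilenberg--Moore comparison sends \<open>x\<close> to the algebra \<open>(R x, R (\<epsilon> x))\<close> and a 1-cell \<open>f\<close>
  to \<open>R f\<close>, regarded as a strict morphism.
\<close>

definition EM_obj ::
  "('o, 'm, 'c, 'p, 'n, 'd) two_map \<Rightarrow> ('o \<Rightarrow> 'm) \<Rightarrow> 'o \<Rightarrow> ('p, 'n) alg"
where
  "EM_obj R \<epsilon> x = (FObj R x, FArr R (\<epsilon> x))"

definition EM_arr ::
  "('o, 'm, 'c) two_cat \<Rightarrow> ('p, 'n, 'd) two_cat \<Rightarrow> ('o, 'm, 'c, 'p, 'n, 'd) two_map
     \<Rightarrow> ('o \<Rightarrow> 'm) \<Rightarrow> 'm \<Rightarrow> ('p, 'n, 'd) alg_mor"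
where
  "EM_arr A B R \<epsilon> f =
     AlgMor (EM_obj R \<epsilon> (Dom A f)) (EM_obj R \<epsilon> (Cod A f)) (FArr R f)
       (Id2 B (FArr R f \<odot>\<^bsub>B\<^esub> FArr R (\<epsilon> (Dom A f))))"

definition EM_comparison ::
  "('o, 'm, 'c) two_cat \<Rightarrow> ('p, 'n, 'd) two_cat \<Rightarrow> ('o, 'm, 'c, 'p, 'n, 'd) two_map
     \<Rightarrow> ('o \<Rightarrow> 'm) \<Rightarrow> ('o, 'm, 'c, ('p, 'n) alg, ('p, 'n, 'd) alg_mor, ('p, 'n, 'd) alg_cell) two_map"
where
  "EM_comparison A B R \<epsilon> =
     \<lparr>FObj = EM_obj R \<epsilon>,
      FArr = EM_arr A B R \<epsilon>,
      FCel = (\<lambda>\<alpha>. AlgCell (EM_arr A B R \<epsilon> (Src A \<alpha>)) (EM_arr A B R \<epsilon> (Tgt A \<alpha>)) (FCel R \<alpha>))\<rparr>"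

text \<open>\<open>E\<^sub>w\<close> is an \<open>\<F>\<close>-functor extending \<open>E\<close> and lying over the base 2-category.\<close>

definition is_extension_over_base ::
  "weakness \<Rightarrow> ('p, 'k, 'e) monad_data \<Rightarrow> ('o, 'm, 'c, 'n, 'd) f_cat
     \<Rightarrow> ('o, 'n, 'd, 'p, 'k, 'e) two_map
     \<Rightarrow> ('o, 'm, 'c, ('p, 'k) alg, ('p, 'k, 'e) alg_mor, ('p, 'k, 'e) alg_cell) two_map
     \<Rightarrow> ('o, 'n, 'd, ('p, 'k) alg, ('p, 'k, 'e) alg_mor, ('p, 'k, 'e) alg_cell) two_map \<Rightarrow> bool"
where
  "is_extension_over_base w T A H E E\<^sub>w \<longleftrightarrow>
     f_functor A (TAlg_F w T) E\<^sub>w \<and>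
     two_map_eq (Tight A) (E\<^sub>w \<circ>\<circ> Incl A) (Incl (TAlg_F w T) \<circ>\<circ> E) \<and>
     two_map_eq (Loose A) (forgetful \<circ>\<circ> E\<^sub>w) H"

end

theory Submission
  imports Defs
begin

text \<open>
  Consider the lax case, and let \<open>f : A \<leadsto> B\<close> be loose with colax limit
  \<open>p : C \<rightarrow> A\<close>, \<open>q : C \<rightarrow> B\<close>, \<open>\<kappa> : q \<Rightarrow> f p\<close>. The cone \<open>(1, id, f)\<close> induces a loose
  \<open>t : A \<leadsto> C\<close> with \<open>p t = 1\<close>, \<open>q t = f\<close>, \<open>\<kappa> t = id\<close>, and the 2-dimensional part of the universal
  property gives \<open>u : 1 \<Rightarrow> t p\<close> with \<open>p u = id\<close> and \<open>q u = \<kappa>\<close>. Thus every loose morphism is a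
  composite \<open>q t\<close> of a tight morphism with a right adjoint of a tight morphism
  (\<open>limit_resolution\<close>). An extension of \<open>E\<close> makes \<open>p\<close> and \<open>q\<close> strict, and by doctrinal adjunction
  a right adjoint of a strict morphism carries exactly one lax structure, the mate of an identity.
  So the structure 2-cell of \<open>f\<close> has to be \<open>H\<kappa>\<close> whiskered with \<open>c \<circ> T(Ht)\<close>, where \<open>c\<close> is the
  algebra structure of \<open>C\<close>; this is the definition of \<open>mate\<close>, and it gives uniqueness.

  For existence, the point is that the mate makes every 2-cell \<open>\<beta> : s \<Rightarrow> f r\<close> with \<open>r\<close> and \<open>s\<close>
  tight into an algebra 2-cell. For \<open>\<beta> = \<kappa>\<close> this is an interchange argument using \<open>u\<close>
  (\<open>compatible_mate\<close>), and the other cones with tight legs factor through \<open>\<kappa>\<close> by a tight morphism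
  (\<open>compatible_cone\<close>). In the pseudo case a non-invertible \<open>\<beta>\<close> is not a cone; it is then compared
  with the pseudolimit of \<open>f r\<close> (\<open>compatible_all\<close>). This property characterises the structure
  2-cell independently of the chosen limit, and the axioms for lax morphisms, for algebra 2-cells
  and for compositionality all follow from it: paste the relevant data into some \<open>\<beta>\<close> with tight
  legs and whisker with a section such as \<open>t\<close> (\<open>str_mult\<close>, \<open>str_natural\<close>, \<open>str_Comp\<close>).

  The colax case is the lax case with all 2-cells reversed. The argument is carried out for an
  arbitrary 2-monad \<open>T\<close> and an arbitrary 2-functor \<open>E\<close> lifting \<open>H\<^sub>\<tau>\<close> to strict algebras
  (\<open>strict_lift.unique_extension\<close>); the adjunction supplies \<open>T\<close> and \<open>E\<close>.
\<close>

section \<open>Whiskering in a strict 2-category\<close>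

lemma two_map_comp_simps [simp]:
  "FObj (G \<circ>\<circ> F) x = FObj G (FObj F x)"
  "FArr (G \<circ>\<circ> F) f = FArr G (FArr F f)"
  "FCel (G \<circ>\<circ> F) \<alpha> = FCel G (FCel F \<alpha>)"
  by (simp_all add: two_map_comp_def)

lemma two_map_id_simps [simp]:
  "FObj two_map_id x = x" "FArr two_map_id f = f" "FCel two_map_id \<alpha> = \<alpha>"
  by (simp_all add: two_map_id_def)

text \<open>
  The laws are restated with the typing conditions expressed through \<open>Dom\<close>, \<open>Cod\<close>, \<open>Src\<close> and
  \<open>Tgt\<close>, so that no premise contains a variable absent from the conclusion and the simplifier can
  check the typing by itself. It then brings pastings into the form of a right-nested vertical
  composite of whiskerings \<open>h \<rhd> (\<alpha> \<lhd> k)\<close>.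
\<close>

context two_category
begin

lemma arrI: "f \<in> Arr C \<Longrightarrow> arr C f (Dom C f) (Cod C f)"
  by (simp add: arr_def)

lemma cellI: "\<alpha> \<in> Cel C \<Longrightarrow> cell C \<alpha> (Src C \<alpha>) (Tgt C \<alpha>)"
  by (simp add: cell_def)

lemmas boundary_simps [simp] = Dom_Obj Cod_Obj Src_Arr Tgt_Arr Dom_Tgt Cod_Tgt

lemma Id1_simps [simp]:
  assumes "x \<in> Obj C"
  shows "Id1 C x \<in> Arr C" "Dom C (Id1 C x) = x" "Cod C (Id1 C x) = x"
  using Id1_arr[OF assms] by (simp_all add: arr_def)

lemma Comp_simps [simp]:
  assumes "f \<in> Arr C" "g \<in> Arr C" "Cod C f = Dom C g"
  shows "g \<odot> f \<in> Arr C" "Dom C (g \<odot> f) = Dom C f" "Cod C (g \<odot> f) = Cod C g"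
  using Comp_arr[of f "Dom C f" "Cod C f" g "Cod C g"] assms by (simp_all add: arr_def)

lemma Comp_Id1_simps [simp]:
  "f \<in> Arr C \<Longrightarrow> Dom C f = x \<Longrightarrow> f \<odot> Id1 C x = f"
  "f \<in> Arr C \<Longrightarrow> Cod C f = y \<Longrightarrow> Id1 C y \<odot> f = f"
  using Comp_Id1[of f x] Id1_Comp[of f _ y] by (auto simp: arr_def)

lemma Comp_assoc_simp [simp]:
  assumes "f \<in> Arr C" "g \<in> Arr C" "h \<in> Arr C" "Cod C f = Dom C g" "Cod C g = Dom C h"
  shows "(h \<odot> g) \<odot> f = h \<odot> (g \<odot> f)"
  using Comp_assoc[of f "Dom C f" "Cod C f" g "Cod C g" h "Cod C h"] assms by (simp add: arr_def)

text \<open>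
  The simplifier nests composites to the right, which hides the left-hand side of an equation
  between composites; the equation is needed with an arbitrary tail.
\<close>

lemma Comp_eq_extend:
  assumes "g \<odot> h = g' \<odot> h'"
    and "g \<in> Arr C" "h \<in> Arr C" "Cod C h = Dom C g" "g' \<in> Arr C" "h' \<in> Arr C" "Cod C h' = Dom C g'"
    and "k \<in> Arr C" "Cod C k = Dom C h"
  shows "g \<odot> (h \<odot> k) = g' \<odot> (h' \<odot> k)"
proof -
  have "Dom C h = Dom C h'" by (metis assms(1-7) Comp_simps(2))
  then have "g \<odot> (h \<odot> k) = (g \<odot> h) \<odot> k" "g' \<odot> (h' \<odot> k) = (g' \<odot> h') \<odot> k"
    using assms(2-) by simp_all
  then show ?thesis using assms(1) by simp
qed

lemma Id2_simps [simp]: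
  assumes "f \<in> Arr C"
  shows "Id2 C f \<in> Cel C" "Src C (Id2 C f) = f" "Tgt C (Id2 C f) = f"
  using Id2_cell[OF assms] by (simp_all add: cell_def)

lemma VComp_simps [simp]:
  assumes "\<alpha> \<in> Cel C" "\<beta> \<in> Cel C" "Tgt C \<alpha> = Src C \<beta>"
  shows "\<beta> \<bullet> \<alpha> \<in> Cel C" "Src C (\<beta> \<bullet> \<alpha>) = Src C \<alpha>" "Tgt C (\<beta> \<bullet> \<alpha>) = Tgt C \<beta>"
  using VComp_cell[of \<alpha> "Src C \<alpha>" "Tgt C \<alpha>" \<beta> "Tgt C \<beta>"] assms by (simp_all add: cell_def)

lemma VComp_Id2_simps [simp]:
  "\<alpha> \<in> Cel C \<Longrightarrow> Src C \<alpha> = f \<Longrightarrow> \<alpha> \<bullet> Id2 C f = \<alpha>"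
  "\<alpha> \<in> Cel C \<Longrightarrow> Tgt C \<alpha> = g \<Longrightarrow> Id2 C g \<bullet> \<alpha> = \<alpha>"
  using VComp_Id2[of \<alpha> f] Id2_VComp[of \<alpha> _ g] by (auto simp: cell_def)

lemma VComp_assoc_simp [simp]:
  assumes "\<alpha> \<in> Cel C" "\<beta> \<in> Cel C" "\<gamma> \<in> Cel C" "Tgt C \<alpha> = Src C \<beta>" "Tgt C \<beta> = Src C \<gamma>"
  shows "(\<gamma> \<bullet> \<beta>) \<bullet> \<alpha> = \<gamma> \<bullet> (\<beta> \<bullet> \<alpha>)"
  using VComp_assoc[of \<alpha> "Src C \<alpha>" "Tgt C \<alpha>" \<beta> "Tgt C \<beta>" \<gamma> "Tgt C \<gamma>"] assms
  by (simp add: cell_def)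

lemma VComp_eq_extend:
  assumes "\<delta> \<bullet> \<gamma> = \<delta>' \<bullet> \<gamma>'"
    and "\<delta> \<in> Cel C" "\<gamma> \<in> Cel C" "Tgt C \<gamma> = Src C \<delta>" "\<delta>' \<in> Cel C" "\<gamma>' \<in> Cel C" "Tgt C \<gamma>' = Src C \<delta>'"
    and "\<rho> \<in> Cel C" "Tgt C \<rho> = Src C \<gamma>"
  shows "\<delta> \<bullet> (\<gamma> \<bullet> \<rho>) = \<delta>' \<bullet> (\<gamma>' \<bullet> \<rho>)"
proof -
  have "Src C \<gamma> = Src C \<gamma>'" by (metis assms(1-7) VComp_simps(2))
  then have "\<delta> \<bullet> (\<gamma> \<bullet> \<rho>) = (\<delta> \<bullet> \<gamma>) \<bullet> \<rho>" "\<delta>' \<bullet> (\<gamma>' \<bullet> \<rho>) = (\<delta>' \<bullet> \<gamma>') \<bullet> \<rho>"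
    using assms(2-) by simp_all
  then show ?thesis using assms(1) by simp
qed

lemma HComp_simps [simp]:
  assumes "\<alpha> \<in> Cel C" "\<beta> \<in> Cel C" "Cod C (Src C \<alpha>) = Dom C (Src C \<beta>)"
  shows "\<beta> \<star> \<alpha> \<in> Cel C" "Src C (\<beta> \<star> \<alpha>) = Src C \<beta> \<odot> Src C \<alpha>"
    "Tgt C (\<beta> \<star> \<alpha>) = Tgt C \<beta> \<odot> Tgt C \<alpha>"
  using HComp_cell[OF cellI[OF assms(1)] cellI[OF assms(2)] assms(3)] by (simp_all add: cell_def)

lemma HComp_Id_simps [simp]:
  "\<alpha> \<in> Cel C \<Longrightarrow> Dom C (Src C \<alpha>) = x \<Longrightarrow> \<alpha> \<star> Id2 C (Id1 C x) = \<alpha>"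
  "\<alpha> \<in> Cel C \<Longrightarrow> Cod C (Src C \<alpha>) = y \<Longrightarrow> Id2 C (Id1 C y) \<star> \<alpha> = \<alpha>"
  using HComp_Id[of \<alpha> _ _ x] Id_HComp[of \<alpha> _ _ y] by (auto simp: cell_def)

lemma HComp_assoc_simp [simp]:
  assumes "\<alpha> \<in> Cel C" "\<beta> \<in> Cel C" "\<gamma> \<in> Cel C"
    "Cod C (Src C \<alpha>) = Dom C (Src C \<beta>)" "Cod C (Src C \<beta>) = Dom C (Src C \<gamma>)"
  shows "(\<gamma> \<star> \<beta>) \<star> \<alpha> = \<gamma> \<star> (\<beta> \<star> \<alpha>)"
  using HComp_assoc[OF cellI[OF assms(1)] cellI[OF assms(2)] cellI[OF assms(3)] assms(4,5)] .

lemma HComp_Id2_simp [simp]: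
  assumes "f \<in> Arr C" "g \<in> Arr C" "Cod C f = Dom C g"
  shows "Id2 C g \<star> Id2 C f = Id2 C (g \<odot> f)"
  using HComp_Id2[of f "Dom C f" "Cod C f" g "Cod C g"] assms by (simp add: arr_def)

lemma lwhisk_lwhisk [simp]:
  assumes "\<alpha> \<in> Cel C" "f \<in> Arr C" "g \<in> Arr C" "Cod C (Src C \<alpha>) = Dom C f" "Cod C f = Dom C g"
  shows "g \<rhd> f \<rhd> \<alpha> = (g \<odot> f) \<rhd> \<alpha>"
  using HComp_assoc_simp[of \<alpha> "Id2 C f" "Id2 C g"] assms by simp

lemma lwhisk_VComp [simp]:
  assumes "\<alpha> \<in> Cel C" "\<beta> \<in> Cel C" "Tgt C \<alpha> = Src C \<beta>" "h \<in> Arr C" "Cod C (Src C \<alpha>) = Dom C h"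
  shows "h \<rhd> (\<beta> \<bullet> \<alpha>) = (h \<rhd> \<beta>) \<bullet> (h \<rhd> \<alpha>)"
  using interchange[of \<alpha> "Src C \<alpha>" "Tgt C \<alpha>" \<beta> "Tgt C \<beta>" "Id2 C h" h h "Id2 C h" h] assms
  by (simp add: cell_def)

lemma rwhisk_VComp [simp]:
  assumes "\<alpha> \<in> Cel C" "\<beta> \<in> Cel C" "Tgt C \<alpha> = Src C \<beta>" "k \<in> Arr C" "Dom C (Src C \<alpha>) = Cod C k"
  shows "(\<beta> \<bullet> \<alpha>) \<lhd> k = (\<beta> \<lhd> k) \<bullet> (\<alpha> \<lhd> k)"
  using interchange[of "Id2 C k" k k "Id2 C k" k \<alpha> "Src C \<alpha>" "Tgt C \<alpha>" \<beta> "Tgt C \<beta>"] assms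
  by (simp add: cell_def)

lemma interchange_cells:
  assumes "\<alpha> \<in> Cel C" "\<alpha>' \<in> Cel C" "\<beta> \<in> Cel C" "\<beta>' \<in> Cel C"
    "Tgt C \<alpha> = Src C \<alpha>'" "Tgt C \<beta> = Src C \<beta>'" "Cod C (Src C \<alpha>) = Dom C (Src C \<beta>)"
  shows "(\<beta>' \<bullet> \<beta>) \<star> (\<alpha>' \<bullet> \<alpha>) = (\<beta>' \<star> \<alpha>') \<bullet> (\<beta> \<star> \<alpha>)"
  using interchange[of \<alpha> "Src C \<alpha>" "Tgt C \<alpha>" \<alpha>' "Tgt C \<alpha>'" \<beta> "Src C \<beta>" "Tgt C \<beta>" \<beta>' "Tgt C \<beta>'"]
    assms by (simp add: cell_def)

lemma HComp_eq_VComp: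
  assumes "\<alpha> \<in> Cel C" "\<beta> \<in> Cel C" "Cod C (Src C \<alpha>) = Dom C (Src C \<beta>)"
  shows "\<beta> \<star> \<alpha> = (\<beta> \<lhd> Tgt C \<alpha>) \<bullet> (Src C \<beta> \<rhd> \<alpha>)"
    and "\<beta> \<star> \<alpha> = (Tgt C \<beta> \<rhd> \<alpha>) \<bullet> (\<beta> \<lhd> Src C \<alpha>)"
  using interchange[of \<alpha> "Src C \<alpha>" "Tgt C \<alpha>" "Id2 C (Tgt C \<alpha>)" "Tgt C \<alpha>"
      "Id2 C (Src C \<beta>)" "Src C \<beta>" "Src C \<beta>" \<beta> "Tgt C \<beta>"]
    interchange[of "Id2 C (Src C \<alpha>)" "Src C \<alpha>" "Src C \<alpha>" \<alpha> "Tgt C \<alpha>"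
      \<beta> "Src C \<beta>" "Tgt C \<beta>" "Id2 C (Tgt C \<beta>)" "Tgt C \<beta>"] assms
  by (simp_all add: cell_def)

text \<open>
  Both sides are the horizontal composite \<open>\<beta> \<star> \<alpha>\<close>.
\<close>

lemma whisker_exchange:
  assumes "\<alpha> \<in> Cel C" "\<beta> \<in> Cel C" "Cod C (Src C \<alpha>) = Dom C (Src C \<beta>)"
    "Src C \<alpha> = f" "Tgt C \<alpha> = f'" "Src C \<beta> = g" "Tgt C \<beta> = g'"
  shows "(g' \<rhd> \<alpha>) \<bullet> (\<beta> \<lhd> f) = (\<beta> \<lhd> f') \<bullet> (g \<rhd> \<alpha>)"
  using HComp_eq_VComp[OF assms(1-3)] assms(4-) by simp

lemma invertible_Id2: "f \<in> Arr C \<Longrightarrow> invertible C (Id2 C f)"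
  unfolding invertible_def by (auto simp: cell_def intro!: exI[of _ "Id2 C f"])

lemma invertible_VComp:
  assumes "invertible C \<alpha>" "invertible C \<beta>" "Tgt C \<alpha> = Src C \<beta>"
  shows "invertible C (\<beta> \<bullet> \<alpha>)"
proof -
  obtain \<alpha>' \<beta>' where inv: "\<alpha> \<in> Cel C" "\<beta> \<in> Cel C" "cell C \<alpha>' (Tgt C \<alpha>) (Src C \<alpha>)"
      "cell C \<beta>' (Tgt C \<beta>) (Src C \<beta>)"
      "\<alpha>' \<bullet> \<alpha> = Id2 C (Src C \<alpha>)" "\<alpha> \<bullet> \<alpha>' = Id2 C (Tgt C \<alpha>)"
      "\<beta>' \<bullet> \<beta> = Id2 C (Src C \<beta>)" "\<beta> \<bullet> \<beta>' = Id2 C (Tgt C \<beta>)"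
    using assms unfolding invertible_def by blast
  have "\<beta>' \<bullet> (\<beta> \<bullet> \<alpha>) = \<alpha>" "\<alpha> \<bullet> (\<alpha>' \<bullet> \<beta>') = \<beta>'"
    using inv assms(3) VComp_assoc_simp[of \<alpha> \<beta> \<beta>'] VComp_assoc_simp[of \<beta>' \<alpha>' \<alpha>]
    by (simp_all add: cell_def)
  with inv assms(3) show ?thesis
    unfolding invertible_def by (auto simp: cell_def intro!: exI[of _ "\<alpha>' \<bullet> \<beta>'"])
qed

lemma invertible_lwhisk:
  assumes "invertible C \<alpha>" "h \<in> Arr C" "Cod C (Src C \<alpha>) = Dom C h"
  shows "invertible C (h \<rhd> \<alpha>)"
proof -
  obtain \<alpha>' where inv: "\<alpha> \<in> Cel C" "cell C \<alpha>' (Tgt C \<alpha>) (Src C \<alpha>)"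
      "\<alpha>' \<bullet> \<alpha> = Id2 C (Src C \<alpha>)" "\<alpha> \<bullet> \<alpha>' = Id2 C (Tgt C \<alpha>)"
    using assms unfolding invertible_def by blast
  have "(h \<rhd> \<alpha>') \<bullet> (h \<rhd> \<alpha>) = h \<rhd> (\<alpha>' \<bullet> \<alpha>)" "(h \<rhd> \<alpha>) \<bullet> (h \<rhd> \<alpha>') = h \<rhd> (\<alpha> \<bullet> \<alpha>')"
    using inv(1,2) assms(2,3) by (simp_all add: cell_def)
  with inv assms(2,3) show ?thesis
    unfolding invertible_def by (auto simp: cell_def intro!: exI[of _ "h \<rhd> \<alpha>'"])
qed

lemma invertible_rwhisk:
  assumes "invertible C \<alpha>" "k \<in> Arr C" "Dom C (Src C \<alpha>) = Cod C k"
  shows "invertible C (\<alpha> \<lhd> k)"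
proof -
  obtain \<alpha>' where inv: "\<alpha> \<in> Cel C" "cell C \<alpha>' (Tgt C \<alpha>) (Src C \<alpha>)"
      "\<alpha>' \<bullet> \<alpha> = Id2 C (Src C \<alpha>)" "\<alpha> \<bullet> \<alpha>' = Id2 C (Tgt C \<alpha>)"
    using assms unfolding invertible_def by blast
  have "(\<alpha>' \<lhd> k) \<bullet> (\<alpha> \<lhd> k) = (\<alpha>' \<bullet> \<alpha>) \<lhd> k" "(\<alpha> \<lhd> k) \<bullet> (\<alpha>' \<lhd> k) = (\<alpha> \<bullet> \<alpha>') \<lhd> k"
    using inv(1,2) assms(2,3) by (simp_all add: cell_def)
  with inv assms(2,3) show ?thesis
    unfolding invertible_def by (auto simp: cell_def intro!: exI[of _ "\<alpha>' \<lhd> k"])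
qed

end

context two_functor
begin

lemma FArr_simps [simp]:
  assumes "f \<in> Arr C"
  shows "FArr F f \<in> Arr D" "Dom D (FArr F f) = FObj F (Dom C f)" "Cod D (FArr F f) = FObj F (Cod C f)"
  using FArr_arr[OF C.arrI[OF assms]] by (simp_all add: arr_def)

lemma FCel_simps [simp]:
  assumes "\<alpha> \<in> Cel C"
  shows "FCel F \<alpha> \<in> Cel D" "Src D (FCel F \<alpha>) = FArr F (Src C \<alpha>)" "Tgt D (FCel F \<alpha>) = FArr F (Tgt C \<alpha>)"
  using FCel_cell[OF C.cellI[OF assms]] by (simp_all add: cell_def)

lemmas functor_simps [simp] = FObj_Obj FArr_Id1 FCel_Id2

lemma FArr_Comp_simp [simp]:
  "\<lbrakk>f \<in> Arr C; g \<in> Arr C; Cod C f = Dom C g\<rbrakk> \<Longrightarrow> FArr F (g \<odot>\<^bsub>C\<^esub> f) = FArr F g \<odot>\<^bsub>D\<^esub> FArr F f"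
  by (rule FArr_Comp) (auto simp: arr_def)

lemma FCel_VComp_simp [simp]:
  "\<lbrakk>\<alpha> \<in> Cel C; \<beta> \<in> Cel C; Tgt C \<alpha> = Src C \<beta>\<rbrakk>
    \<Longrightarrow> FCel F (\<beta> \<bullet>\<^bsub>C\<^esub> \<alpha>) = FCel F \<beta> \<bullet>\<^bsub>D\<^esub> FCel F \<alpha>"
  by (rule FCel_VComp) (auto simp: cell_def)

lemma FCel_HComp_simp [simp]:
  "\<lbrakk>\<alpha> \<in> Cel C; \<beta> \<in> Cel C; Cod C (Src C \<alpha>) = Dom C (Src C \<beta>)\<rbrakk>
    \<Longrightarrow> FCel F (\<beta> \<star>\<^bsub>C\<^esub> \<alpha>) = FCel F \<beta> \<star>\<^bsub>D\<^esub> FCel F \<alpha>"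
  by (rule FCel_HComp) (auto simp: cell_def)

lemma invertible_FCel: "invertible C \<alpha> \<Longrightarrow> invertible D (FCel F \<alpha>)"
proof -
  assume "invertible C \<alpha>"
  then obtain \<alpha>' where inv: "\<alpha> \<in> Cel C" "cell C \<alpha>' (Tgt C \<alpha>) (Src C \<alpha>)"
      "\<alpha>' \<bullet>\<^bsub>C\<^esub> \<alpha> = Id2 C (Src C \<alpha>)" "\<alpha> \<bullet>\<^bsub>C\<^esub> \<alpha>' = Id2 C (Tgt C \<alpha>)"
    unfolding invertible_def by blast
  have "FCel F \<alpha>' \<bullet>\<^bsub>D\<^esub> FCel F \<alpha> = FCel F (\<alpha>' \<bullet>\<^bsub>C\<^esub> \<alpha>)"
      "FCel F \<alpha> \<bullet>\<^bsub>D\<^esub> FCel F \<alpha>' = FCel F (\<alpha> \<bullet>\<^bsub>C\<^esub> \<alpha>')"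
    using inv(1,2) by (simp_all add: cell_def)
  with inv show ?thesis
    unfolding invertible_def by (auto simp: cell_def intro!: exI[of _ "FCel F \<alpha>'"])
qed

end

context two_natural
begin

lemma component_simps [simp]:
  assumes "x \<in> Obj C"
  shows "t x \<in> Arr D" "Dom D (t x) = FObj F x" "Cod D (t x) = FObj G x"
  using component_arr[OF assms] by (simp_all add: arr_def)

lemma naturality_1: "f \<in> Arr C \<Longrightarrow> FArr G f \<odot>\<^bsub>D\<^esub> t (Dom C f) = t (Cod C f) \<odot>\<^bsub>D\<^esub> FArr F f"
  by (rule natural_1) (simp add: arr_def)

lemma naturality_2:
  "\<alpha> \<in> Cel C \<Longrightarrow>
    FCel G \<alpha> \<lhd>\<^bsub>D\<^esub> t (Dom C (Src C \<alpha>)) = t (Cod C (Src C \<alpha>)) \<rhd>\<^bsub>D\<^esub> FCel F \<alpha>"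
  by (rule natural_2[of _ "Src C \<alpha>" "Tgt C \<alpha>"]) (auto simp: arr_def cell_def)

end

section \<open>Lax morphisms of algebras and their 2-cells\<close>

context two_monad
begin

abbreviation B where "B \<equiv> Base T"
abbreviation TO where "TO \<equiv> FObj (Fun T)"
abbreviation TA where "TA \<equiv> FArr (Fun T)"
abbreviation TC where "TC \<equiv> FCel (Fun T)"

lemma algD:
  assumes "is_alg T X"
  shows "fst X \<in> Obj B" "snd X \<in> Arr B" "Dom B (snd X) = TO (fst X)" "Cod B (snd X) = fst X"
    "snd X \<odot>\<^bsub>B\<^esub> TA (snd X) = snd X \<odot>\<^bsub>B\<^esub> Mult T (fst X)"
    "snd X \<odot>\<^bsub>B\<^esub> Unit T (fst X) = Id1 B (fst X)"
  using assms by (auto simp: is_alg_def arr_def split: prod.splits)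

lemma lax_mor_iff:
  "lax_mor T u \<longleftrightarrow>
     is_alg T (alg_dom u) \<and> is_alg T (alg_cod u) \<and>
     und_arr u \<in> Arr B \<and> Dom B (und_arr u) = fst (alg_dom u) \<and> Cod B (und_arr u) = fst (alg_cod u) \<and>
     str_cell u \<in> Cel B \<and>
     Src B (str_cell u) = snd (alg_cod u) \<odot>\<^bsub>B\<^esub> TA (und_arr u) \<and>
     Tgt B (str_cell u) = und_arr u \<odot>\<^bsub>B\<^esub> snd (alg_dom u) \<and>
     str_cell u \<lhd>\<^bsub>B\<^esub> Mult T (fst (alg_dom u))
       = (str_cell u \<lhd>\<^bsub>B\<^esub> TA (snd (alg_dom u))) \<bullet>\<^bsub>B\<^esub> (snd (alg_cod u) \<rhd>\<^bsub>B\<^esub> TC (str_cell u)) \<and>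
     str_cell u \<lhd>\<^bsub>B\<^esub> Unit T (fst (alg_dom u)) = Id2 B (und_arr u)"
  by (cases u; cases "alg_dom u"; cases "alg_cod u") (auto simp: arr_def cell_def)

lemma colax_mor_iff:
  "colax_mor T u \<longleftrightarrow>
     is_alg T (alg_dom u) \<and> is_alg T (alg_cod u) \<and>
     und_arr u \<in> Arr B \<and> Dom B (und_arr u) = fst (alg_dom u) \<and> Cod B (und_arr u) = fst (alg_cod u) \<and>
     str_cell u \<in> Cel B \<and>
     Tgt B (str_cell u) = snd (alg_cod u) \<odot>\<^bsub>B\<^esub> TA (und_arr u) \<and>
     Src B (str_cell u) = und_arr u \<odot>\<^bsub>B\<^esub> snd (alg_dom u) \<and>
     str_cell u \<lhd>\<^bsub>B\<^esub> Mult T (fst (alg_dom u))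
       = (snd (alg_cod u) \<rhd>\<^bsub>B\<^esub> TC (str_cell u)) \<bullet>\<^bsub>B\<^esub> (str_cell u \<lhd>\<^bsub>B\<^esub> TA (snd (alg_dom u))) \<and>
     str_cell u \<lhd>\<^bsub>B\<^esub> Unit T (fst (alg_dom u)) = Id2 B (und_arr u)"
  by (cases u; cases "alg_dom u"; cases "alg_cod u") (auto simp: arr_def cell_def)

text \<open>
  When the structure 2-cell is an identity, its source and target coincide, so that a strict
  morphism is just a 1-cell commuting with the algebra structures; both coherence axioms then become
  equations between identities.
\<close>

lemma strict_mor_iff:
  "weak_mor Strict T u \<longleftrightarrow>
     is_alg T (alg_dom u) \<and> is_alg T (alg_cod u) \<and>
     und_arr u \<in> Arr B \<and> Dom B (und_arr u) = fst (alg_dom u) \<and> Cod B (und_arr u) = fst (alg_cod u) \<and>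
     und_arr u \<odot>\<^bsub>B\<^esub> snd (alg_dom u) = snd (alg_cod u) \<odot>\<^bsub>B\<^esub> TA (und_arr u) \<and>
     str_cell u = Id2 B (und_arr u \<odot>\<^bsub>B\<^esub> snd (alg_dom u))" (is "?l \<longleftrightarrow> ?r")
proof
  assume ?l
  then show ?r by (auto simp: lax_mor_iff)
next
  assume r: ?r
  let ?f = "und_arr u" and ?a = "snd (alg_dom u)" and ?b = "snd (alg_cod u)"
    and ?x = "fst (alg_dom u)" and ?y = "fst (alg_cod u)"
  note a = algD[OF conjunct1[OF r]] and b = algD[OF conjunct1[OF conjunct2[OF r]]]
  have f: "?f \<in> Arr B" "Dom B ?f = ?x" "Cod B ?f = ?y" and fa: "?f \<odot>\<^bsub>B\<^esub> ?a = ?b \<odot>\<^bsub>B\<^esub> TA ?f"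
    and s: "str_cell u = Id2 B (?f \<odot>\<^bsub>B\<^esub> ?a)" using r by auto
  have 2: "?f \<odot>\<^bsub>B\<^esub> (?a \<odot>\<^bsub>B\<^esub> Mult T ?x) = ?b \<odot>\<^bsub>B\<^esub> (TA ?f \<odot>\<^bsub>B\<^esub> TA ?a)"
    using a b f mult.F.C.Comp_eq_extend[OF fa, of "TA ?a"] by simp
  have "str_cell u \<lhd>\<^bsub>B\<^esub> Mult T ?x = (str_cell u \<lhd>\<^bsub>B\<^esub> TA ?a) \<bullet>\<^bsub>B\<^esub> (?b \<rhd>\<^bsub>B\<^esub> TC (str_cell u))"
    unfolding s using a b f by (simp add: 2[symmetric])
  moreover have "str_cell u \<lhd>\<^bsub>B\<^esub> Unit T ?x = Id2 B ?f"
    unfolding s using a f by simp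
  ultimately show ?l
    using r a b f unfolding weak_mor.simps lax_mor_iff s by simp
qed

lemma alg_cell_iff:
  "weak_cell w T \<theta> \<longleftrightarrow>
     weak_mor w T (alg_src \<theta>) \<and> weak_mor w T (alg_tgt \<theta>) \<and>
     alg_dom (alg_src \<theta>) = alg_dom (alg_tgt \<theta>) \<and> alg_cod (alg_src \<theta>) = alg_cod (alg_tgt \<theta>) \<and>
     und_cell \<theta> \<in> Cel B \<and> Src B (und_cell \<theta>) = und_arr (alg_src \<theta>) \<and>
     Tgt B (und_cell \<theta>) = und_arr (alg_tgt \<theta>) \<and>
     (if w = Colax then
        str_cell (alg_tgt \<theta>) \<bullet>\<^bsub>B\<^esub> (und_cell \<theta> \<lhd>\<^bsub>B\<^esub> snd (alg_dom (alg_src \<theta>)))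
          = (snd (alg_cod (alg_src \<theta>)) \<rhd>\<^bsub>B\<^esub> TC (und_cell \<theta>)) \<bullet>\<^bsub>B\<^esub> str_cell (alg_src \<theta>)
      else
        (und_cell \<theta> \<lhd>\<^bsub>B\<^esub> snd (alg_dom (alg_src \<theta>))) \<bullet>\<^bsub>B\<^esub> str_cell (alg_src \<theta>)
          = str_cell (alg_tgt \<theta>) \<bullet>\<^bsub>B\<^esub> (snd (alg_cod (alg_src \<theta>)) \<rhd>\<^bsub>B\<^esub> TC (und_cell \<theta>)))"
  by (cases \<theta>) (auto simp: cell_def Let_def)

lemma alg_mor_comp_sel [simp]:
  "alg_dom (alg_mor_comp w T v u) = alg_dom u"
  "alg_cod (alg_mor_comp w T v u) = alg_cod v"
  "und_arr (alg_mor_comp w T v u) = und_arr v \<odot>\<^bsub>B\<^esub> und_arr u"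
  by (simp_all add: alg_mor_comp_def)

lemma str_cell_comp:
  "w \<noteq> Colax \<Longrightarrow> str_cell (alg_mor_comp w T v u)
     = (und_arr v \<rhd>\<^bsub>B\<^esub> str_cell u) \<bullet>\<^bsub>B\<^esub> (str_cell v \<lhd>\<^bsub>B\<^esub> TA (und_arr u))"
  by (simp add: alg_mor_comp_def Let_def)

lemma lax_mor_comp:
  assumes u: "lax_mor T u" and v: "lax_mor T v" and uv: "alg_cod u = alg_dom v" and w: "w \<noteq> Colax"
  shows "lax_mor T (alg_mor_comp w T v u)"
proof -
  define x a y b z c f f' g g' where defs: "x = fst (alg_dom u)" "a = snd (alg_dom u)"
    "y = fst (alg_dom v)" "b = snd (alg_dom v)" "z = fst (alg_cod v)" "c = snd (alg_cod v)"
    "f = und_arr u" "f' = str_cell u" "g = und_arr v" "g' = str_cell v"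
  have algs: "is_alg T (alg_dom u)" "is_alg T (alg_dom v)" "is_alg T (alg_cod v)"
    using u v by (simp_all add: lax_mor_iff)
  note [simp] = algD(1-4)[OF algs(1), folded defs] algD(1-4)[OF algs(2), folded defs]
    algD(1-4)[OF algs(3), folded defs]
  have [simp]: "f \<in> Arr B" "Dom B f = x" "Cod B f = y" "f' \<in> Cel B"
      "Src B f' = b \<odot>\<^bsub>B\<^esub> TA f" "Tgt B f' = f \<odot>\<^bsub>B\<^esub> a"
      "g \<in> Arr B" "Dom B g = y" "Cod B g = z" "g' \<in> Cel B"
      "Src B g' = c \<odot>\<^bsub>B\<^esub> TA g" "Tgt B g' = g \<odot>\<^bsub>B\<^esub> b"
    and fm: "f' \<lhd>\<^bsub>B\<^esub> Mult T x = (f' \<lhd>\<^bsub>B\<^esub> TA a) \<bullet>\<^bsub>B\<^esub> (b \<rhd>\<^bsub>B\<^esub> TC f')"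
    and gm: "g' \<lhd>\<^bsub>B\<^esub> Mult T y = (g' \<lhd>\<^bsub>B\<^esub> TA b) \<bullet>\<^bsub>B\<^esub> (c \<rhd>\<^bsub>B\<^esub> TC g')"
    and fu: "f' \<lhd>\<^bsub>B\<^esub> Unit T x = Id2 B f"
    and gu: "g' \<lhd>\<^bsub>B\<^esub> Unit T y = Id2 B g"
    using u v uv by (auto simp: lax_mor_iff defs)
  have Tf [simp]: "TA f \<in> Arr B" "Dom B (TA f) = TO x" "Cod B (TA f) = TO y" by simp_all
  let ?h = "(g \<rhd>\<^bsub>B\<^esub> f') \<bullet>\<^bsub>B\<^esub> (g' \<lhd>\<^bsub>B\<^esub> TA f)"
  have natm: "TA f \<odot>\<^bsub>B\<^esub> Mult T x = Mult T y \<odot>\<^bsub>B\<^esub> TA (TA f)"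
    using mult.naturality_1[of f] by simp
  have natu: "TA f \<odot>\<^bsub>B\<^esub> Unit T x = Unit T y \<odot>\<^bsub>B\<^esub> f"
    using unit.naturality_1[of f] by simp
  have ba: "b \<odot>\<^bsub>B\<^esub> TA b = b \<odot>\<^bsub>B\<^esub> Mult T y" "a \<odot>\<^bsub>B\<^esub> TA a = a \<odot>\<^bsub>B\<^esub> Mult T x"
    "c \<odot>\<^bsub>B\<^esub> TA c = c \<odot>\<^bsub>B\<^esub> Mult T z"
    using algD(5) algs by (simp_all add: defs)
  have e1: "g' \<lhd>\<^bsub>B\<^esub> (TA f \<odot>\<^bsub>B\<^esub> Mult T x) = (g' \<lhd>\<^bsub>B\<^esub> Mult T y) \<lhd>\<^bsub>B\<^esub> TA (TA f)"
    by (simp add: natm)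
  have mu: "?h \<lhd>\<^bsub>B\<^esub> Mult T x = (?h \<lhd>\<^bsub>B\<^esub> TA a) \<bullet>\<^bsub>B\<^esub> (c \<rhd>\<^bsub>B\<^esub> TC ?h)"
  proof -
    have "?h \<lhd>\<^bsub>B\<^esub> Mult T x = (g \<rhd>\<^bsub>B\<^esub> (f' \<lhd>\<^bsub>B\<^esub> Mult T x)) \<bullet>\<^bsub>B\<^esub> (g' \<lhd>\<^bsub>B\<^esub> (TA f \<odot>\<^bsub>B\<^esub> Mult T x))"
      by simp
    also have "\<dots> = (g \<rhd>\<^bsub>B\<^esub> ((f' \<lhd>\<^bsub>B\<^esub> TA a) \<bullet>\<^bsub>B\<^esub> (b \<rhd>\<^bsub>B\<^esub> TC f')))
        \<bullet>\<^bsub>B\<^esub> (((g' \<lhd>\<^bsub>B\<^esub> TA b) \<bullet>\<^bsub>B\<^esub> (c \<rhd>\<^bsub>B\<^esub> TC g')) \<lhd>\<^bsub>B\<^esub> TA (TA f))"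
      unfolding e1 fm gm ..
    also have "\<dots> = (g \<rhd>\<^bsub>B\<^esub> (f' \<lhd>\<^bsub>B\<^esub> TA a)) \<bullet>\<^bsub>B\<^esub> (((g \<odot>\<^bsub>B\<^esub> b) \<rhd>\<^bsub>B\<^esub> TC f')
        \<bullet>\<^bsub>B\<^esub> ((g' \<lhd>\<^bsub>B\<^esub> (TA b \<odot>\<^bsub>B\<^esub> TA (TA f))) \<bullet>\<^bsub>B\<^esub> (c \<rhd>\<^bsub>B\<^esub> (TC g' \<lhd>\<^bsub>B\<^esub> TA (TA f)))))"
      by (simp add: ba)
    \<comment> \<open>The two middle cells act on different factors and may be exchanged.\<close>
    also have "((g \<odot>\<^bsub>B\<^esub> b) \<rhd>\<^bsub>B\<^esub> TC f')
        \<bullet>\<^bsub>B\<^esub> ((g' \<lhd>\<^bsub>B\<^esub> (TA b \<odot>\<^bsub>B\<^esub> TA (TA f))) \<bullet>\<^bsub>B\<^esub> (c \<rhd>\<^bsub>B\<^esub> (TC g' \<lhd>\<^bsub>B\<^esub> TA (TA f))))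
      = (g' \<lhd>\<^bsub>B\<^esub> (TA f \<odot>\<^bsub>B\<^esub> TA a)) \<bullet>\<^bsub>B\<^esub>
        (((c \<odot>\<^bsub>B\<^esub> TA g) \<rhd>\<^bsub>B\<^esub> TC f') \<bullet>\<^bsub>B\<^esub> (c \<rhd>\<^bsub>B\<^esub> (TC g' \<lhd>\<^bsub>B\<^esub> TA (TA f))))"
      by (rule mult.F.C.VComp_eq_extend[OF mult.F.C.whisker_exchange[of "TC f'" g']]) simp_all
    also have "(g \<rhd>\<^bsub>B\<^esub> (f' \<lhd>\<^bsub>B\<^esub> TA a)) \<bullet>\<^bsub>B\<^esub> \<dots> = (?h \<lhd>\<^bsub>B\<^esub> TA a) \<bullet>\<^bsub>B\<^esub> (c \<rhd>\<^bsub>B\<^esub> TC ?h)"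
      by simp
    finally show ?thesis .
  qed
  have un: "?h \<lhd>\<^bsub>B\<^esub> Unit T x = Id2 B (g \<odot>\<^bsub>B\<^esub> f)"
  proof -
    have e2: "g' \<lhd>\<^bsub>B\<^esub> (TA f \<odot>\<^bsub>B\<^esub> Unit T x) = (g' \<lhd>\<^bsub>B\<^esub> Unit T y) \<lhd>\<^bsub>B\<^esub> f"
      by (simp add: natu)
    have "?h \<lhd>\<^bsub>B\<^esub> Unit T x = (g \<rhd>\<^bsub>B\<^esub> (f' \<lhd>\<^bsub>B\<^esub> Unit T x)) \<bullet>\<^bsub>B\<^esub> (g' \<lhd>\<^bsub>B\<^esub> (TA f \<odot>\<^bsub>B\<^esub> Unit T x))"
      by simp
    also have "\<dots> = Id2 B (g \<odot>\<^bsub>B\<^esub> f)" unfolding e2 fu gu by simp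
    finally show ?thesis .
  qed
  show ?thesis
    using algs mu un w by (simp add: lax_mor_iff str_cell_comp defs[symmetric])
qed

lemma weak_mor_cases:
  assumes "w \<noteq> Colax" "weak_mor w T u" shows "lax_mor T u"
  using assms by (cases w) auto

lemma alg_mor_comp_id:
  assumes "lax_mor T u" "w \<noteq> Colax"
  shows "alg_mor_comp w T u (alg_mor_id T (alg_dom u)) = u"
    and "alg_mor_comp w T (alg_mor_id T (alg_cod u)) u = u"
proof -
  note a = algD(1-4)[of "alg_dom u"] algD(1-4)[of "alg_cod u"]
  show "alg_mor_comp w T u (alg_mor_id T (alg_dom u)) = u"
    "alg_mor_comp w T (alg_mor_id T (alg_cod u)) u = u"
    using assms a by (auto simp: lax_mor_iff str_cell_comp alg_mor_id_def intro!: alg_mor.expand)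
qed

lemma alg_mor_comp_assoc:
  assumes "lax_mor T u" "lax_mor T v" "lax_mor T t" "alg_cod u = alg_dom v" "alg_cod v = alg_dom t"
    and w: "w \<noteq> Colax"
  shows "alg_mor_comp w T (alg_mor_comp w T t v) u = alg_mor_comp w T t (alg_mor_comp w T v u)"
proof -
  note a = algD(1-4)[of "alg_dom u"] algD(1-4)[of "alg_cod u"] algD(1-4)[of "alg_dom t"]
    algD(1-4)[of "alg_cod t"]
  show ?thesis
    using assms a by (auto simp: lax_mor_iff str_cell_comp intro!: alg_mor.expand)
qed

abbreviation lax_cell_eq where
  "lax_cell_eq u v \<alpha> \<equiv>
     (\<alpha> \<lhd>\<^bsub>B\<^esub> snd (alg_dom u)) \<bullet>\<^bsub>B\<^esub> str_cell u = str_cell v \<bullet>\<^bsub>B\<^esub> (snd (alg_cod u) \<rhd>\<^bsub>B\<^esub> TC \<alpha>)"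

lemma lax_cell_VComp:
  assumes mor: "lax_mor T u" "lax_mor T v" "lax_mor T t"
    and par: "alg_dom u = alg_dom v" "alg_dom t = alg_dom v" "alg_cod u = alg_cod v" "alg_cod t = alg_cod v"
    and \<alpha>: "\<alpha> \<in> Cel B" "Src B \<alpha> = und_arr u" "Tgt B \<alpha> = und_arr v" "lax_cell_eq u v \<alpha>"
    and \<beta>: "\<beta> \<in> Cel B" "Src B \<beta> = und_arr v" "Tgt B \<beta> = und_arr t" "lax_cell_eq v t \<beta>"
  shows "lax_cell_eq u t (\<beta> \<bullet>\<^bsub>B\<^esub> \<alpha>)"
proof -
  let ?a = "snd (alg_dom v)" and ?b = "snd (alg_cod v)"
  note [simp] = mor[unfolded lax_mor_iff, simplified par] par \<alpha>(1-3) \<beta>(1-3)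
  note [simp] = algD(1-4)[of "alg_dom v"] algD(1-4)[of "alg_cod v"]
  have "((\<beta> \<bullet>\<^bsub>B\<^esub> \<alpha>) \<lhd>\<^bsub>B\<^esub> ?a) \<bullet>\<^bsub>B\<^esub> str_cell u
      = (\<beta> \<lhd>\<^bsub>B\<^esub> ?a) \<bullet>\<^bsub>B\<^esub> ((\<alpha> \<lhd>\<^bsub>B\<^esub> ?a) \<bullet>\<^bsub>B\<^esub> str_cell u)"
    by simp
  also have "\<dots> = (\<beta> \<lhd>\<^bsub>B\<^esub> ?a) \<bullet>\<^bsub>B\<^esub> (str_cell v \<bullet>\<^bsub>B\<^esub> (?b \<rhd>\<^bsub>B\<^esub> TC \<alpha>))"
    using \<alpha>(4) by simp
  also have "\<dots> = str_cell t \<bullet>\<^bsub>B\<^esub> ((?b \<rhd>\<^bsub>B\<^esub> TC \<beta>) \<bullet>\<^bsub>B\<^esub> (?b \<rhd>\<^bsub>B\<^esub> TC \<alpha>))"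
    by (rule mult.F.C.VComp_eq_extend[OF \<beta>(4)[unfolded par]]) simp_all
  also have "\<dots> = str_cell t \<bullet>\<^bsub>B\<^esub> (?b \<rhd>\<^bsub>B\<^esub> TC (\<beta> \<bullet>\<^bsub>B\<^esub> \<alpha>))"
    by simp
  finally show ?thesis by simp
qed

lemma lax_cell_HComp:
  assumes mor: "lax_mor T u" "lax_mor T u1" "lax_mor T v" "lax_mor T v1"
    and par: "alg_dom u1 = alg_dom u" "alg_cod u1 = alg_dom v" "alg_cod u = alg_dom v"
      "alg_dom v1 = alg_dom v" "alg_cod v1 = alg_cod v"
    and \<alpha>: "\<alpha> \<in> Cel B" "Src B \<alpha> = und_arr u" "Tgt B \<alpha> = und_arr u1" "lax_cell_eq u u1 \<alpha>"
    and \<beta>: "\<beta> \<in> Cel B" "Src B \<beta> = und_arr v" "Tgt B \<beta> = und_arr v1" "lax_cell_eq v v1 \<beta>"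
    and w: "w \<noteq> Colax"
  shows "lax_cell_eq (alg_mor_comp w T v u) (alg_mor_comp w T v1 u1) (\<beta> \<star>\<^bsub>B\<^esub> \<alpha>)"
proof -
  define a b c f f' f1 f1' g g' g1 g1' where defs: "a = snd (alg_dom u)"
    "b = snd (alg_dom v)" "c = snd (alg_cod v)"
    "f = und_arr u" "f' = str_cell u" "f1 = und_arr u1" "f1' = str_cell u1"
    "g = und_arr v" "g' = str_cell v" "g1 = und_arr v1" "g1' = str_cell v1"
  note [simp] = mor[unfolded lax_mor_iff par, folded defs]
  note [simp] = algD(1-4)[of "alg_dom u", folded defs] algD(1-4)[of "alg_dom v", folded defs]
    algD(1-4)[of "alg_cod v", folded defs]
  note [simp] = \<alpha>(1-3)[folded defs] \<beta>(1-3)[folded defs]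
  have A: "(\<alpha> \<lhd>\<^bsub>B\<^esub> a) \<bullet>\<^bsub>B\<^esub> f' = f1' \<bullet>\<^bsub>B\<^esub> (b \<rhd>\<^bsub>B\<^esub> TC \<alpha>)"
    using \<alpha>(4) by (simp add: par defs)
  have Be: "(\<beta> \<lhd>\<^bsub>B\<^esub> b) \<bullet>\<^bsub>B\<^esub> g' = g1' \<bullet>\<^bsub>B\<^esub> (c \<rhd>\<^bsub>B\<^esub> TC \<beta>)"
    using \<beta>(4) by (simp add: par defs)
  \<comment> \<open>Slide \<open>\<alpha>\<close> past \<open>f'\<close> and \<open>\<beta>\<close> past \<open>g'\<close>, with an interchange before and after.\<close>
  have "((\<beta> \<star>\<^bsub>B\<^esub> \<alpha>) \<lhd>\<^bsub>B\<^esub> a) \<bullet>\<^bsub>B\<^esub> ((g \<rhd>\<^bsub>B\<^esub> f') \<bullet>\<^bsub>B\<^esub> (g' \<lhd>\<^bsub>B\<^esub> TA f))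
      = (\<beta> \<lhd>\<^bsub>B\<^esub> (f1 \<odot>\<^bsub>B\<^esub> a)) \<bullet>\<^bsub>B\<^esub> ((g \<rhd>\<^bsub>B\<^esub> ((\<alpha> \<lhd>\<^bsub>B\<^esub> a) \<bullet>\<^bsub>B\<^esub> f')) \<bullet>\<^bsub>B\<^esub> (g' \<lhd>\<^bsub>B\<^esub> TA f))"
    by (simp add: mult.F.C.HComp_eq_VComp(1)[of \<alpha> \<beta>])
  also have "\<dots> = ((\<beta> \<lhd>\<^bsub>B\<^esub> (f1 \<odot>\<^bsub>B\<^esub> a)) \<bullet>\<^bsub>B\<^esub> (g \<rhd>\<^bsub>B\<^esub> f1')) \<bullet>\<^bsub>B\<^esub>
      (((g \<odot>\<^bsub>B\<^esub> b) \<rhd>\<^bsub>B\<^esub> TC \<alpha>) \<bullet>\<^bsub>B\<^esub> (g' \<lhd>\<^bsub>B\<^esub> TA f))"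
    unfolding A by simp
  also have "((\<beta> \<lhd>\<^bsub>B\<^esub> (f1 \<odot>\<^bsub>B\<^esub> a)) \<bullet>\<^bsub>B\<^esub> (g \<rhd>\<^bsub>B\<^esub> f1'))
      = (g1 \<rhd>\<^bsub>B\<^esub> f1') \<bullet>\<^bsub>B\<^esub> (\<beta> \<lhd>\<^bsub>B\<^esub> (b \<odot>\<^bsub>B\<^esub> TA f1))"
    by (rule mult.F.C.whisker_exchange[symmetric]) simp_all
  also have "((g \<odot>\<^bsub>B\<^esub> b) \<rhd>\<^bsub>B\<^esub> TC \<alpha>) \<bullet>\<^bsub>B\<^esub> (g' \<lhd>\<^bsub>B\<^esub> TA f)
      = (g' \<lhd>\<^bsub>B\<^esub> TA f1) \<bullet>\<^bsub>B\<^esub> ((c \<odot>\<^bsub>B\<^esub> TA g) \<rhd>\<^bsub>B\<^esub> TC \<alpha>)"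
    by (rule mult.F.C.whisker_exchange) simp_all
  also have "((g1 \<rhd>\<^bsub>B\<^esub> f1') \<bullet>\<^bsub>B\<^esub> (\<beta> \<lhd>\<^bsub>B\<^esub> (b \<odot>\<^bsub>B\<^esub> TA f1))) \<bullet>\<^bsub>B\<^esub>
        ((g' \<lhd>\<^bsub>B\<^esub> TA f1) \<bullet>\<^bsub>B\<^esub> ((c \<odot>\<^bsub>B\<^esub> TA g) \<rhd>\<^bsub>B\<^esub> TC \<alpha>))
      = (g1 \<rhd>\<^bsub>B\<^esub> f1') \<bullet>\<^bsub>B\<^esub> ((((\<beta> \<lhd>\<^bsub>B\<^esub> b) \<bullet>\<^bsub>B\<^esub> g') \<lhd>\<^bsub>B\<^esub> TA f1) \<bullet>\<^bsub>B\<^esub> ((c \<odot>\<^bsub>B\<^esub> TA g) \<rhd>\<^bsub>B\<^esub> TC \<alpha>))"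
    by simp
  also have "\<dots> = ((g1 \<rhd>\<^bsub>B\<^esub> f1') \<bullet>\<^bsub>B\<^esub> (g1' \<lhd>\<^bsub>B\<^esub> TA f1)) \<bullet>\<^bsub>B\<^esub> (c \<rhd>\<^bsub>B\<^esub> TC (\<beta> \<star>\<^bsub>B\<^esub> \<alpha>))"
    unfolding Be by (simp add: mult.F.C.HComp_eq_VComp(1)[of "TC \<alpha>" "TC \<beta>"])
  finally show ?thesis using w by (simp add: str_cell_comp defs[symmetric])
qed

end

section \<open>Duality\<close>

text \<open>
  Reversing the 2-cells of the base turns colax morphisms into lax ones, and an algebra 2-cell
  \<open>u \<Rightarrow> v\<close> of colax morphisms into an algebra 2-cell \<open>v \<Rightarrow> u\<close> of lax ones. This is how
  statements about colax morphisms are reduced to statements about lax ones.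
\<close>

lemma two_cat_co_simps [simp]:
  "Obj (two_cat_co C) = Obj C" "Arr (two_cat_co C) = Arr C" "Cel (two_cat_co C) = Cel C"
  "Dom (two_cat_co C) = Dom C" "Cod (two_cat_co C) = Cod C"
  "Src (two_cat_co C) = Tgt C" "Tgt (two_cat_co C) = Src C"
  "Id1 (two_cat_co C) = Id1 C" "Id2 (two_cat_co C) = Id2 C" "Comp (two_cat_co C) = Comp C"
  "VComp (two_cat_co C) = (\<lambda>\<beta> \<alpha>. \<alpha> \<bullet>\<^bsub>C\<^esub> \<beta>)" "HComp (two_cat_co C) = HComp C"
  by (simp_all add: two_cat_co_def)

lemma arr_co [simp]: "arr (two_cat_co C) f x y \<longleftrightarrow> arr C f x y"
  by (simp add: arr_def)

lemma cell_co [simp]: "cell (two_cat_co C) \<alpha> f g \<longleftrightarrow> cell C \<alpha> g f"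
  by (auto simp: cell_def)

lemma (in two_category) two_category_co: "two_category (two_cat_co C)"
proof
  fix \<alpha> \<alpha>' \<beta> \<beta>' f f' f'' g g' g''
  assume "cell (two_cat_co C) \<alpha> f f'" "cell (two_cat_co C) \<alpha>' f' f''"
    "cell (two_cat_co C) \<beta> g g'" "cell (two_cat_co C) \<beta>' g' g''"
    "Cod (two_cat_co C) f = Dom (two_cat_co C) g"
  then show "(\<beta>' \<bullet>\<^bsub>two_cat_co C\<^esub> \<beta>) \<star>\<^bsub>two_cat_co C\<^esub> (\<alpha>' \<bullet>\<^bsub>two_cat_co C\<^esub> \<alpha>)
      = (\<beta>' \<star>\<^bsub>two_cat_co C\<^esub> \<alpha>') \<bullet>\<^bsub>two_cat_co C\<^esub> (\<beta> \<star>\<^bsub>two_cat_co C\<^esub> \<alpha>)"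
    using interchange_cells[of \<alpha>' \<alpha> \<beta>' \<beta>] Dom_Tgt[of \<beta>'] Cod_Tgt[of \<alpha>']
    by (auto simp: cell_def)
qed (auto simp: arr_def cell_def)

lemma (in two_functor) two_functor_co: "two_functor (two_cat_co C) (two_cat_co D) F"
  by (intro two_functor.intro C.two_category_co D.two_category_co two_functor_axioms.intro)
    (auto simp: arr_def cell_def)

lemma (in two_natural) two_natural_co: "two_natural (two_cat_co C) (two_cat_co D) F G t"
  by (intro two_natural.intro F.two_functor_co G.two_functor_co two_natural_axioms.intro)
    (auto simp: arr_def cell_def naturality_1 naturality_2)

definition monad_co :: "('o, 'm, 'c) monad_data \<Rightarrow> ('o, 'm, 'c) monad_data" where
  "monad_co T = T\<lparr>Base := two_cat_co (Base T)\<rparr>"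

lemma monad_co_simps [simp]:
  "Base (monad_co T) = two_cat_co (Base T)" "Fun (monad_co T) = Fun T"
  "Mult (monad_co T) = Mult T" "Unit (monad_co T) = Unit T"
  by (simp_all add: monad_co_def)

lemma is_alg_co [simp]: "is_alg (monad_co T) = is_alg T"
  by (simp add: is_alg_def)

lemma lax_mor_co [simp]: "lax_mor (monad_co T) u \<longleftrightarrow> colax_mor T u"
  by (cases u; cases "alg_dom u"; cases "alg_cod u") auto

lemma alg_mor_comp_co [simp]: "alg_mor_comp Lax (monad_co T) = alg_mor_comp Colax T"
  by (auto simp: alg_mor_comp_def Let_def fun_eq_iff)

lemma alg_mor_id_co [simp]: "alg_mor_id (monad_co T) = alg_mor_id T"
  by (auto simp: alg_mor_id_def fun_eq_iff)

lemma weak_cell_co [simp]: 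
  "weak_cell Lax (monad_co T) (AlgCell v u \<alpha>) \<longleftrightarrow> weak_cell Colax T (AlgCell u v \<alpha>)"
  by (auto simp: Let_def)

lemma (in two_monad) two_monad_co: "two_monad (monad_co T)"
proof (intro two_monad.intro two_monad_axioms.intro)
  show "two_natural (Base (monad_co T)) (Base (monad_co T)) (Fun (monad_co T) \<circ>\<circ> Fun (monad_co T))
      (Fun (monad_co T)) (Mult (monad_co T))"
    using mult.two_natural_co by simp
  show "two_natural (Base (monad_co T)) (Base (monad_co T)) two_map_id
      (Fun (monad_co T)) (Unit (monad_co T))"
    using unit.two_natural_co by simp
qed (auto simp: Mult_assoc Mult_Unit Mult_Fun_Unit)

section \<open>The 2-categories of algebras\<close>

context two_monad
begin

lemma weak_mor_basic:
  assumes "weak_mor w T u"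
  shows "is_alg T (alg_dom u)" "is_alg T (alg_cod u)" "und_arr u \<in> Arr B"
    "Dom B (und_arr u) = fst (alg_dom u)" "Cod B (und_arr u) = fst (alg_cod u)"
  using assms by (cases w; auto simp: lax_mor_iff colax_mor_iff)+

text \<open>
  The description of strict morphisms refers to 1-cells only and is therefore self-dual; this is
  why a strict morphism is colax as well as lax.
\<close>

lemma strict_imp_weak:
  assumes "weak_mor Strict T u"
  shows "weak_mor w T u"
proof -
  have l: "lax_mor T u" using assms by simp
  from assms obtain g where g: "g \<in> Arr B" "str_cell u = Id2 B g" by auto
  have "weak_mor Strict (monad_co T) u" 
    using assms unfolding two_monad.strict_mor_iff[OF two_monad_co] strict_mor_iff by simp
  then have "lax_mor (monad_co T) u" unfolding weak_mor.simps by blast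
  then have c: "colax_mor T u" by simp
  show ?thesis using l g c mult.F.C.invertible_Id2[OF g(1)] assms
    by (cases w) auto
qed

lemma weak_mor_id:
  assumes "is_alg T X"
  shows "weak_mor w T (alg_mor_id T X)"
proof (rule strict_imp_weak)
  show "weak_mor Strict T (alg_mor_id T X)"
    unfolding strict_mor_iff using assms algD(1-4)[OF assms] by (simp add: alg_mor_id_def)
qed

text \<open>
  The two formulas for composing structure 2-cells, lax and colax, agree on strict morphisms,
  which makes the inclusion of strict morphisms a 2-functor for each weakness.
\<close>

lemma strict_comp_eq:
  assumes "weak_mor Strict T u" "weak_mor Strict T v" "alg_cod u = alg_dom v"
  shows "alg_mor_comp w T v u = 
    AlgMor (alg_dom u) (alg_cod v) (und_arr v \<odot>\<^bsub>B\<^esub> und_arr u)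
      (Id2 B ((und_arr v \<odot>\<^bsub>B\<^esub> und_arr u) \<odot>\<^bsub>B\<^esub> snd (alg_dom u)))"
proof -
  note u = assms(1)[unfolded strict_mor_iff] and v = assms(2)[unfolded strict_mor_iff]
  note [simp] = algD(1-4)[of "alg_dom u"] algD(1-4)[of "alg_dom v"] algD(1-4)[of "alg_cod v"]
  have su: "str_cell u = Id2 B (und_arr u \<odot>\<^bsub>B\<^esub> snd (alg_dom u))" 
    and fu: "und_arr u \<odot>\<^bsub>B\<^esub> snd (alg_dom u) = snd (alg_dom v) \<odot>\<^bsub>B\<^esub> TA (und_arr u)" 
    and sv: "str_cell v = Id2 B (und_arr v \<odot>\<^bsub>B\<^esub> snd (alg_dom v))" 
    using u v assms(3) by auto
  have "Id2 B (und_arr v \<odot>\<^bsub>B\<^esub> snd (alg_dom v)) \<lhd>\<^bsub>B\<^esub> TA (und_arr u)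
      = Id2 B (und_arr v \<odot>\<^bsub>B\<^esub> (snd (alg_dom v) \<odot>\<^bsub>B\<^esub> TA (und_arr u)))"
    using weak_mor_basic[OF assms(1)] weak_mor_basic[OF assms(2)] assms(3) by simp
  then have sv': "str_cell v \<lhd>\<^bsub>B\<^esub> TA (und_arr u) = Id2 B (und_arr v \<odot>\<^bsub>B\<^esub> (und_arr u \<odot>\<^bsub>B\<^esub> snd (alg_dom u)))"
    unfolding sv fu .
  have su': "und_arr v \<rhd>\<^bsub>B\<^esub> str_cell u = Id2 B (und_arr v \<odot>\<^bsub>B\<^esub> (und_arr u \<odot>\<^bsub>B\<^esub> snd (alg_dom u)))"
    unfolding su using weak_mor_basic[OF assms(1)] weak_mor_basic[OF assms(2)] assms(3) by simp
  show ?thesis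
    unfolding alg_mor_comp_def sv' su' using weak_mor_basic[OF assms(1)] weak_mor_basic[OF assms(2)] assms(3) by (simp add: Let_def)
qed

lemma strict_mor_comp:
  assumes "weak_mor Strict T u" "weak_mor Strict T v" "alg_cod u = alg_dom v"
  shows "weak_mor Strict T (alg_mor_comp w T v u)"
proof -
  note u = assms(1)[unfolded strict_mor_iff] and v = assms(2)[unfolded strict_mor_iff]
  note [simp] = algD(1-4)[of "alg_dom u"] algD(1-4)[of "alg_dom v"] algD(1-4)[of "alg_cod v"]
  have fu: "und_arr u \<odot>\<^bsub>B\<^esub> snd (alg_dom u) = snd (alg_dom v) \<odot>\<^bsub>B\<^esub> TA (und_arr u)" 
    using u assms(3) by auto
  have "und_arr v \<odot>\<^bsub>B\<^esub> (und_arr u \<odot>\<^bsub>B\<^esub> snd (alg_dom u))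
      = snd (alg_cod v) \<odot>\<^bsub>B\<^esub> (TA (und_arr v) \<odot>\<^bsub>B\<^esub> TA (und_arr u))"
    unfolding fu using u v assms(3) mult.F.C.Comp_eq_extend[of "und_arr v" "snd (alg_dom v)"
        "snd (alg_cod v)" "TA (und_arr v)" "TA (und_arr u)"]
    by simp
  then show ?thesis
    unfolding strict_comp_eq[OF assms] strict_mor_iff using u v assms(3) by simp
qed

lemma weak_mor_comp:
  assumes "weak_mor w T u" "weak_mor w T v" "alg_cod u = alg_dom v"
  shows "weak_mor w T (alg_mor_comp w T v u)"
proof (cases w)
  case Strict
  then show ?thesis using strict_mor_comp assms by blast
next
  case Pseudo
  note lu = lax_mor_iff[of u] and lv = lax_mor_iff[of v]
  note [simp] = algD(1-4)[of "alg_dom u"] algD(1-4)[of "alg_dom v"] algD(1-4)[of "alg_cod v"]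
  have "invertible B (str_cell (alg_mor_comp w T v u))"
    using assms Pseudo lu lv unfolding str_cell_comp[of w, unfolded Pseudo, simplified] Pseudo
    by (auto intro!: mult.F.C.invertible_VComp mult.F.C.invertible_lwhisk mult.F.C.invertible_rwhisk)
  with Pseudo show ?thesis using lax_mor_comp assms by auto
next
  case Lax
  with lax_mor_comp assms show ?thesis by auto
next
  case Colax
  with two_monad.lax_mor_comp[OF two_monad_co, of u v Lax] assms show ?thesis by auto
qed

lemma weak_mor_comp_id:
  assumes "weak_mor w T u"
  shows "alg_mor_comp w T u (alg_mor_id T (alg_dom u)) = u"
    and "alg_mor_comp w T (alg_mor_id T (alg_cod u)) u = u"
  using assms alg_mor_comp_id[OF weak_mor_cases, of w u w]
    two_monad.alg_mor_comp_id[OF two_monad_co, of u Lax]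
  by (cases w; auto)+

lemma weak_mor_comp_assoc:
  assumes "weak_mor w T u" "weak_mor w T v" "weak_mor w T t"
    "alg_cod u = alg_dom v" "alg_cod v = alg_dom t"
  shows "alg_mor_comp w T (alg_mor_comp w T t v) u = alg_mor_comp w T t (alg_mor_comp w T v u)"
proof (cases "w = Colax")
  case True
  with assms two_monad.alg_mor_comp_assoc[OF two_monad_co, of u v t Lax] show ?thesis by auto
next
  case False
  with assms weak_mor_cases[OF False] alg_mor_comp_assoc show ?thesis by metis
qed

lemma weak_cell_id:
  assumes "weak_mor w T u"
  shows "weak_cell w T (AlgCell u u (Id2 B (und_arr u)))"
proof -
  note [simp] = algD(1-4)[of "alg_dom u"] algD(1-4)[of "alg_cod u"]
  show ?thesis
    using assms weak_mor_basic[OF assms] weak_mor_cases[of w u]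
    unfolding alg_cell_iff by (cases w; auto simp: lax_mor_iff colax_mor_iff)
qed

lemma lax_weak_cell_VComp:
  assumes "w \<noteq> Colax" "weak_cell w T (AlgCell u v \<alpha>)" "weak_cell w T (AlgCell v t \<beta>)"
  shows "weak_cell w T (AlgCell u t (\<beta> \<bullet>\<^bsub>B\<^esub> \<alpha>))"
proof -
  have m: "weak_mor w T u" "weak_mor w T v" "weak_mor w T t"
    and p: "alg_dom v = alg_dom u" "alg_cod v = alg_cod u" "alg_dom t = alg_dom u" "alg_cod t = alg_cod u"
    and cells: "\<alpha> \<in> Cel B" "Src B \<alpha> = und_arr u" "Tgt B \<alpha> = und_arr v"
      "\<beta> \<in> Cel B" "Src B \<beta> = und_arr v" "Tgt B \<beta> = und_arr t"
    and eqs: "lax_cell_eq u v \<alpha>" "lax_cell_eq v t \<beta>"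
    using assms unfolding alg_cell_iff by auto
  have "lax_cell_eq u t (\<beta> \<bullet>\<^bsub>B\<^esub> \<alpha>)"
    by (rule lax_cell_VComp[of u v t])
      (use cells eqs m[THEN weak_mor_cases[OF assms(1)]] p in simp_all)
  then show ?thesis
    using assms(1) m p cells unfolding alg_cell_iff by simp
qed

lemma weak_cell_VComp:
  assumes "weak_cell w T (AlgCell u v \<alpha>)" "weak_cell w T (AlgCell v t \<beta>)"
  shows "weak_cell w T (AlgCell u t (\<beta> \<bullet>\<^bsub>B\<^esub> \<alpha>))"
proof (cases "w = Colax")
  case True
  then show ?thesis
    using two_monad.lax_weak_cell_VComp[OF two_monad_co, of Lax t v \<beta> u \<alpha>] assms
    by (simp del: weak_cell.simps)
next
  case False
  with lax_weak_cell_VComp assms show ?thesis by blast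
qed

lemma lax_weak_cell_HComp:
  assumes w: "w \<noteq> Colax" and cells: "weak_cell w T (AlgCell u u1 \<alpha>)" "weak_cell w T (AlgCell v v1 \<beta>)"
    and uv: "alg_cod u = alg_dom v"
  shows "weak_cell w T (AlgCell (alg_mor_comp w T v u) (alg_mor_comp w T v1 u1) (\<beta> \<star>\<^bsub>B\<^esub> \<alpha>))"
proof -
  have m: "weak_mor w T u" "weak_mor w T u1" "weak_mor w T v" "weak_mor w T v1"
    and p: "alg_dom u1 = alg_dom u" "alg_cod u1 = alg_dom v" "alg_dom v1 = alg_dom v" "alg_cod v1 = alg_cod v"
    using cells uv unfolding alg_cell_iff by auto
  have cel: "\<alpha> \<in> Cel B" "Src B \<alpha> = und_arr u" "Tgt B \<alpha> = und_arr u1"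
      "\<beta> \<in> Cel B" "Src B \<beta> = und_arr v" "Tgt B \<beta> = und_arr v1"
    and eqs: "lax_cell_eq u u1 \<alpha>" "lax_cell_eq v v1 \<beta>"
    using cells w unfolding alg_cell_iff by auto
  have "lax_cell_eq (alg_mor_comp w T v u) (alg_mor_comp w T v1 u1) (\<beta> \<star>\<^bsub>B\<^esub> \<alpha>)"
    by (rule lax_cell_HComp) (use cel eqs m[THEN weak_mor_cases[OF w]] p uv w in simp_all)
  moreover have "weak_mor w T (alg_mor_comp w T v u)" "weak_mor w T (alg_mor_comp w T v1 u1)"
    using weak_mor_comp[OF m(1) m(3)] weak_mor_comp[OF m(2) m(4)] p uv by simp_all
  moreover have "\<beta> \<star>\<^bsub>B\<^esub> \<alpha> \<in> Cel B" "Src B (\<beta> \<star>\<^bsub>B\<^esub> \<alpha>) = und_arr v \<odot>\<^bsub>B\<^esub> und_arr u"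
      "Tgt B (\<beta> \<star>\<^bsub>B\<^esub> \<alpha>) = und_arr v1 \<odot>\<^bsub>B\<^esub> und_arr u1"
    using cel weak_mor_basic[OF m(1)] weak_mor_basic[OF m(3)] uv by simp_all
  ultimately show ?thesis
    using w p unfolding alg_cell_iff by simp
qed

lemma weak_cell_HComp:
  assumes "weak_cell w T (AlgCell u u1 \<alpha>)" "weak_cell w T (AlgCell v v1 \<beta>)" "alg_cod u = alg_dom v"
  shows "weak_cell w T (AlgCell (alg_mor_comp w T v u) (alg_mor_comp w T v1 u1) (\<beta> \<star>\<^bsub>B\<^esub> \<alpha>))"
proof (cases "w = Colax")
  case True
  have "alg_cod u1 = alg_dom v1"
    using assms unfolding alg_cell_iff by auto
  with True show ?thesis
    using two_monad.lax_weak_cell_HComp[OF two_monad_co, of Lax u1 u \<alpha> v1 v \<beta>] assms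
    by (simp del: weak_cell.simps)
next
  case False
  with lax_weak_cell_HComp assms show ?thesis by blast
qed

lemma TAlg_simps [simp]:
  "Obj (TAlg w T) = {X. is_alg T X}" "Arr (TAlg w T) = {u. weak_mor w T u}"
  "Cel (TAlg w T) = {\<theta>. weak_cell w T \<theta>}" "Dom (TAlg w T) = alg_dom" "Cod (TAlg w T) = alg_cod"
  "Src (TAlg w T) = alg_src" "Tgt (TAlg w T) = alg_tgt" "Id1 (TAlg w T) = alg_mor_id T"
  "Id2 (TAlg w T) u = AlgCell u u (Id2 B (und_arr u))"
  "Comp (TAlg w T) = alg_mor_comp w T"
  "VComp (TAlg w T) \<theta> \<psi> = AlgCell (alg_src \<psi>) (alg_tgt \<theta>) (und_cell \<theta> \<bullet>\<^bsub>B\<^esub> und_cell \<psi>)"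
  "HComp (TAlg w T) \<theta> \<psi> = AlgCell (alg_mor_comp w T (alg_src \<theta>) (alg_src \<psi>))
     (alg_mor_comp w T (alg_tgt \<theta>) (alg_tgt \<psi>)) (und_cell \<theta> \<star>\<^bsub>B\<^esub> und_cell \<psi>)"
  by (simp_all add: TAlg_def)

lemma weak_cell_basic:
  assumes "weak_cell w T \<theta>"
  shows "weak_mor w T (alg_src \<theta>)" "weak_mor w T (alg_tgt \<theta>)"
    "alg_dom (alg_tgt \<theta>) = alg_dom (alg_src \<theta>)" "alg_cod (alg_tgt \<theta>) = alg_cod (alg_src \<theta>)"
    "und_cell \<theta> \<in> Cel B" "Src B (und_cell \<theta>) = und_arr (alg_src \<theta>)"
    "Tgt B (und_cell \<theta>) = und_arr (alg_tgt \<theta>)"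
    "weak_cell w T (AlgCell (alg_src \<theta>) (alg_tgt \<theta>) (und_cell \<theta>))"
  using assms unfolding alg_cell_iff by auto

lemma cell_TAlg_iff:
  "cell (TAlg w T) \<theta> u v \<longleftrightarrow> weak_cell w T \<theta> \<and> (\<exists>\<alpha>. \<theta> = AlgCell u v \<alpha>)"
  by (cases \<theta>) (auto simp: cell_def simp del: weak_cell.simps)

lemma weak_cellD:
  assumes "weak_cell w T (AlgCell u v \<alpha>)"
  shows "\<alpha> \<in> Cel B" "Src B \<alpha> = und_arr u" "Tgt B \<alpha> = und_arr v"
    "weak_mor w T u" "weak_mor w T v" "alg_dom v = alg_dom u" "alg_cod v = alg_cod u"
  using weak_cell_basic[OF assms] by simp_all

lemma two_category_TAlg: "two_category (TAlg w T)"
proof -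
  note [simp del] = weak_mor.simps weak_cell.simps
  have ids: "und_arr (alg_mor_id T x) = Id1 B (fst x)" "alg_dom (alg_mor_id T x) = x"
    "alg_cod (alg_mor_id T x) = x" for x by (simp_all add: alg_mor_id_def)
  show ?thesis
  proof
    show "Src (TAlg w T) \<alpha> \<in> Arr (TAlg w T)" "Tgt (TAlg w T) \<alpha> \<in> Arr (TAlg w T)"
      "Dom (TAlg w T) (Tgt (TAlg w T) \<alpha>) = Dom (TAlg w T) (Src (TAlg w T) \<alpha>)"
      "Cod (TAlg w T) (Tgt (TAlg w T) \<alpha>) = Cod (TAlg w T) (Src (TAlg w T) \<alpha>)"
      if "\<alpha> \<in> Cel (TAlg w T)" for \<alpha>
      using that weak_cell_basic[of w \<alpha>] by simp_all
    show "arr (TAlg w T) (Id1 (TAlg w T) x) x x" if "x \<in> Obj (TAlg w T)" for x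
      using that weak_mor_id by (simp add: arr_def ids)
    show "f \<odot>\<^bsub>TAlg w T\<^esub> Id1 (TAlg w T) x = f" "Id1 (TAlg w T) y \<odot>\<^bsub>TAlg w T\<^esub> f = f"
      if "arr (TAlg w T) f x y" for f x y
      using that weak_mor_comp_id by (auto simp: arr_def)
    show "cell (TAlg w T) (Id2 (TAlg w T) f) f f" if "f \<in> Arr (TAlg w T)" for f
      using that weak_cell_id by (simp add: cell_def)
    show "cell (TAlg w T) (\<beta> \<bullet>\<^bsub>TAlg w T\<^esub> \<alpha>) f h" 
      if "cell (TAlg w T) \<alpha> f g" "cell (TAlg w T) \<beta> g h" for f g h \<alpha> \<beta>
    proof -
      from that obtain a b where c: "\<alpha> = AlgCell f g a" "\<beta> = AlgCell g h b"
          "weak_cell w T (AlgCell f g a)" "weak_cell w T (AlgCell g h b)"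
        unfolding cell_TAlg_iff by blast
      show ?thesis using c(1,2) weak_cell_VComp[OF c(3,4)] by (simp add: cell_TAlg_iff)
    qed
    show "cell (TAlg w T) (\<beta> \<star>\<^bsub>TAlg w T\<^esub> \<alpha>) (g \<odot>\<^bsub>TAlg w T\<^esub> f) (g' \<odot>\<^bsub>TAlg w T\<^esub> f')" 
      if "cell (TAlg w T) \<alpha> f f'" "cell (TAlg w T) \<beta> g g'" "Cod (TAlg w T) f = Dom (TAlg w T) g" 
      for f g f' g' \<alpha> \<beta>
    proof -
      from that(1,2) obtain a b where c: "\<alpha> = AlgCell f f' a" "\<beta> = AlgCell g g' b"
          "weak_cell w T (AlgCell f f' a)" "weak_cell w T (AlgCell g g' b)"
        unfolding cell_TAlg_iff by blast
      show ?thesis using c(1,2) weak_cell_HComp[OF c(3,4)] that(3) by (simp add: cell_TAlg_iff)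
    qed
    show "\<beta> \<bullet>\<^bsub>TAlg w T\<^esub> Id2 (TAlg w T) f = \<beta>" "Id2 (TAlg w T) g \<bullet>\<^bsub>TAlg w T\<^esub> \<beta> = \<beta>" 
      if "cell (TAlg w T) \<beta> f g" for f g \<beta>
    proof -
      from that obtain b where c: "\<beta> = AlgCell f g b" "weak_cell w T (AlgCell f g b)"
        unfolding cell_TAlg_iff by blast
      show "\<beta> \<bullet>\<^bsub>TAlg w T\<^esub> Id2 (TAlg w T) f = \<beta>" "Id2 (TAlg w T) g \<bullet>\<^bsub>TAlg w T\<^esub> \<beta> = \<beta>"
        using c(1) weak_cellD[OF c(2)] by simp_all
    qed
    show "\<gamma> \<bullet>\<^bsub>TAlg w T\<^esub> \<beta> \<bullet>\<^bsub>TAlg w T\<^esub> \<alpha> = \<gamma> \<bullet>\<^bsub>TAlg w T\<^esub> (\<beta> \<bullet>\<^bsub>TAlg w T\<^esub> \<alpha>)"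
      if "cell (TAlg w T) \<alpha> f g" "cell (TAlg w T) \<beta> g h" "cell (TAlg w T) \<gamma> h k" for f g h k \<alpha> \<beta> \<gamma>
    proof -
      from that obtain a b c where c: "\<alpha> = AlgCell f g a" "\<beta> = AlgCell g h b" "\<gamma> = AlgCell h k c"
          "weak_cell w T (AlgCell f g a)" "weak_cell w T (AlgCell g h b)" "weak_cell w T (AlgCell h k c)"
        unfolding cell_TAlg_iff by blast
      show ?thesis using c(1-3) weak_cellD[OF c(4)] weak_cellD[OF c(5)] weak_cellD[OF c(6)] by simp
    qed
    show "\<alpha> \<star>\<^bsub>TAlg w T\<^esub> Id2 (TAlg w T) (Id1 (TAlg w T) x) = \<alpha>" 
      if "cell (TAlg w T) \<alpha> f f'" "Dom (TAlg w T) f = x" for f f' \<alpha> x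
    proof -
      from that obtain a where c: "\<alpha> = AlgCell f f' a" "weak_cell w T (AlgCell f f' a)"
        unfolding cell_TAlg_iff by blast
      show ?thesis
        using c(1) that(2) weak_cellD[OF c(2)] weak_mor_comp_id(1)[of w f]
          weak_mor_comp_id(1)[of w f'] weak_mor_basic[of w f] by (auto simp: ids)
    qed
    show "Id2 (TAlg w T) (Id1 (TAlg w T) y) \<star>\<^bsub>TAlg w T\<^esub> \<alpha> = \<alpha>" 
      if "cell (TAlg w T) \<alpha> f f'" "Cod (TAlg w T) f = y" for f f' \<alpha> y
    proof -
      from that obtain a where c: "\<alpha> = AlgCell f f' a" "weak_cell w T (AlgCell f f' a)"
        unfolding cell_TAlg_iff by blast
      show ?thesis
        using c(1) that(2) weak_cellD[OF c(2)] weak_mor_comp_id(2)[of w f]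
          weak_mor_comp_id(2)[of w f'] weak_mor_basic[of w f] by (auto simp: ids)
    qed
    show "\<gamma> \<star>\<^bsub>TAlg w T\<^esub> \<beta> \<star>\<^bsub>TAlg w T\<^esub> \<alpha> = \<gamma> \<star>\<^bsub>TAlg w T\<^esub> (\<beta> \<star>\<^bsub>TAlg w T\<^esub> \<alpha>)"
      if that: "cell (TAlg w T) \<alpha> f f'" "cell (TAlg w T) \<beta> g g'" "cell (TAlg w T) \<gamma> h h'" 
        "Cod (TAlg w T) f = Dom (TAlg w T) g" "Cod (TAlg w T) g = Dom (TAlg w T) h" 
      for f g h f' g' h' \<alpha> \<beta> \<gamma>
    proof -
      from that obtain a b c where c: "\<alpha> = AlgCell f f' a" "\<beta> = AlgCell g g' b" "\<gamma> = AlgCell h h' c"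
          "weak_cell w T (AlgCell f f' a)" "weak_cell w T (AlgCell g g' b)" "weak_cell w T (AlgCell h h' c)"
        unfolding cell_TAlg_iff by blast
      note d = weak_cellD[OF c(4)] weak_cellD[OF c(5)] weak_cellD[OF c(6)]
      have e: "alg_cod f = alg_dom g" "alg_cod g = alg_dom h" using that(4,5) by simp_all
      have "c \<star>\<^bsub>B\<^esub> b \<star>\<^bsub>B\<^esub> a = c \<star>\<^bsub>B\<^esub> (b \<star>\<^bsub>B\<^esub> a)"
        using d weak_mor_basic[OF d(4)] weak_mor_basic[OF d(11)] weak_mor_basic[OF d(18)] e by simp
      then show ?thesis
        using c(1-3) weak_mor_comp_assoc[OF d(4,11,18)] weak_mor_comp_assoc[OF d(5,12,19)] e d by simp
    qed
    show "Id2 (TAlg w T) g \<star>\<^bsub>TAlg w T\<^esub> Id2 (TAlg w T) f = Id2 (TAlg w T) (g \<odot>\<^bsub>TAlg w T\<^esub> f)"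
      if "arr (TAlg w T) f x y" "arr (TAlg w T) g y z" for f g x y z
      using that weak_mor_basic[of w f] weak_mor_basic[of w g] by (auto simp: arr_def)
    show "(\<beta>' \<bullet>\<^bsub>TAlg w T\<^esub> \<beta>) \<star>\<^bsub>TAlg w T\<^esub> (\<alpha>' \<bullet>\<^bsub>TAlg w T\<^esub> \<alpha>) =
        (\<beta>' \<star>\<^bsub>TAlg w T\<^esub> \<alpha>') \<bullet>\<^bsub>TAlg w T\<^esub> (\<beta> \<star>\<^bsub>TAlg w T\<^esub> \<alpha>)"
      if that: "cell (TAlg w T) \<alpha> f f'" "cell (TAlg w T) \<alpha>' f' f''" "cell (TAlg w T) \<beta> g g'"
        "cell (TAlg w T) \<beta>' g' g''" "Cod (TAlg w T) f = Dom (TAlg w T) g"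
      for f g f' g' f'' g'' \<alpha> \<alpha>' \<beta> \<beta>'
    proof -
      from that obtain a b a' b' where c: "\<alpha> = AlgCell f f' a" "\<beta> = AlgCell g g' b"
          "\<alpha>' = AlgCell f' f'' a'" "\<beta>' = AlgCell g' g'' b'"
          "weak_cell w T (AlgCell f f' a)" "weak_cell w T (AlgCell g g' b)"
          "weak_cell w T (AlgCell f' f'' a')" "weak_cell w T (AlgCell g' g'' b')"
        unfolding cell_TAlg_iff by blast
      note d = weak_cellD[OF c(5)] weak_cellD[OF c(6)] weak_cellD[OF c(7)] weak_cellD[OF c(8)]
      have e: "alg_cod f = alg_dom g" using that(5) by simp
      have "(b' \<bullet>\<^bsub>B\<^esub> b) \<star>\<^bsub>B\<^esub> (a' \<bullet>\<^bsub>B\<^esub> a) = (b' \<star>\<^bsub>B\<^esub> a') \<bullet>\<^bsub>B\<^esub> (b \<star>\<^bsub>B\<^esub> a)"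
        by (rule mult.F.C.interchange_cells)
          (use d weak_mor_basic[OF d(4)] weak_mor_basic[OF d(11)] e in simp_all)
      then show ?thesis using c(1-4) by simp
    qed
    show "arr (TAlg w T) (g \<odot>\<^bsub>TAlg w T\<^esub> f) x z" 
      if "arr (TAlg w T) f x y" "arr (TAlg w T) g y z" for f g x y z
      using that weak_mor_comp[of w f g] by (auto simp: arr_def)
    show "h \<odot>\<^bsub>TAlg w T\<^esub> g \<odot>\<^bsub>TAlg w T\<^esub> f = h \<odot>\<^bsub>TAlg w T\<^esub> (g \<odot>\<^bsub>TAlg w T\<^esub> f)"
      if "arr (TAlg w T) f x y" "arr (TAlg w T) g y z" "arr (TAlg w T) h z v" for f g h x y z v
      using that weak_mor_comp_assoc[of w f g h] by (auto simp: arr_def)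
  qed (auto simp: weak_mor_basic[of w])
qed

text \<open>
  Between strict morphisms the condition on an algebra 2-cell is the same for each weakness.
  This is what makes the inclusion of strict morphisms locally fully faithful.
\<close>

lemma strict_cell_iff:
  assumes "weak_mor Strict T u" "weak_mor Strict T v"
  shows "weak_cell w T (AlgCell u v \<alpha>) \<longleftrightarrow>
    alg_dom u = alg_dom v \<and> alg_cod u = alg_cod v \<and> cell B \<alpha> (und_arr u) (und_arr v) \<and>
    \<alpha> \<lhd>\<^bsub>B\<^esub> snd (alg_dom u) = snd (alg_cod u) \<rhd>\<^bsub>B\<^esub> TC \<alpha>"
proof (cases "alg_dom v = alg_dom u \<and> alg_cod v = alg_cod u \<and> cell B \<alpha> (und_arr u) (und_arr v)")
  case True
  define a b f g where defs: "a = snd (alg_dom u)" "b = snd (alg_cod u)"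
    "f = und_arr u" "g = und_arr v"
  note u = weak_mor_basic[OF assms(1)] and v = weak_mor_basic[OF assms(2)]
  have su: "str_cell u = Id2 B (f \<odot>\<^bsub>B\<^esub> a)" "f \<odot>\<^bsub>B\<^esub> a = b \<odot>\<^bsub>B\<^esub> TA f"
    and sv: "str_cell v = Id2 B (g \<odot>\<^bsub>B\<^esub> a)" "g \<odot>\<^bsub>B\<^esub> a = b \<odot>\<^bsub>B\<^esub> TA g"
    using assms[unfolded strict_mor_iff] True by (simp_all add: defs)
  have \<alpha>: "\<alpha> \<in> Cel B" "Src B \<alpha> = f" "Tgt B \<alpha> = g" using True by (simp_all add: cell_def defs)
  have fg: "f \<in> Arr B" "Dom B f = fst (alg_dom u)" "Cod B f = fst (alg_cod u)"
    using u by (simp_all add: defs)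
  note ab = algD(1-4)[OF u(1), folded defs] algD(1-4)[OF u(2), folded defs]
  have wa: "\<alpha> \<lhd>\<^bsub>B\<^esub> a \<in> Cel B" "Src B (\<alpha> \<lhd>\<^bsub>B\<^esub> a) = f \<odot>\<^bsub>B\<^esub> a" "Tgt B (\<alpha> \<lhd>\<^bsub>B\<^esub> a) = g \<odot>\<^bsub>B\<^esub> a"
    using \<alpha> fg ab by simp_all
  have wb: "b \<rhd>\<^bsub>B\<^esub> TC \<alpha> \<in> Cel B" "Src B (b \<rhd>\<^bsub>B\<^esub> TC \<alpha>) = f \<odot>\<^bsub>B\<^esub> a"
      "Tgt B (b \<rhd>\<^bsub>B\<^esub> TC \<alpha>) = g \<odot>\<^bsub>B\<^esub> a"
    unfolding su sv using \<alpha> fg ab by simp_all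
  show ?thesis
    unfolding alg_cell_iff
    using True strict_imp_weak[OF assms(1), of w] strict_imp_weak[OF assms(2), of w] wa wb
    by (simp add: defs[symmetric] su(1) sv(1) cell_def del: weak_mor.simps)
next
  case False
  then show ?thesis unfolding alg_cell_iff by (auto simp: cell_def)
qed

end

section \<open>The mate of a loose morphism resolved by its limit\<close>

lemma (in f_category) tight_arr [simp]: "tight A f \<Longrightarrow> f \<in> Arr (Loose A)"
  by (auto simp: tight_def)

lemma (in f_category) tight_Comp:
  assumes "tight A f" "tight A g" "Cod (Loose A) f = Dom (Loose A) g"
  shows "tight A (g \<odot>\<^bsub>Loose A\<^esub> f)"
proof -
  from assms obtain f0 g0 where *: "f0 \<in> Arr (Tight A)" "f = FArr (Incl A) f0"
      "g0 \<in> Arr (Tight A)" "g = FArr (Incl A) g0"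
    by (auto simp: tight_def)
  then have "Cod (Tight A) f0 = Dom (Tight A) g0"
    using assms(3) by (simp add: Incl_Obj)
  then have "g \<odot>\<^bsub>Loose A\<^esub> f = FArr (Incl A) (g0 \<odot>\<^bsub>Tight A\<^esub> f0)" "g0 \<odot>\<^bsub>Tight A\<^esub> f0 \<in> Arr (Tight A)"
    using * by simp_all
  then show ?thesis by (auto simp: tight_def)
qed

lemma (in f_category) tight_Id1:
  assumes "x \<in> Obj (Loose A)"
  shows "tight A (Id1 (Loose A) x)"
proof -
  have "Id1 (Loose A) x = FArr (Incl A) (Id1 (Tight A) x)" "Id1 (Tight A) x \<in> Arr (Tight A)"
    using assms incl.FArr_Id1[of x] by (simp_all add: Obj_eq Incl_Obj)
  then show ?thesis by (auto simp: tight_def)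
qed

text \<open>
  A lift of the tight part of \<open>H\<close> to strict algebras, reduced to its essential data: since the
  underlying cells are prescribed by \<open>H\<close>, only the algebra structures \<open>e x\<close> on the objects \<open>H x\<close>
  remain to be given.
\<close>

locale algebra_lift = f_category A + two_monad T + H: two_functor "Loose A" "Base T" H
  for A :: "('o, 'm, 'c, 'n, 'd) f_cat"
    and T :: "('p, 'k, 'e) monad_data"
    and H :: "('o, 'n, 'd, 'p, 'k, 'e) two_map" +
  fixes e :: "'o \<Rightarrow> 'k"
  assumes lift_alg: "x \<in> Obj (Loose A) \<Longrightarrow> is_alg T (FObj H x, e x)"
    and lift_strict: "tight A f \<Longrightarrow>
      FArr H f \<odot>\<^bsub>Base T\<^esub> e (Dom (Loose A) f) = e (Cod (Loose A) f) \<odot>\<^bsub>Base T\<^esub> FArr (Fun T) (FArr H f)"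
    and lift_cell: "\<lbrakk>\<gamma> \<in> Cel (Loose A); tight A (Src (Loose A) \<gamma>); tight A (Tgt (Loose A) \<gamma>)\<rbrakk> \<Longrightarrow>
      FCel H \<gamma> \<lhd>\<^bsub>Base T\<^esub> e (Dom (Loose A) (Src (Loose A) \<gamma>))
        = e (Cod (Loose A) (Src (Loose A) \<gamma>)) \<rhd>\<^bsub>Base T\<^esub> FCel (Fun T) (FCel H \<gamma>)"
begin

abbreviation C where "C \<equiv> Loose A"

lemma lift_simps [simp]:
  assumes "x \<in> Obj C"
  shows "e x \<in> Arr B" "Dom B (e x) = TO (FObj H x)" "Cod B (e x) = FObj H x"
  using algD[OF lift_alg[OF assms]] by simp_all

lemma lift_Mult: "x \<in> Obj C \<Longrightarrow> e x \<odot>\<^bsub>B\<^esub> TA (e x) = e x \<odot>\<^bsub>B\<^esub> Mult T (FObj H x)"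
  and lift_Unit: "x \<in> Obj C \<Longrightarrow> e x \<odot>\<^bsub>B\<^esub> Unit T (FObj H x) = Id1 B (FObj H x)"
  using algD[OF lift_alg] by simp_all

text \<open>
  A cone over \<open>g\<close> with tight legs \<open>r\<close> and \<open>Src \<beta>\<close>, whose 2-cell is arbitrary even where the
  universal property concerns invertible 2-cells only.
\<close>

definition tight_cone :: "'n \<Rightarrow> 'n \<Rightarrow> 'd \<Rightarrow> bool" where
  "tight_cone g r \<beta> \<longleftrightarrow> g \<in> Arr C \<and> tight A r \<and> Cod C r = Dom C g \<and>
     \<beta> \<in> Cel C \<and> tight A (Src C \<beta>) \<and> Tgt C \<beta> = g \<odot>\<^bsub>C\<^esub> r"

lemma tight_coneD:
  assumes "tight_cone g r \<beta>"
  shows "g \<in> Arr C" "tight A r" "r \<in> Arr C" "Cod C r = Dom C g" "\<beta> \<in> Cel C" "tight A (Src C \<beta>)"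
    "Tgt C \<beta> = g \<odot>\<^bsub>C\<^esub> r" "Dom C (Src C \<beta>) = Dom C r" "Cod C (Src C \<beta>) = Cod C g"
  using assms incl.D.Dom_Tgt[of \<beta>] incl.D.Cod_Tgt[of \<beta>] by (auto simp: tight_cone_def)

definition boundary :: "'n \<Rightarrow> 'e \<Rightarrow> bool" where
  "boundary g \<sigma> \<longleftrightarrow> \<sigma> \<in> Cel B \<and> Src B \<sigma> = e (Cod C g) \<odot>\<^bsub>B\<^esub> TA (FArr H g) \<and>
     Tgt B \<sigma> = FArr H g \<odot>\<^bsub>B\<^esub> e (Dom C g)"

text \<open>
  With \<open>\<sigma>\<close> as structure 2-cell of \<open>g\<close>, and the tight \<open>r\<close> and \<open>Src \<beta>\<close> strict, this equation says
  that \<open>H\<beta>\<close> is an algebra 2-cell \<open>H(Src \<beta>) \<Rightarrow> H(g r)\<close>.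
\<close>

definition compatible :: "'n \<Rightarrow> 'e \<Rightarrow> 'n \<Rightarrow> 'd \<Rightarrow> bool" where
  "compatible g \<sigma> r \<beta> \<longleftrightarrow>
     (\<sigma> \<lhd>\<^bsub>B\<^esub> TA (FArr H r)) \<bullet>\<^bsub>B\<^esub> (e (Cod C g) \<rhd>\<^bsub>B\<^esub> TC (FCel H \<beta>)) = FCel H \<beta> \<lhd>\<^bsub>B\<^esub> e (Dom C r)"

text \<open>
  A property that mentions no limit, yet determines \<open>\<sigma>\<close> as soon as \<open>g\<close> has a resolution.
\<close>

definition structure_cell :: "'n \<Rightarrow> 'e \<Rightarrow> bool" where
  "structure_cell g \<sigma> \<longleftrightarrow> boundary g \<sigma> \<and> (\<forall>r \<beta>. tight_cone g r \<beta> \<longrightarrow> compatible g \<sigma> r \<beta>)"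

text \<open>
  The form in which compatibility is used: a loose \<open>t\<close> may be put in front of a cone with tight
  legs. When \<open>r t = 1\<close>, the right-hand side is \<open>\<sigma>\<close> pasted with \<open>\<beta> t\<close> alone.
\<close>

lemma compatible_whisker:
  assumes "tight_cone g r \<beta>" "boundary g \<sigma>" "compatible g \<sigma> r \<beta>" "t \<in> Arr C" "Cod C t = Dom C r"
  shows "FCel H \<beta> \<lhd>\<^bsub>B\<^esub> (e (Dom C r) \<odot>\<^bsub>B\<^esub> TA (FArr H t))
    = (\<sigma> \<lhd>\<^bsub>B\<^esub> TA (FArr H (r \<odot>\<^bsub>C\<^esub> t))) \<bullet>\<^bsub>B\<^esub> (e (Cod C g) \<rhd>\<^bsub>B\<^esub> TC (FCel H (\<beta> \<lhd>\<^bsub>C\<^esub> t)))"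
proof -
  note b = tight_coneD[OF assms(1)] and s = assms(2)[unfolded boundary_def]
  have "FCel H \<beta> \<lhd>\<^bsub>B\<^esub> (e (Dom C r) \<odot>\<^bsub>B\<^esub> TA (FArr H t))
      = (FCel H \<beta> \<lhd>\<^bsub>B\<^esub> e (Dom C r)) \<lhd>\<^bsub>B\<^esub> TA (FArr H t)"
    using b assms(4,5) by simp
  also have "\<dots> = ((\<sigma> \<lhd>\<^bsub>B\<^esub> TA (FArr H r)) \<bullet>\<^bsub>B\<^esub> (e (Cod C g) \<rhd>\<^bsub>B\<^esub> TC (FCel H \<beta>))) \<lhd>\<^bsub>B\<^esub> TA (FArr H t)"
    using assms(3) unfolding compatible_def by simp
  also have "\<dots> = (\<sigma> \<lhd>\<^bsub>B\<^esub> TA (FArr H (r \<odot>\<^bsub>C\<^esub> t))) \<bullet>\<^bsub>B\<^esub> (e (Cod C g) \<rhd>\<^bsub>B\<^esub> TC (FCel H (\<beta> \<lhd>\<^bsub>C\<^esub> t)))"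
    using b s assms(4,5) by simp
  finally show ?thesis .
qed

text \<open>
  The 1-cell \<open>t\<close> is right adjoint to the tight \<open>p\<close> with unit \<open>u\<close> and identity counit, and \<open>g\<close> is
  recovered as \<open>q t\<close> for the tight \<open>q = Src \<kappa>\<close>.
\<close>

definition resolution :: "'n \<Rightarrow> 'o \<Rightarrow> 'n \<Rightarrow> 'd \<Rightarrow> 'n \<Rightarrow> 'd \<Rightarrow> bool" where
  "resolution g X p \<kappa> t u \<longleftrightarrow> tight_cone g p \<kappa> \<and> arr C p X (Dom C g) \<and> arr C t (Dom C g) X \<and>
     p \<odot>\<^bsub>C\<^esub> t = Id1 C (Dom C g) \<and> Src C \<kappa> \<odot>\<^bsub>C\<^esub> t = g \<and> \<kappa> \<lhd>\<^bsub>C\<^esub> t = Id2 C g \<and>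
     cell C u (Id1 C X) (t \<odot>\<^bsub>C\<^esub> p) \<and> p \<rhd>\<^bsub>C\<^esub> u = Id2 C p \<and> Src C \<kappa> \<rhd>\<^bsub>C\<^esub> u = \<kappa>"

text \<open>
  Under the adjunction of \<open>p\<close> and \<open>t\<close>, the identity expressing strictness of \<open>p\<close> has as its mate
  \<open>Hu\<close> whiskered with \<open>e X \<circ> T(Ht)\<close>. Composing with the strict \<open>q\<close> gives this formula, because
  \<open>q u = \<kappa>\<close>.
\<close>

definition mate :: "'o \<Rightarrow> 'd \<Rightarrow> 'n \<Rightarrow> 'e" where
  "mate X \<kappa> t = FCel H \<kappa> \<lhd>\<^bsub>B\<^esub> (e X \<odot>\<^bsub>B\<^esub> TA (FArr H t))"

lemma resolutionD:
  assumes "resolution g X p \<kappa> t u"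
  shows "tight_cone g p \<kappa>" "X \<in> Obj C" "p \<in> Arr C" "Dom C p = X" "Cod C p = Dom C g"
    "t \<in> Arr C" "Dom C t = Dom C g" "Cod C t = X" "p \<odot>\<^bsub>C\<^esub> t = Id1 C (Dom C g)"
    "Src C \<kappa> \<odot>\<^bsub>C\<^esub> t = g" "\<kappa> \<lhd>\<^bsub>C\<^esub> t = Id2 C g"
    "u \<in> Cel C" "Src C u = Id1 C X" "Tgt C u = t \<odot>\<^bsub>C\<^esub> p"
    "p \<rhd>\<^bsub>C\<^esub> u = Id2 C p" "Src C \<kappa> \<rhd>\<^bsub>C\<^esub> u = \<kappa>"
  using assms incl.D.Dom_Obj[of p] by (auto simp: resolution_def arr_def cell_def)

text \<open>
  Whisker compatibility with \<open>\<kappa>\<close> by \<open>t\<close>: since \<open>p t = 1\<close> and \<open>\<kappa> t = id\<close>, only \<open>\<sigma>\<close> is left.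
\<close>

lemma structure_cell_eq_mate:
  assumes "structure_cell g \<sigma>" "resolution g X p \<kappa> t u"
  shows "\<sigma> = mate X \<kappa> t"
proof -
  note r = resolutionD[OF assms(2)]
  have b: "boundary g \<sigma>" "compatible g \<sigma> p \<kappa>" 
    using assms(1) r(1) by (auto simp: structure_cell_def)
  have "mate X \<kappa> t = (\<sigma> \<lhd>\<^bsub>B\<^esub> TA (FArr H (p \<odot>\<^bsub>C\<^esub> t))) \<bullet>\<^bsub>B\<^esub> (e (Cod C g) \<rhd>\<^bsub>B\<^esub> TC (FCel H (\<kappa> \<lhd>\<^bsub>C\<^esub> t)))"
    using compatible_whisker[OF r(1) b r(6)] r by (simp add: mate_def)
  also have "\<dots> = \<sigma>"
    using b(1) tight_coneD[OF r(1)] unfolding r(9,11) boundary_def by simp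
  finally show ?thesis by simp
qed

lemma structure_cell_unique:
  assumes "structure_cell g \<sigma>" "structure_cell g \<sigma>'" "resolution g X p \<kappa> t u"
  shows "\<sigma> = \<sigma>'"
  using structure_cell_eq_mate[OF assms(1,3)] structure_cell_eq_mate[OF assms(2,3)] by simp

lemma lift_strict_comp:
  assumes "tight A f" "k \<in> Arr B" "Cod B k = TO (FObj H (Dom C f))"
  shows "FArr H f \<odot>\<^bsub>B\<^esub> (e (Dom C f) \<odot>\<^bsub>B\<^esub> k) = e (Cod C f) \<odot>\<^bsub>B\<^esub> (TA (FArr H f) \<odot>\<^bsub>B\<^esub> k)"
  by (rule mult.F.C.Comp_eq_extend[OF lift_strict[OF assms(1)]]) (use assms in simp_all)

lemma lift_strict_section:
  assumes "resolution g X p \<kappa> t u"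
  shows "FArr H p \<odot>\<^bsub>B\<^esub> (e X \<odot>\<^bsub>B\<^esub> TA (FArr H t)) = e (Dom C g)"
    and "FArr H (Src C \<kappa>) \<odot>\<^bsub>B\<^esub> (e X \<odot>\<^bsub>B\<^esub> TA (FArr H t)) = e (Cod C g) \<odot>\<^bsub>B\<^esub> TA (FArr H g)"
proof -
  note r = resolutionD[OF assms] and c = tight_coneD[OF resolutionD(1)[OF assms]]
  have "FArr H p \<odot>\<^bsub>B\<^esub> (e X \<odot>\<^bsub>B\<^esub> TA (FArr H t)) = e (Dom C g) \<odot>\<^bsub>B\<^esub> TA (FArr H (p \<odot>\<^bsub>C\<^esub> t))"
    using lift_strict_comp[of p "TA (FArr H t)"] r(2-8) c by simp
  then show "FArr H p \<odot>\<^bsub>B\<^esub> (e X \<odot>\<^bsub>B\<^esub> TA (FArr H t)) = e (Dom C g)"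
    unfolding r(9) using c by simp
  have "FArr H (Src C \<kappa>) \<odot>\<^bsub>B\<^esub> (e X \<odot>\<^bsub>B\<^esub> TA (FArr H t)) = e (Cod C g) \<odot>\<^bsub>B\<^esub> TA (FArr H (Src C \<kappa> \<odot>\<^bsub>C\<^esub> t))"
    using lift_strict_comp[of "Src C \<kappa>" "TA (FArr H t)"] r(2-8) c by simp
  then show "FArr H (Src C \<kappa>) \<odot>\<^bsub>B\<^esub> (e X \<odot>\<^bsub>B\<^esub> TA (FArr H t)) = e (Cod C g) \<odot>\<^bsub>B\<^esub> TA (FArr H g)"
    unfolding r(10) .
qed

lemma boundary_mate:
  assumes "resolution g X p \<kappa> t u"
  shows "boundary g (mate X \<kappa> t)"
proof -
  note r = resolutionD[OF assms] and c = tight_coneD[OF resolutionD(1)[OF assms]]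
  have "FArr H g \<odot>\<^bsub>B\<^esub> (FArr H p \<odot>\<^bsub>B\<^esub> (e X \<odot>\<^bsub>B\<^esub> TA (FArr H t))) = FArr H g \<odot>\<^bsub>B\<^esub> e (Dom C g)"
    using lift_strict_section(1)[OF assms] by simp
  then show ?thesis
    using lift_strict_section(2)[OF assms] r c unfolding boundary_def mate_def by simp
qed

text \<open>
  As \<open>\<kappa> = q u\<close> and \<open>q\<close> is strict, the interchange law moves \<open>Hu\<close> past \<open>H\<kappa>\<close>; there it is whiskered
  with \<open>p\<close>, and vanishes because \<open>p\<close> is strict and \<open>p u = id\<close>.
\<close>

lemma compatible_mate:
  assumes "resolution g X p \<kappa> t u"
  shows "compatible g (mate X \<kappa> t) p \<kappa>"
proof -
  note r = resolutionD[OF assms] and c = tight_coneD[OF resolutionD(1)[OF assms]]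
  let ?q = "Src C \<kappa>"
  have eq: "e (Cod C g) \<odot>\<^bsub>B\<^esub> TA (FArr H ?q) = FArr H ?q \<odot>\<^bsub>B\<^esub> e X"
    using lift_strict[of ?q] c r by simp
  have ep: "FArr H p \<odot>\<^bsub>B\<^esub> e X = e (Dom C g) \<odot>\<^bsub>B\<^esub> TA (FArr H p)"
    using lift_strict[of p] c r by simp
  have "e (Cod C g) \<rhd>\<^bsub>B\<^esub> TC (FCel H \<kappa>) = e (Cod C g) \<rhd>\<^bsub>B\<^esub> TC (FCel H (?q \<rhd>\<^bsub>C\<^esub> u))"
    using r(16) by simp
  also have "\<dots> = (e (Cod C g) \<odot>\<^bsub>B\<^esub> TA (FArr H ?q)) \<rhd>\<^bsub>B\<^esub> TC (FCel H u)"
    using r(2-8,12-14) c by simp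
  also have "\<dots> = FArr H ?q \<rhd>\<^bsub>B\<^esub> (e X \<rhd>\<^bsub>B\<^esub> TC (FCel H u))"
    unfolding eq using r(2-8,12-14) c by simp
  finally have 1: "e (Cod C g) \<rhd>\<^bsub>B\<^esub> TC (FCel H \<kappa>) = FArr H ?q \<rhd>\<^bsub>B\<^esub> (e X \<rhd>\<^bsub>B\<^esub> TC (FCel H u))" .
  have "(mate X \<kappa> t \<lhd>\<^bsub>B\<^esub> TA (FArr H p)) \<bullet>\<^bsub>B\<^esub> (e (Cod C g) \<rhd>\<^bsub>B\<^esub> TC (FCel H \<kappa>))
      = (FCel H \<kappa> \<lhd>\<^bsub>B\<^esub> (e X \<odot>\<^bsub>B\<^esub> TA (FArr H (t \<odot>\<^bsub>C\<^esub> p)))) \<bullet>\<^bsub>B\<^esub> (FArr H ?q \<rhd>\<^bsub>B\<^esub> (e X \<rhd>\<^bsub>B\<^esub> TC (FCel H u)))"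
    unfolding 1 mate_def using r(2-8) c by simp
  also have "\<dots> = (FArr H (g \<odot>\<^bsub>C\<^esub> p) \<rhd>\<^bsub>B\<^esub> (e X \<rhd>\<^bsub>B\<^esub> TC (FCel H u))) \<bullet>\<^bsub>B\<^esub> (FCel H \<kappa> \<lhd>\<^bsub>B\<^esub> e X)"
    by (rule mult.F.C.whisker_exchange[symmetric]) (use r(2-8,12-14) c in simp_all)
  also have "FArr H (g \<odot>\<^bsub>C\<^esub> p) \<rhd>\<^bsub>B\<^esub> (e X \<rhd>\<^bsub>B\<^esub> TC (FCel H u))
      = FArr H g \<rhd>\<^bsub>B\<^esub> ((FArr H p \<odot>\<^bsub>B\<^esub> e X) \<rhd>\<^bsub>B\<^esub> TC (FCel H u))"
    using r(2-8,12-14) c by simp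
  also have "\<dots> = FArr H g \<rhd>\<^bsub>B\<^esub> (e (Dom C g) \<rhd>\<^bsub>B\<^esub> TC (FCel H (p \<rhd>\<^bsub>C\<^esub> u)))"
    unfolding ep using r(2-8,12-14) c by simp
  also have "\<dots> = Id2 B (FArr H g \<odot>\<^bsub>B\<^esub> (FArr H p \<odot>\<^bsub>B\<^esub> e X))"
    unfolding r(15) ep using r(2-8,12-14) c by simp
  also have "\<dots> \<bullet>\<^bsub>B\<^esub> (FCel H \<kappa> \<lhd>\<^bsub>B\<^esub> e X) = FCel H \<kappa> \<lhd>\<^bsub>B\<^esub> e X"
    using r(2-8,12-14) c by simp
  finally show ?thesis unfolding compatible_def r(4) .
qed

lemma compatible_tight_whisker:
  assumes "tight_cone g r \<beta>" "boundary g \<sigma>" "compatible g \<sigma> r \<beta>" "tight A k" "Cod C k = Dom C r"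
  shows "compatible g \<sigma> (r \<odot>\<^bsub>C\<^esub> k) (\<beta> \<lhd>\<^bsub>C\<^esub> k)"
proof -
  note c = tight_coneD[OF assms(1)]
  have "FCel H (\<beta> \<lhd>\<^bsub>C\<^esub> k) \<lhd>\<^bsub>B\<^esub> e (Dom C k) = FCel H \<beta> \<lhd>\<^bsub>B\<^esub> (FArr H k \<odot>\<^bsub>B\<^esub> e (Dom C k))"
    using c assms(4,5) by simp
  also have "\<dots> = FCel H \<beta> \<lhd>\<^bsub>B\<^esub> (e (Dom C r) \<odot>\<^bsub>B\<^esub> TA (FArr H k))"
    using lift_strict[OF assms(4)] assms(5) by simp
  also note compatible_whisker[OF assms(1-3) tight_arr[OF assms(4)] assms(5)]
  finally show ?thesis using c assms(4,5) unfolding compatible_def by simp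
qed

lemma compatible_tight_precomp:
  assumes "tight_cone g r \<beta>" "boundary g \<sigma>" "compatible g \<sigma> r \<beta>"
    "\<gamma> \<in> Cel C" "tight A (Src C \<gamma>)" "Tgt C \<gamma> = Src C \<beta>"
  shows "compatible g \<sigma> r (\<beta> \<bullet>\<^bsub>C\<^esub> \<gamma>)"
proof -
  note c = tight_coneD[OF assms(1)] and s = assms(2)[unfolded boundary_def]
  have d: "Dom C (Src C \<gamma>) = Dom C r" "Cod C (Src C \<gamma>) = Cod C g"
    using c assms(4,6) incl.D.Dom_Tgt[of \<gamma>] incl.D.Cod_Tgt[of \<gamma>] by simp_all
  have "FCel H (\<beta> \<bullet>\<^bsub>C\<^esub> \<gamma>) \<lhd>\<^bsub>B\<^esub> e (Dom C r)
      = (FCel H \<beta> \<lhd>\<^bsub>B\<^esub> e (Dom C r)) \<bullet>\<^bsub>B\<^esub> (FCel H \<gamma> \<lhd>\<^bsub>B\<^esub> e (Dom C r))"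
    using c assms(4,6) d by simp
  also have "\<dots> = ((\<sigma> \<lhd>\<^bsub>B\<^esub> TA (FArr H r)) \<bullet>\<^bsub>B\<^esub> (e (Cod C g) \<rhd>\<^bsub>B\<^esub> TC (FCel H \<beta>)))
      \<bullet>\<^bsub>B\<^esub> (e (Cod C g) \<rhd>\<^bsub>B\<^esub> TC (FCel H \<gamma>))"
    using assms(3) lift_cell[OF assms(4,5)] assms(6) c d unfolding compatible_def by simp
  also have "\<dots> = (\<sigma> \<lhd>\<^bsub>B\<^esub> TA (FArr H r)) \<bullet>\<^bsub>B\<^esub> (e (Cod C g) \<rhd>\<^bsub>B\<^esub> TC (FCel H (\<beta> \<bullet>\<^bsub>C\<^esub> \<gamma>)))"
    using c s assms(4,6) d by simp
  finally show ?thesis unfolding compatible_def by simp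
qed

text \<open>
  The universal property applied to the cone \<open>(1, id, g)\<close> gives \<open>t\<close>; its 2-dimensional part,
  applied to the 2-cells \<open>id\<close> and \<open>\<kappa>\<close> from the limit cone to the cone \<open>(p, id, g p)\<close> induced by \<open>t p\<close>,
  gives \<open>u\<close>. The condition on \<open>Q\<close> makes the two triples with an identity 2-cell cones.
\<close>

lemma limit_resolution:
  assumes lim: "is_limit Q A g X p q \<kappa>" and g: "g \<in> Arr C" and Q: "\<And>f. f \<in> Arr C \<Longrightarrow> Q (Id2 C f)"
  obtains t u where "resolution g X p \<kappa> t u"
proof -
  have tp: "tight A p" "tight A q" and cone: "cone Q A g X p \<kappa> q"
    using lim by (auto simp: is_limit_def)
  have p: "p \<in> Arr C" "Dom C p = X" "Cod C p = Dom C g" "q \<in> Arr C" "Dom C q = X" "Cod C q = Cod C g"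
      "\<kappa> \<in> Cel C" "Src C \<kappa> = q" "Tgt C \<kappa> = g \<odot>\<^bsub>C\<^esub> p" and X: "X \<in> Obj C"
    using cone incl.D.Dom_Obj[of p] by (auto simp: cone_def arr_def cell_def)
  have c1: "cone Q A g (Dom C g) (Id1 C (Dom C g)) (Id2 C g) g"
    using g Q by (simp add: cone_def arr_def cell_def)
  then obtain t where "induces A X p q \<kappa> (Dom C g) (Id1 C (Dom C g)) (Id2 C g) g t"
    using lim unfolding is_limit_def by blast
  then have t: "t \<in> Arr C" "Dom C t = Dom C g" "Cod C t = X" "p \<odot>\<^bsub>C\<^esub> t = Id1 C (Dom C g)"
      "q \<odot>\<^bsub>C\<^esub> t = g" "\<kappa> \<lhd>\<^bsub>C\<^esub> t = Id2 C g"
    by (auto simp: induces_def arr_def)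
  have c2: "cone Q A g X p (Id2 C (g \<odot>\<^bsub>C\<^esub> p)) (g \<odot>\<^bsub>C\<^esub> p)"
    using g p Q by (simp add: cone_def arr_def cell_def)
  have i1: "induces A X p q \<kappa> X p \<kappa> q (Id1 C X)"
    using p X by (simp add: induces_def arr_def)
  have e1: "p \<odot>\<^bsub>C\<^esub> (t \<odot>\<^bsub>C\<^esub> p) = p"
    using incl.D.Comp_assoc_simp[of p t p] t p g by simp
  have e2: "q \<odot>\<^bsub>C\<^esub> (t \<odot>\<^bsub>C\<^esub> p) = g \<odot>\<^bsub>C\<^esub> p"
    using incl.D.Comp_assoc_simp[of p t q] t p g by simp
  have "\<kappa> \<lhd>\<^bsub>C\<^esub> (t \<odot>\<^bsub>C\<^esub> p) = (\<kappa> \<lhd>\<^bsub>C\<^esub> t) \<lhd>\<^bsub>C\<^esub> p"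
    using t(1-3) p by simp
  then have e3: "\<kappa> \<lhd>\<^bsub>C\<^esub> (t \<odot>\<^bsub>C\<^esub> p) = Id2 C (g \<odot>\<^bsub>C\<^esub> p)"
    unfolding t(6) using p g by simp
  have i2: "induces A X p q \<kappa> X p (Id2 C (g \<odot>\<^bsub>C\<^esub> p)) (g \<odot>\<^bsub>C\<^esub> p) (t \<odot>\<^bsub>C\<^esub> p)"
    using p t(1-3) e1 e2 e3 by (simp add: induces_def arr_def)
  have "cell C (Id2 C p) p p" "cell C \<kappa> q (g \<odot>\<^bsub>C\<^esub> p)"
      "Id2 C (g \<odot>\<^bsub>C\<^esub> p) \<bullet>\<^bsub>C\<^esub> \<kappa> = (g \<rhd>\<^bsub>C\<^esub> Id2 C p) \<bullet>\<^bsub>C\<^esub> \<kappa>"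
    using p g by (simp_all add: cell_def)
  then have "\<exists>!u. cell C u (Id1 C X) (t \<odot>\<^bsub>C\<^esub> p) \<and> p \<rhd>\<^bsub>C\<^esub> u = Id2 C p \<and> q \<rhd>\<^bsub>C\<^esub> u = \<kappa>"
    using lim cone c2 i1 i2 unfolding is_limit_def by blast
  then obtain u where "cell C u (Id1 C X) (t \<odot>\<^bsub>C\<^esub> p)" "p \<rhd>\<^bsub>C\<^esub> u = Id2 C p" "q \<rhd>\<^bsub>C\<^esub> u = \<kappa>"
    by blast
  then have "resolution g X p \<kappa> t u"
    using g p t tp by (simp add: resolution_def tight_cone_def arr_def)
  with that show thesis by blast
qed

text \<open>
  The 1-cell \<open>k\<close> through which the cone factors is tight because the legs are, so that compatibility
  can be transported along it.
\<close>

lemma compatible_cone: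
  assumes lim: "is_limit Q A g X p q \<kappa>" and "boundary g \<sigma>" "compatible g \<sigma> p \<kappa>"
    and \<beta>: "tight_cone g r \<beta>" "Q \<beta>"
  shows "compatible g \<sigma> r \<beta>"
proof -
  note c = tight_coneD[OF \<beta>(1)]
  have "cone Q A g (Dom C r) r \<beta> (Src C \<beta>)"
    using c \<beta>(2) by (simp add: cone_def arr_def cell_def)
  then obtain k where "induces A X p q \<kappa> (Dom C r) r \<beta> (Src C \<beta>) k"
    using lim unfolding is_limit_def by blast
  then have k: "arr C k (Dom C r) X" "p \<odot>\<^bsub>C\<^esub> k = r" "q \<odot>\<^bsub>C\<^esub> k = Src C \<beta>" "\<kappa> \<lhd>\<^bsub>C\<^esub> k = \<beta>"
    by (auto simp: induces_def)
  have tk: "tight A k"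
    using lim k c unfolding is_limit_def by metis
  have cone: "cone Q A g X p \<kappa> q" "tight A p" "tight A q"
    using lim by (auto simp: is_limit_def)
  have "tight_cone g p \<kappa>" "Cod C k = Dom C p"
    using cone k(1) c(1) by (auto simp: tight_cone_def cone_def arr_def cell_def)
  from compatible_tight_whisker[OF this(1) assms(2,3) tk this(2)] show ?thesis
    unfolding k .
qed

end

section \<open>The structure 2-cells in the presence of limits\<close>

text \<open>
  The predicate \<open>Q\<close> selects the colax limits or the pseudolimits, which are the limits relevant to
  lax and to pseudo morphisms.
\<close>

locale algebra_lift_limits = algebra_lift A T H e
  for A :: "('o, 'm, 'c, 'n, 'd) f_cat"
    and T :: "('p, 'k, 'e) monad_data"
    and H :: "('o, 'n, 'd, 'p, 'k, 'e) two_map"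
    and e :: "'o \<Rightarrow> 'k" +
  fixes Q :: "'d \<Rightarrow> bool"
  assumes Q_cases: "Q = (\<lambda>_. True) \<or> Q = invertible (Loose A)"
    and limits: "f \<in> Arr (Loose A) \<Longrightarrow> \<exists>X p q \<kappa>. is_limit Q A f X p q \<kappa>"
begin

lemma Q_Id2: "f \<in> Arr C \<Longrightarrow> Q (Id2 C f)"
  using Q_cases incl.D.invertible_Id2 by auto

lemma obtain_limit_resolution:
  assumes "g \<in> Arr C"
  obtains X p q \<kappa> t u where "is_limit Q A g X p q \<kappa>" "resolution g X p \<kappa> t u" "Q \<kappa>"
proof -
  obtain X p q \<kappa> where l: "is_limit Q A g X p q \<kappa>" using limits[OF assms] by blast
  have "Q \<kappa>" using l unfolding is_limit_def cone_def by blast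
  obtain t u where "resolution g X p \<kappa> t u"
    by (rule limit_resolution[OF l assms Q_Id2])
  with l \<open>Q \<kappa>\<close> that show thesis by blast
qed

lemma obtain_resolution:
  assumes "g \<in> Arr C"
  obtains X p \<kappa> t u where "resolution g X p \<kappa> t u" "Q \<kappa>"
  by (rule obtain_limit_resolution[OF assms]) (rule that)

text \<open>
  In the pseudo case \<open>\<beta> : s \<Rightarrow> g r\<close> may fail to be a cone. Take the pseudolimit \<open>(X, p, q, \<kappa>)\<close> of
  \<open>h = g r\<close>. Then \<open>\<beta> p = \<kappa> \<gamma>\<close> for the 2-cell \<open>\<gamma> = \<kappa>\<^sup>-\<^sup>1 (\<beta> p) : s p \<Rightarrow> q\<close> between tight morphisms,
  which is an algebra 2-cell, while the invertible \<open>\<kappa>\<close> is a cone over \<open>g\<close> with tight legs \<open>r p\<close> and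
  \<open>q\<close>. Hence \<open>\<beta> p\<close> is compatible, and so is \<open>\<beta>\<close>, by whiskering with the section \<open>t\<close> of \<open>p\<close>.
\<close>

lemma compatible_all:
  assumes "boundary g \<sigma>" and Qcomp: "\<And>r \<beta>. tight_cone g r \<beta> \<Longrightarrow> Q \<beta> \<Longrightarrow> compatible g \<sigma> r \<beta>"
    and \<beta>: "tight_cone g r \<beta>"
  shows "compatible g \<sigma> r \<beta>"
proof (cases "Q = (\<lambda>_. True)")
  case True
  with Qcomp \<beta> show ?thesis by simp
next
  case False
  then have Q: "Q = invertible C" using Q_cases by blast
  note b = tight_coneD[OF \<beta>]
  define h where "h = g \<odot>\<^bsub>C\<^esub> r"
  have h: "h \<in> Arr C" "Dom C h = Dom C r" "Cod C h = Cod C g"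
    using b by (simp_all add: h_def)
  obtain X p \<kappa> t u where res: "resolution h X p \<kappa> t u" and "Q \<kappa>"
    by (rule obtain_resolution[OF h(1)])
  then have inv: "invertible C \<kappa>" using Q by simp
  note r = resolutionD[OF res] and k = tight_coneD[OF resolutionD(1)[OF res]]
  have p: "tight A p" "p \<in> Arr C" "Dom C p = X" "Cod C p = Dom C r"
    using k r h by simp_all
  have trp: "tight A (r \<odot>\<^bsub>C\<^esub> p)" using tight_Comp b p by simp
  have assoc: "h \<odot>\<^bsub>C\<^esub> p = g \<odot>\<^bsub>C\<^esub> (r \<odot>\<^bsub>C\<^esub> p)" using b p by (simp add: h_def)
  have cone_k: "tight_cone g (r \<odot>\<^bsub>C\<^esub> p) \<kappa>"
    using b p k trp assoc by (simp add: tight_cone_def)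
  obtain \<kappa>' where k': "\<kappa>' \<in> Cel C" "Src C \<kappa>' = h \<odot>\<^bsub>C\<^esub> p" "Tgt C \<kappa>' = Src C \<kappa>"
      "\<kappa> \<bullet>\<^bsub>C\<^esub> \<kappa>' = Id2 C (h \<odot>\<^bsub>C\<^esub> p)"
    using inv k(7) unfolding invertible_def cell_def by metis
  define \<gamma> where "\<gamma> = \<kappa>' \<bullet>\<^bsub>C\<^esub> (\<beta> \<lhd>\<^bsub>C\<^esub> p)"
  have bp: "\<beta> \<lhd>\<^bsub>C\<^esub> p \<in> Cel C" "Src C (\<beta> \<lhd>\<^bsub>C\<^esub> p) = Src C \<beta> \<odot>\<^bsub>C\<^esub> p" "Tgt C (\<beta> \<lhd>\<^bsub>C\<^esub> p) = h \<odot>\<^bsub>C\<^esub> p"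
    using b p by (simp_all add: h_def)
  have g: "\<gamma> \<in> Cel C" "Src C \<gamma> = Src C \<beta> \<odot>\<^bsub>C\<^esub> p" "Tgt C \<gamma> = Src C \<kappa>"
    unfolding \<gamma>_def using bp k' by simp_all
  have "\<kappa> \<bullet>\<^bsub>C\<^esub> \<gamma> = (\<kappa> \<bullet>\<^bsub>C\<^esub> \<kappa>') \<bullet>\<^bsub>C\<^esub> (\<beta> \<lhd>\<^bsub>C\<^esub> p)"
    unfolding \<gamma>_def using bp k'(1-3) k by simp
  then have kg: "\<kappa> \<bullet>\<^bsub>C\<^esub> \<gamma> = \<beta> \<lhd>\<^bsub>C\<^esub> p"
    unfolding k'(4) using bp by simp
  have ts: "tight A (Src C \<gamma>)" unfolding g using tight_Comp b p by simp
  have comp: "compatible g \<sigma> (r \<odot>\<^bsub>C\<^esub> p) (\<beta> \<lhd>\<^bsub>C\<^esub> p)"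
    using compatible_tight_precomp[OF cone_k assms(1) Qcomp[OF cone_k] g(1) ts g(3)] inv
    unfolding kg Q by simp
  have cone_bp: "tight_cone g (r \<odot>\<^bsub>C\<^esub> p) (\<beta> \<lhd>\<^bsub>C\<^esub> p)"
    unfolding tight_cone_def using b p bp trp assoc ts g by simp
  have t: "t \<in> Arr C" "Dom C t = Dom C r" "Cod C t = X" "p \<odot>\<^bsub>C\<^esub> t = Id1 C (Dom C r)"
    using r h by simp_all
  have rpt: "(r \<odot>\<^bsub>C\<^esub> p) \<odot>\<^bsub>C\<^esub> t = r"
    using t b p incl.D.Comp_assoc_simp[of t p r] by simp
  have bpt: "(\<beta> \<lhd>\<^bsub>C\<^esub> p) \<lhd>\<^bsub>C\<^esub> t = \<beta>"
    using t b p incl.D.HComp_assoc_simp[of "Id2 C t" "Id2 C p" \<beta>] by simp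
  have "FCel H \<beta> \<lhd>\<^bsub>B\<^esub> (FArr H p \<odot>\<^bsub>B\<^esub> (e X \<odot>\<^bsub>B\<^esub> TA (FArr H t)))
      = FCel H (\<beta> \<lhd>\<^bsub>C\<^esub> p) \<lhd>\<^bsub>B\<^esub> (e X \<odot>\<^bsub>B\<^esub> TA (FArr H t))"
    using b p t(1-3) r(2) by simp
  also have "\<dots> = (\<sigma> \<lhd>\<^bsub>B\<^esub> TA (FArr H r)) \<bullet>\<^bsub>B\<^esub> (e (Cod C g) \<rhd>\<^bsub>B\<^esub> TC (FCel H \<beta>))"
    using compatible_whisker[OF cone_bp assms(1) comp t(1)] t(3) b p unfolding rpt bpt by simp
  finally show ?thesis
    unfolding compatible_def using lift_strict_section(1)[OF res] h by simp
qed

lemma structure_cell_mate: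
  assumes lim: "is_limit Q A g X p q \<kappa>" and res: "resolution g X p \<kappa> t u"
  shows "structure_cell g (mate X \<kappa> t)"
  unfolding structure_cell_def
  using compatible_all[OF boundary_mate[OF res] compatible_cone[OF lim boundary_mate[OF res] compatible_mate[OF res]]]
    boundary_mate[OF res] by blast

text \<open>
  The choice is immaterial, structure cells being unique in the presence of limits.
\<close>

definition str :: "'n \<Rightarrow> 'e" where
  "str g = (SOME \<sigma>. structure_cell g \<sigma>)"

lemma structure_cell_str:
  assumes "g \<in> Arr C"
  shows "structure_cell g (str g)"
proof -
  obtain X p q \<kappa> t u where "is_limit Q A g X p q \<kappa>" "resolution g X p \<kappa> t u"
    by (rule obtain_limit_resolution[OF assms])
  then have "structure_cell g (mate X \<kappa> t)" by (rule structure_cell_mate)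
  then show ?thesis unfolding str_def by (rule someI)
qed

lemma str_boundary:
  assumes "g \<in> Arr C"
  shows "str g \<in> Cel B" "Src B (str g) = e (Cod C g) \<odot>\<^bsub>B\<^esub> TA (FArr H g)"
    "Tgt B (str g) = FArr H g \<odot>\<^bsub>B\<^esub> e (Dom C g)"
  using structure_cell_str[OF assms] by (simp_all add: structure_cell_def boundary_def)

lemma str_whisker:
  assumes "tight_cone g r \<beta>" "t \<in> Arr C" "Cod C t = Dom C r"
  shows "FCel H \<beta> \<lhd>\<^bsub>B\<^esub> (e (Dom C r) \<odot>\<^bsub>B\<^esub> TA (FArr H t))
    = (str g \<lhd>\<^bsub>B\<^esub> TA (FArr H (r \<odot>\<^bsub>C\<^esub> t))) \<bullet>\<^bsub>B\<^esub> (e (Cod C g) \<rhd>\<^bsub>B\<^esub> TC (FCel H (\<beta> \<lhd>\<^bsub>C\<^esub> t)))"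
  using structure_cell_str[of g] tight_coneD(1)[OF assms(1)] assms
    compatible_whisker[OF assms(1) _ _ assms(2,3)]
  by (simp add: structure_cell_def)

lemma str_eq_mate: "resolution g X p \<kappa> t u \<Longrightarrow> str g = mate X \<kappa> t"
  using structure_cell_eq_mate[OF structure_cell_str] resolutionD(1) tight_coneD(1) by blast

lemma str_invertible:
  assumes "Q = invertible C" "g \<in> Arr C"
  shows "invertible B (str g)"
proof -
  obtain X p \<kappa> t u where res: "resolution g X p \<kappa> t u" and "Q \<kappa>"
    by (rule obtain_resolution[OF assms(2)])
  then have "invertible C \<kappa>" using assms(1) by simp
  then show ?thesis
    unfolding str_eq_mate[OF res] mate_def
    using resolutionD[OF res] tight_coneD[OF resolutionD(1)[OF res]]
    by (intro mult.F.C.invertible_rwhisk H.invertible_FCel) simp_all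
qed

text \<open>
  Compatibility with the identity 2-cell of \<open>f\<close>, seen as a cone with legs \<open>1\<close> and \<open>f\<close>.
\<close>

lemma str_tight:
  assumes "tight A f"
  shows "str f = Id2 B (FArr H f \<odot>\<^bsub>B\<^esub> e (Dom C f))"
proof -
  have f: "f \<in> Arr C" using assms by simp
  have c: "tight_cone f (Id1 C (Dom C f)) (Id2 C f)"
    using assms f tight_Id1 by (simp add: tight_cone_def)
  have "Id2 B (FArr H f) \<lhd>\<^bsub>B\<^esub> e (Dom C f)
      = str f \<bullet>\<^bsub>B\<^esub> Id2 B (e (Cod C f) \<odot>\<^bsub>B\<^esub> TA (FArr H f))"
    using str_whisker[OF c, of "Id1 C (Dom C f)"] f str_boundary[OF f] by simp
  then show ?thesis using str_boundary[OF f] f by simp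
qed

text \<open>
  By naturality of the unit and the unit law of \<open>e X\<close>, the whiskering by \<open>e X \<circ> T(Ht)\<close> in the mate
  becomes one by \<open>Ht\<close>, and \<open>\<kappa> t = id\<close>.
\<close>

lemma str_unit:
  assumes f: "f \<in> Arr C"
  shows "str f \<lhd>\<^bsub>B\<^esub> Unit T (FObj H (Dom C f)) = Id2 B (FArr H f)"
proof -
  obtain X p \<kappa> t u where res: "resolution f X p \<kappa> t u"
    by (rule obtain_resolution[OF f])
  note r = resolutionD[OF res] and k = tight_coneD[OF resolutionD(1)[OF res]]
  have nat: "TA (FArr H t) \<odot>\<^bsub>B\<^esub> Unit T (FObj H (Dom C f)) = Unit T (FObj H X) \<odot>\<^bsub>B\<^esub> FArr H t"
    using unit.naturality_1[of "FArr H t"] r by simp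
  have "e X \<odot>\<^bsub>B\<^esub> (TA (FArr H t) \<odot>\<^bsub>B\<^esub> Unit T (FObj H (Dom C f)))
      = (e X \<odot>\<^bsub>B\<^esub> Unit T (FObj H X)) \<odot>\<^bsub>B\<^esub> FArr H t"
    unfolding nat using r(2-8) by simp
  also have "\<dots> = FArr H t" unfolding lift_Unit[OF r(2)] using r by simp
  finally have et: "e X \<odot>\<^bsub>B\<^esub> (TA (FArr H t) \<odot>\<^bsub>B\<^esub> Unit T (FObj H (Dom C f))) = FArr H t" .
  have "str f \<lhd>\<^bsub>B\<^esub> Unit T (FObj H (Dom C f)) = FCel H \<kappa> \<lhd>\<^bsub>B\<^esub> (e X \<odot>\<^bsub>B\<^esub> (TA (FArr H t) \<odot>\<^bsub>B\<^esub> Unit T (FObj H (Dom C f))))"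
    unfolding str_eq_mate[OF res] mate_def using r(2-8) k f by simp
  also have "\<dots> = FCel H (\<kappa> \<lhd>\<^bsub>C\<^esub> t)" unfolding et using r(2-8) k by simp
  also have "\<dots> = Id2 B (FArr H f)" unfolding r(11) using f by simp
  finally show ?thesis .
qed

text \<open>
  By naturality of the multiplication and associativity of \<open>e X\<close>, the left-hand side is
  \<open>H\<kappa> \<lhd> e X\<close> whiskered with \<open>T(e X) \<circ> TT(Ht)\<close>. Compatibility with \<open>\<kappa>\<close> splits it into the two factors
  on the right, the second of which arises by applying \<open>T\<close> to the mate.
\<close>

lemma str_mult:
  assumes f: "f \<in> Arr C"
  shows "str f \<lhd>\<^bsub>B\<^esub> Mult T (FObj H (Dom C f))
    = (str f \<lhd>\<^bsub>B\<^esub> TA (e (Dom C f))) \<bullet>\<^bsub>B\<^esub> (e (Cod C f) \<rhd>\<^bsub>B\<^esub> TC (str f))"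
proof -
  obtain X p \<kappa> t u where res: "resolution f X p \<kappa> t u"
    by (rule obtain_resolution[OF f])
  note r = resolutionD[OF res] and k = tight_coneD[OF resolutionD(1)[OF res]]
  let ?x = "FObj H (Dom C f)" and ?t = "FArr H t"
  let ?m = "TA (e X) \<odot>\<^bsub>B\<^esub> TA (TA ?t)"
  have nat: "TA ?t \<odot>\<^bsub>B\<^esub> Mult T ?x = Mult T (FObj H X) \<odot>\<^bsub>B\<^esub> TA (TA ?t)"
    using mult.naturality_1[of ?t] r by simp
  have "e X \<odot>\<^bsub>B\<^esub> (TA ?t \<odot>\<^bsub>B\<^esub> Mult T ?x) = (e X \<odot>\<^bsub>B\<^esub> Mult T (FObj H X)) \<odot>\<^bsub>B\<^esub> TA (TA ?t)"
    unfolding nat using r(2-8) by simp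
  also have "\<dots> = e X \<odot>\<^bsub>B\<^esub> ?m" unfolding lift_Mult[OF r(2), symmetric] using r(2-8) by simp
  finally have et: "e X \<odot>\<^bsub>B\<^esub> (TA ?t \<odot>\<^bsub>B\<^esub> Mult T ?x) = e X \<odot>\<^bsub>B\<^esub> ?m" .
  have Te: "TA (FArr H p) \<odot>\<^bsub>B\<^esub> ?m = TA (e (Dom C f))"
    using arg_cong[OF lift_strict_section(1)[OF res], of TA] r(2-8) f by simp
  have "str f \<lhd>\<^bsub>B\<^esub> Mult T ?x = FCel H \<kappa> \<lhd>\<^bsub>B\<^esub> (e X \<odot>\<^bsub>B\<^esub> (TA ?t \<odot>\<^bsub>B\<^esub> Mult T ?x))"
    unfolding str_eq_mate[OF res] mate_def using r(2-8) k f by simp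
  also have "\<dots> = (FCel H \<kappa> \<lhd>\<^bsub>B\<^esub> e X) \<lhd>\<^bsub>B\<^esub> ?m" unfolding et using r(2-8) k by simp
  also have "FCel H \<kappa> \<lhd>\<^bsub>B\<^esub> e X
      = (str f \<lhd>\<^bsub>B\<^esub> TA (FArr H p)) \<bullet>\<^bsub>B\<^esub> (e (Cod C f) \<rhd>\<^bsub>B\<^esub> TC (FCel H \<kappa>))"
    using structure_cell_str[OF f] r(1,4) by (simp add: structure_cell_def compatible_def)
  also have "\<dots> \<lhd>\<^bsub>B\<^esub> ?m = (str f \<lhd>\<^bsub>B\<^esub> (TA (FArr H p) \<odot>\<^bsub>B\<^esub> ?m))
      \<bullet>\<^bsub>B\<^esub> (e (Cod C f) \<rhd>\<^bsub>B\<^esub> TC (mate X \<kappa> t))"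
    unfolding mate_def using r(2-8) k f str_boundary[OF f] by simp
  finally show ?thesis unfolding Te str_eq_mate[OF res] .
qed

lemma str_natural:
  assumes \<alpha>: "\<alpha> \<in> Cel C" "Src C \<alpha> = f" "Tgt C \<alpha> = g"
  shows "(FCel H \<alpha> \<lhd>\<^bsub>B\<^esub> e (Dom C f)) \<bullet>\<^bsub>B\<^esub> str f = str g \<bullet>\<^bsub>B\<^esub> (e (Cod C f) \<rhd>\<^bsub>B\<^esub> TC (FCel H \<alpha>))"
proof -
  have f: "f \<in> Arr C" and g: "g \<in> Arr C" "Dom C g = Dom C f" "Cod C g = Cod C f"
    using \<alpha> by auto
  obtain X p \<kappa> t u where res: "resolution f X p \<kappa> t u"
    by (rule obtain_resolution[OF f])
  note r = resolutionD[OF res] and k = tight_coneD[OF resolutionD(1)[OF res]]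
  \<comment> \<open>A cone over \<open>g\<close> with tight legs from which whiskering with \<open>t\<close> recovers \<open>\<alpha>\<close>.\<close>
  let ?\<beta> = "(\<alpha> \<lhd>\<^bsub>C\<^esub> p) \<bullet>\<^bsub>C\<^esub> \<kappa>"
  have c: "tight_cone g p ?\<beta>" unfolding tight_cone_def using k g r(2-8) \<alpha> by simp
  have "?\<beta> \<lhd>\<^bsub>C\<^esub> t = (\<alpha> \<lhd>\<^bsub>C\<^esub> (p \<odot>\<^bsub>C\<^esub> t)) \<bullet>\<^bsub>C\<^esub> (\<kappa> \<lhd>\<^bsub>C\<^esub> t)"
    using k r(2-8) g \<alpha> by simp
  also have "\<dots> = \<alpha>" unfolding r(9,11) using \<alpha> f by simp
  finally have bt: "?\<beta> \<lhd>\<^bsub>C\<^esub> t = \<alpha>" .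
  have "(FCel H \<alpha> \<lhd>\<^bsub>B\<^esub> e (Dom C f)) \<bullet>\<^bsub>B\<^esub> str f
      = (FCel H \<alpha> \<lhd>\<^bsub>B\<^esub> (FArr H p \<odot>\<^bsub>B\<^esub> (e X \<odot>\<^bsub>B\<^esub> TA (FArr H t)))) \<bullet>\<^bsub>B\<^esub> mate X \<kappa> t"
    unfolding lift_strict_section(1)[OF res] str_eq_mate[OF res] ..
  also have "\<dots> = FCel H ?\<beta> \<lhd>\<^bsub>B\<^esub> (e X \<odot>\<^bsub>B\<^esub> TA (FArr H t))"
    unfolding mate_def using k r(2-8) \<alpha> by simp
  also have "\<dots> = (str g \<lhd>\<^bsub>B\<^esub> TA (FArr H (p \<odot>\<^bsub>C\<^esub> t))) \<bullet>\<^bsub>B\<^esub> (e (Cod C g) \<rhd>\<^bsub>B\<^esub> TC (FCel H \<alpha>))"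
    using str_whisker[OF c r(6)] r(4,8) unfolding bt by simp
  also have "\<dots> = str g \<bullet>\<^bsub>B\<^esub> (e (Cod C f) \<rhd>\<^bsub>B\<^esub> TC (FCel H \<alpha>))"
    unfolding r(9) using str_boundary[OF g(1)] f g by simp
  finally show ?thesis .
qed

text \<open>
  Resolve \<open>f\<close> by \<open>(X, p, q, \<kappa>)\<close>, and then \<open>g q\<close>, where \<open>q\<close> is tight, by \<open>(X', p', q', \<kappa>')\<close>. The pasting
  \<open>(g \<kappa> p') \<kappa>'\<close> is a 2-cell \<open>q' \<Rightarrow> g f p p'\<close> between tight legs over \<open>g f\<close>, and \<open>s = t' t\<close> is a section
  of \<open>p p'\<close>. Whiskering by \<open>s\<close> turns the pasting into \<open>str (g f)\<close>, and its two layers into the two factors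
  on the right.
\<close>

lemma str_Comp:
  assumes f: "f \<in> Arr C" and g: "g \<in> Arr C" and fg: "Cod C f = Dom C g"
  shows "str (g \<odot>\<^bsub>C\<^esub> f) = (FArr H g \<rhd>\<^bsub>B\<^esub> str f) \<bullet>\<^bsub>B\<^esub> (str g \<lhd>\<^bsub>B\<^esub> TA (FArr H f))"
proof -
  obtain X p \<kappa> t u where res: "resolution f X p \<kappa> t u"
    by (rule obtain_resolution[OF f])
  define q where "q = Src C \<kappa>"
  note r = resolutionD[OF res, folded q_def] and k = tight_coneD[OF resolutionD(1)[OF res], folded q_def]
  have q: "q \<in> Arr C" "Dom C q = X" "Cod C q = Dom C g" "tight A q"
    using k r fg by simp_all
  have gq: "g \<odot>\<^bsub>C\<^esub> q \<in> Arr C" using g q by simp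
  obtain X' p' \<kappa>' t' u' where res': "resolution (g \<odot>\<^bsub>C\<^esub> q) X' p' \<kappa>' t' u'"
    by (rule obtain_resolution[OF gq])
  note r' = resolutionD[OF res'] and k' = tight_coneD[OF resolutionD(1)[OF res']]
  have t': "p' \<in> Arr C" "Dom C p' = X'" "Cod C p' = X" "tight A p'" "t' \<in> Arr C" "Dom C t' = X" "Cod C t' = X'"
      "p' \<odot>\<^bsub>C\<^esub> t' = Id1 C X" "\<kappa>' \<lhd>\<^bsub>C\<^esub> t' = Id2 C (g \<odot>\<^bsub>C\<^esub> q)"
      "\<kappa>' \<in> Cel C" "tight A (Src C \<kappa>')" "Tgt C \<kappa>' = g \<odot>\<^bsub>C\<^esub> (q \<odot>\<^bsub>C\<^esub> p')"
      "Dom C (Src C \<kappa>') = X'" "Cod C (Src C \<kappa>') = Cod C g" "X' \<in> Obj C"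
    using r' k' g q by simp_all
  let ?s = "t' \<odot>\<^bsub>C\<^esub> t"
  let ?\<beta> = "(g \<rhd>\<^bsub>C\<^esub> (\<kappa> \<lhd>\<^bsub>C\<^esub> p')) \<bullet>\<^bsub>C\<^esub> \<kappa>'"
  let ?m = "e X' \<odot>\<^bsub>B\<^esub> TA (FArr H ?s)"
  have s: "?s \<in> Arr C" "Dom C ?s = Dom C f" "Cod C ?s = X'" using t' r(2-8) by simp_all
  have tt: "p' \<odot>\<^bsub>C\<^esub> ?s = t"
    using incl.D.Comp_assoc_simp[of t t' p'] t' r(2-8) by simp
  have tpp: "tight A (p \<odot>\<^bsub>C\<^esub> p')" "tight A (q \<odot>\<^bsub>C\<^esub> p')" using tight_Comp t' k r q by simp_all
  \<comment> \<open>\<open>\<kappa>'\<close> is also a cone over \<open>g\<close> itself, with tight leg \<open>q p'\<close>.\<close>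
  have cone': "tight_cone g (q \<odot>\<^bsub>C\<^esub> p') \<kappa>'"
    unfolding tight_cone_def using tpp g q t' by simp
  have cone: "tight_cone (g \<odot>\<^bsub>C\<^esub> f) (p \<odot>\<^bsub>C\<^esub> p') ?\<beta>"
    unfolding tight_cone_def using tpp f g fg k r(2-8) t' q_def by simp
  have pps: "(p \<odot>\<^bsub>C\<^esub> p') \<odot>\<^bsub>C\<^esub> ?s = Id1 C (Dom C f)" "(q \<odot>\<^bsub>C\<^esub> p') \<odot>\<^bsub>C\<^esub> ?s = f"
    using incl.D.Comp_assoc_simp[of ?s p' p] incl.D.Comp_assoc_simp[of ?s p' q] tt s t' k r(2-8) q r(9,10)
    by simp_all
  have "\<kappa>' \<lhd>\<^bsub>C\<^esub> ?s = (\<kappa>' \<lhd>\<^bsub>C\<^esub> t') \<lhd>\<^bsub>C\<^esub> t" using t'(1-7,10-15) r(2-8) by simp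
  also have "\<dots> = Id2 C (g \<odot>\<^bsub>C\<^esub> (q \<odot>\<^bsub>C\<^esub> t))" unfolding t'(9) using g q r(2-8) by simp
  finally have ks: "\<kappa>' \<lhd>\<^bsub>C\<^esub> ?s = Id2 C (g \<odot>\<^bsub>C\<^esub> f)" unfolding r(10) .
  have "?\<beta> \<lhd>\<^bsub>C\<^esub> ?s = (g \<rhd>\<^bsub>C\<^esub> (\<kappa> \<lhd>\<^bsub>C\<^esub> (p' \<odot>\<^bsub>C\<^esub> ?s))) \<bullet>\<^bsub>C\<^esub> (\<kappa>' \<lhd>\<^bsub>C\<^esub> ?s)"
    using t'(1-7,10-15) s g fg k q r(2-8) q_def by simp
  also have "\<dots> = Id2 C (g \<odot>\<^bsub>C\<^esub> f)"
    unfolding tt ks r(11) using f g fg by simp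
  finally have bs: "?\<beta> \<lhd>\<^bsub>C\<^esub> ?s = Id2 C (g \<odot>\<^bsub>C\<^esub> f)" .
  have gf: "g \<odot>\<^bsub>C\<^esub> f \<in> Arr C" "Dom C (g \<odot>\<^bsub>C\<^esub> f) = Dom C f" "Cod C (g \<odot>\<^bsub>C\<^esub> f) = Cod C g"
    using f g fg by simp_all
  have em: "FArr H p' \<odot>\<^bsub>B\<^esub> ?m = e X \<odot>\<^bsub>B\<^esub> TA (FArr H t)"
  proof -
    have "FArr H p' \<odot>\<^bsub>B\<^esub> ?m = e X \<odot>\<^bsub>B\<^esub> TA (FArr H (p' \<odot>\<^bsub>C\<^esub> ?s))"
      using lift_strict_comp[of p' "TA (FArr H ?s)"] t'(1-7) s r(2-8) by simp
    then show ?thesis unfolding tt .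
  qed
  have "FCel H ?\<beta> \<lhd>\<^bsub>B\<^esub> ?m
      = (str (g \<odot>\<^bsub>C\<^esub> f) \<lhd>\<^bsub>B\<^esub> TA (FArr H (Id1 C (Dom C f))))
        \<bullet>\<^bsub>B\<^esub> (e (Cod C g) \<rhd>\<^bsub>B\<^esub> TC (FCel H (Id2 C (g \<odot>\<^bsub>C\<^esub> f))))"
    using str_whisker[OF cone s(1)] s t'(1-3) r(2-8) gf unfolding pps bs by simp
  also have "\<dots> = str (g \<odot>\<^bsub>C\<^esub> f)"
    using str_boundary[OF gf(1)] f g gf by simp
  finally have "str (g \<odot>\<^bsub>C\<^esub> f) = FCel H ?\<beta> \<lhd>\<^bsub>B\<^esub> ?m" by simp
  also have "\<dots> = (FArr H g \<rhd>\<^bsub>B\<^esub> (FCel H \<kappa> \<lhd>\<^bsub>B\<^esub> (FArr H p' \<odot>\<^bsub>B\<^esub> ?m))) \<bullet>\<^bsub>B\<^esub> (FCel H \<kappa>' \<lhd>\<^bsub>B\<^esub> ?m)"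
    using t'(1-7,10-15) s g fg k q r(2-8) q_def by simp
  also have "FCel H \<kappa> \<lhd>\<^bsub>B\<^esub> (FArr H p' \<odot>\<^bsub>B\<^esub> ?m) = str f"
    unfolding em str_eq_mate[OF res] mate_def ..
  also have "FCel H \<kappa>' \<lhd>\<^bsub>B\<^esub> ?m = (str g \<lhd>\<^bsub>B\<^esub> TA (FArr H f))
      \<bullet>\<^bsub>B\<^esub> (e (Cod C g) \<rhd>\<^bsub>B\<^esub> TC (FCel H (Id2 C (g \<odot>\<^bsub>C\<^esub> f))))"
    using str_whisker[OF cone' s(1)] s t'(1-3) q unfolding pps ks by simp
  also have "\<dots> = str g \<lhd>\<^bsub>B\<^esub> TA (FArr H f)"
    using str_boundary[OF g] f g fg by simp
  finally show ?thesis .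
qed

end

section \<open>Coherent families of structure 2-cells\<close>

definition lift_obj :: "('o, 'n, 'd, 'p, 'k, 'e) two_map \<Rightarrow> ('o \<Rightarrow> 'k) \<Rightarrow> 'o \<Rightarrow> ('p, 'k) alg" where
  "lift_obj H e x = (FObj H x, e x)"

definition lift_mor ::
  "('o, 'm, 'c, 'n, 'd) f_cat \<Rightarrow> ('o, 'n, 'd, 'p, 'k, 'e) two_map \<Rightarrow> ('o \<Rightarrow> 'k) \<Rightarrow> ('n \<Rightarrow> 'e)
    \<Rightarrow> 'n \<Rightarrow> ('p, 'k, 'e) alg_mor" where
  "lift_mor A H e str f =
     AlgMor (lift_obj H e (Dom (Loose A) f)) (lift_obj H e (Cod (Loose A) f)) (FArr H f) (str f)"

definition lift_cel ::
  "('o, 'm, 'c, 'n, 'd) f_cat \<Rightarrow> ('o, 'n, 'd, 'p, 'k, 'e) two_map \<Rightarrow> ('o \<Rightarrow> 'k) \<Rightarrow> ('n \<Rightarrow> 'e)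
    \<Rightarrow> 'd \<Rightarrow> ('p, 'k, 'e) alg_cell" where
  "lift_cel A H e str \<alpha> =
     AlgCell (lift_mor A H e str (Src (Loose A) \<alpha>)) (lift_mor A H e str (Tgt (Loose A) \<alpha>)) (FCel H \<alpha>)"

text \<open>
  The conditions on structure 2-cells under which \<open>lift_obj\<close>, \<open>lift_mor\<close> and \<open>lift_cel\<close> form an
  extension. Preservation of identities is the instance of the last condition at identity 1-cells.
\<close>

definition coherent ::
  "weakness \<Rightarrow> ('o, 'm, 'c, 'n, 'd) f_cat \<Rightarrow> ('p, 'k, 'e) monad_data
    \<Rightarrow> ('o, 'n, 'd, 'p, 'k, 'e) two_map \<Rightarrow> ('o \<Rightarrow> 'k) \<Rightarrow> ('n \<Rightarrow> 'e) \<Rightarrow> bool" where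
  "coherent w A T H e str \<longleftrightarrow>
     (\<forall>f\<in>Arr (Loose A). weak_mor w T (lift_mor A H e str f)) \<and>
     (\<forall>\<alpha>\<in>Cel (Loose A). weak_cell w T (lift_cel A H e str \<alpha>)) \<and>
     (\<forall>f\<in>Arr (Loose A). \<forall>g\<in>Arr (Loose A). Cod (Loose A) f = Dom (Loose A) g \<longrightarrow>
        lift_mor A H e str (g \<odot>\<^bsub>Loose A\<^esub> f)
          = alg_mor_comp w T (lift_mor A H e str g) (lift_mor A H e str f)) \<and>
     (\<forall>f. tight A f \<longrightarrow> str f = Id2 (Base T) (FArr H f \<odot>\<^bsub>Base T\<^esub> e (Dom (Loose A) f)))"

lemma lift_mor_sel [simp]:
  "alg_dom (lift_mor A H e str f) = (FObj H (Dom (Loose A) f), e (Dom (Loose A) f))"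
  "alg_cod (lift_mor A H e str f) = (FObj H (Cod (Loose A) f), e (Cod (Loose A) f))"
  "und_arr (lift_mor A H e str f) = FArr H f"
  "str_cell (lift_mor A H e str f) = str f"
  by (simp_all add: lift_mor_def lift_obj_def)

lemma lift_cel_sel [simp]:
  "alg_src (lift_cel A H e str \<alpha>) = lift_mor A H e str (Src (Loose A) \<alpha>)"
  "alg_tgt (lift_cel A H e str \<alpha>) = lift_mor A H e str (Tgt (Loose A) \<alpha>)"
  "und_cell (lift_cel A H e str \<alpha>) = FCel H \<alpha>"
  by (simp_all add: lift_cel_def)

lemma f_cat_co_simps [simp]:
  "Tight (f_cat_co A) = two_cat_co (Tight A)" "Loose (f_cat_co A) = two_cat_co (Loose A)"
  "Incl (f_cat_co A) = Incl A" "tight (f_cat_co A) f \<longleftrightarrow> tight A f"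
  by (simp_all add: f_cat_co_def tight_def)

lemma (in f_category) f_category_co: "f_category (f_cat_co A)"
proof (intro f_category.intro f_category_axioms.intro)
  show "two_functor (Tight (f_cat_co A)) (Loose (f_cat_co A)) (Incl (f_cat_co A))"
    using incl.two_functor_co by simp
  show "bij_betw (FCel (Incl (f_cat_co A))) {\<alpha>. cell (Tight (f_cat_co A)) \<alpha> f g}
      {\<beta>. cell (Loose (f_cat_co A)) \<beta> (FArr (Incl (f_cat_co A)) f) (FArr (Incl (f_cat_co A)) g)}"
    if "arr (Tight (f_cat_co A)) f x y" "arr (Tight (f_cat_co A)) g x y" for f g x y
    using that Incl_locally_fully_faithful[of g x y f] by simp
qed (auto simp: Obj_eq Incl_Obj Incl_faithful)

lemma (in algebra_lift) algebra_lift_co: "algebra_lift (f_cat_co A) (monad_co T) H e"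
proof (intro algebra_lift.intro algebra_lift_axioms.intro f_category_co two_monad_co)
  show "two_functor (Loose (f_cat_co A)) (Base (monad_co T)) H"
    using H.two_functor_co by simp
qed (simp_all add: lift_alg lift_strict lift_cell)

lemma lift_mor_co [simp]: "lift_mor (f_cat_co A) H e str f = lift_mor A H e str f"
  by (simp add: lift_mor_def)

text \<open>
  The reversal of algebra 2-cells under duality matches the exchange of \<open>Src\<close> and \<open>Tgt\<close> in
  \<open>lift_cel\<close>.
\<close>

lemma coherent_co: "coherent Lax (f_cat_co A) (monad_co T) H e str \<longleftrightarrow> coherent Colax A T H e str"
proof -
  have "weak_cell Lax (monad_co T) (lift_cel (f_cat_co A) H e str \<alpha>)
      \<longleftrightarrow> weak_cell Colax T (lift_cel A H e str \<alpha>)" for \<alpha>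
    unfolding lift_cel_def lift_mor_co f_cat_co_simps two_cat_co_simps by (rule weak_cell_co)
  then show ?thesis by (simp add: coherent_def)
qed

context algebra_lift
begin

text \<open>
  In a coherent family \<open>H\<beta>\<close> is an algebra 2-cell for every \<open>\<beta>\<close>. When the legs are tight, their
  structure 2-cells are identities, the one of \<open>g r\<close> is that of \<open>g\<close> whiskered with \<open>T(Hr)\<close>, and the
  condition on \<open>H\<beta>\<close> becomes compatibility.
\<close>

lemma structure_cell_coherent:
  assumes coh: "coherent w A T H e str" and w: "w \<noteq> Colax" and g: "g \<in> Arr C"
  shows "structure_cell g (str g)"
proof -
  have lax: "lax_mor T (lift_mor A H e str f)" if "f \<in> Arr C" for f
    using coh that weak_mor_cases[OF w] by (simp add: coherent_def)
  have b: "boundary f (str f)" if "f \<in> Arr C" for f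
    using lax[OF that] by (simp add: lax_mor_iff boundary_def)
  have "compatible g (str g) r \<beta>" if \<beta>: "tight_cone g r \<beta>" for r \<beta>
  proof -
    note k = tight_coneD[OF \<beta>]
    let ?s = "Src C \<beta>"
    have ts: "str ?s = Id2 B (FArr H ?s \<odot>\<^bsub>B\<^esub> e (Dom C r))" "str r = Id2 B (FArr H r \<odot>\<^bsub>B\<^esub> e (Dom C r))"
      using coh k by (simp_all add: coherent_def)
    have "lift_mor A H e str (g \<odot>\<^bsub>C\<^esub> r) = alg_mor_comp w T (lift_mor A H e str g) (lift_mor A H e str r)"
      using coh k by (simp add: coherent_def)
    then have "str (g \<odot>\<^bsub>C\<^esub> r) = (FArr H g \<rhd>\<^bsub>B\<^esub> str r) \<bullet>\<^bsub>B\<^esub> (str g \<lhd>\<^bsub>B\<^esub> TA (FArr H r))"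
      using str_cell_comp[OF w] lift_mor_sel by metis
    then have gr: "str (g \<odot>\<^bsub>C\<^esub> r) = str g \<lhd>\<^bsub>B\<^esub> TA (FArr H r)"
      unfolding ts using k b[OF k(1)] lift_strict[OF k(2)] by (simp add: boundary_def)
    have "weak_cell w T (lift_cel A H e str \<beta>)"
      using coh k by (simp add: coherent_def)
    then have "(FCel H \<beta> \<lhd>\<^bsub>B\<^esub> e (Dom C r)) \<bullet>\<^bsub>B\<^esub> str ?s
        = str (g \<odot>\<^bsub>C\<^esub> r) \<bullet>\<^bsub>B\<^esub> (e (Cod C g) \<rhd>\<^bsub>B\<^esub> TC (FCel H \<beta>))"
      using w k unfolding alg_cell_iff by simp
    then show ?thesis
      unfolding gr ts compatible_def using k by simp
  qed
  then show ?thesis using b[OF g] by (simp add: structure_cell_def)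
qed

end

context algebra_lift_limits
begin

lemma lax_mor_str:
  assumes "f \<in> Arr C"
  shows "lax_mor T (lift_mor A H e str f)"
  using assms str_boundary[OF assms] str_unit[OF assms] str_mult[OF assms] lift_alg
  by (simp add: lax_mor_iff)

text \<open>
  Stated for each \<open>w\<close> other than \<open>Colax\<close> so as to serve lax and pseudo morphisms alike, the latter
  differing only by invertibility of the structure 2-cells.
\<close>

lemma coherent_str_weak:
  assumes w: "w \<noteq> Colax" and mor: "\<And>f. f \<in> Arr C \<Longrightarrow> weak_mor w T (lift_mor A H e str f)"
  shows "coherent w A T H e str"
  unfolding coherent_def
proof (intro conjI ballI allI impI)
  show "weak_cell w T (lift_cel A H e str \<alpha>)" if "\<alpha> \<in> Cel C" for \<alpha>
    using that w mor str_natural[OF that refl refl] by (simp add: alg_cell_iff)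
  show "lift_mor A H e str (g \<odot>\<^bsub>C\<^esub> f) = alg_mor_comp w T (lift_mor A H e str g) (lift_mor A H e str f)"
    if "f \<in> Arr C" "g \<in> Arr C" "Cod C f = Dom C g" for f g
    by (rule alg_mor.expand) (use that w str_Comp[OF that] in \<open>simp add: str_cell_comp\<close>)
qed (use mor str_tight in auto)

lemma coherent_str_unique:
  assumes "coherent w A T H e str'" "w \<noteq> Colax" "f \<in> Arr C"
  shows "str' f = str f"
proof -
  obtain X p \<kappa> t u where "resolution f X p \<kappa> t u"
    by (rule obtain_resolution[OF assms(3)])
  with structure_cell_unique[OF structure_cell_coherent[OF assms] structure_cell_str[OF assms(3)]]
  show ?thesis by blast
qed

end

lemma (in algebra_lift) algebra_lift_limits_co:
  assumes "has_limits_of_loose_morphisms Lax A"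
  shows "algebra_lift_limits (f_cat_co A) (monad_co T) H e (\<lambda>_. True)"
  using assms
  by (intro algebra_lift_limits.intro algebra_lift_co algebra_lift_limits_axioms.intro)
    (auto simp: has_limits_of_loose_morphisms_def is_lax_limit_def is_colax_limit_def)

theorem (in algebra_lift) unique_coherent:
  assumes "w \<in> {Lax, Pseudo, Colax}" "has_limits_of_loose_morphisms (dual_weakness w) A"
  shows "\<exists>str. coherent w A T H e str \<and>
    (\<forall>str'. coherent w A T H e str' \<longrightarrow> (\<forall>f\<in>Arr (Loose A). str' f = str f))"
proof -
  consider "w = Lax" | "w = Pseudo" | "w = Colax" using assms(1) by blast
  then show ?thesis
  proof cases
    case 1
    interpret algebra_lift_limits A T H e "\<lambda>_. True"
      using assms(2) 1 by unfold_locales (auto simp: has_limits_of_loose_morphisms_def is_colax_limit_def)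
    have "coherent w A T H e str"
      by (rule coherent_str_weak) (simp_all add: 1 lax_mor_str)
    with coherent_str_unique[of w] show ?thesis unfolding 1 by blast
  next
    case 2
    interpret algebra_lift_limits A T H e "invertible (Loose A)"
      using assms(2) 2 by unfold_locales (auto simp: has_limits_of_loose_morphisms_def is_pseudo_limit_def)
    have "coherent w A T H e str"
      by (rule coherent_str_weak) (simp_all add: 2 lax_mor_str str_invertible)
    with coherent_str_unique[of w] show ?thesis unfolding 2 by blast
  next
    case 3
    then have lims: "has_limits_of_loose_morphisms Lax A" using assms(2) by simp
    interpret co: algebra_lift_limits "f_cat_co A" "monad_co T" H e "\<lambda>_. True"
      by (rule algebra_lift_limits_co[OF lims])
    have "coherent Lax (f_cat_co A) (monad_co T) H e co.str"
      by (rule co.coherent_str_weak) (simp_all only: weak_mor.simps co.lax_mor_str weakness.distinct not_False_eq_True)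
    moreover have "str' f = co.str f"
      if "coherent Lax (f_cat_co A) (monad_co T) H e str'" "f \<in> Arr (Loose A)" for str' f
      using co.coherent_str_unique[OF that(1)] that(2) by simp
    ultimately show ?thesis unfolding 3 coherent_co by blast
  qed
qed

section \<open>The \<open>\<F>\<close>-categories of algebras\<close>

lemma TAlg_F_sel [simp]:
  "Tight (TAlg_F w T) = TAlg Strict T" "Loose (TAlg_F w T) = TAlg w T" "Incl (TAlg_F w T) = two_map_id"
  by (simp_all add: TAlg_F_def)

lemma forgetful_sel [simp]:
  "FObj forgetful = fst" "FArr forgetful = und_arr" "FCel forgetful = und_cell"
  by (simp_all add: forgetful_def)

context two_monad
begin

lemma tight_TAlg_F: "tight (TAlg_F w T) u \<longleftrightarrow> weak_mor Strict T u"
proof -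
  have "FArr two_map_id = (\<lambda>u. u)" by (simp add: fun_eq_iff)
  then show ?thesis by (simp add: tight_def del: weak_mor.simps)
qed

lemma strict_cell_imp_weak:
  assumes "weak_cell Strict T (AlgCell u v \<alpha>)"
  shows "weak_cell w T (AlgCell u v \<alpha>)"
  using assms strict_cell_iff[OF weak_cellD(4,5)[OF assms]] by blast

lemma two_functor_strict_inclusion: "two_functor (TAlg Strict T) (TAlg w T) two_map_id"
proof (intro two_functor.intro two_functor_axioms.intro two_category_TAlg)
  note [simp del] = weak_mor.simps weak_cell.simps
  show "arr (TAlg w T) (FArr two_map_id f) (FObj two_map_id x) (FObj two_map_id y)"
    if "arr (TAlg Strict T) f x y" for f x y
    using that strict_imp_weak by (simp add: arr_def)
  show "cell (TAlg w T) (FCel two_map_id \<alpha>) (FArr two_map_id f) (FArr two_map_id g)"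
    if "cell (TAlg Strict T) \<alpha> f g" for \<alpha> f g
    using that strict_cell_imp_weak by (auto simp: cell_TAlg_iff)
  have comp: "alg_mor_comp Strict T v u = alg_mor_comp w T v u"
    if "weak_mor Strict T u" "weak_mor Strict T v" "alg_cod u = alg_dom v" for u v
    using strict_comp_eq[OF that] by simp
  then show "FArr two_map_id (g \<odot>\<^bsub>TAlg Strict T\<^esub> f) = FArr two_map_id g \<odot>\<^bsub>TAlg w T\<^esub> FArr two_map_id f"
    if "arr (TAlg Strict T) f x y" "arr (TAlg Strict T) g y z" for f g x y z
    using that by (simp add: arr_def)
  show "FCel two_map_id (\<beta> \<star>\<^bsub>TAlg Strict T\<^esub> \<alpha>) = FCel two_map_id \<beta> \<star>\<^bsub>TAlg w T\<^esub> FCel two_map_id \<alpha>"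
    if "cell (TAlg Strict T) \<alpha> f f'" "cell (TAlg Strict T) \<beta> g g'"
      "Cod (TAlg Strict T) f = Dom (TAlg Strict T) g" for \<alpha> \<beta> f f' g g'
  proof -
    from that obtain a b where c: "\<alpha> = AlgCell f f' a" "\<beta> = AlgCell g g' b"
        "weak_cell Strict T (AlgCell f f' a)" "weak_cell Strict T (AlgCell g g' b)"
      unfolding cell_TAlg_iff by blast
    have d: "alg_cod f = alg_dom g" "alg_cod f' = alg_dom g'"
      using that(3) weak_cellD[OF c(3)] weak_cellD[OF c(4)] by simp_all
    show ?thesis
      using c(1,2) comp[OF weak_cellD(4)[OF c(3)] weak_cellD(4)[OF c(4)] d(1)]
        comp[OF weak_cellD(5)[OF c(3)] weak_cellD(5)[OF c(4)] d(2)] by simp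
  qed
qed simp_all

lemma f_category_TAlg_F: "f_category (TAlg_F w T)"
proof (intro f_category.intro f_category_axioms.intro)
  note [simp del] = weak_mor.simps weak_cell.simps
  show "two_functor (Tight (TAlg_F w T)) (Loose (TAlg_F w T)) (Incl (TAlg_F w T))"
    using two_functor_strict_inclusion by simp
  show "bij_betw (FCel (Incl (TAlg_F w T))) {\<alpha>. cell (Tight (TAlg_F w T)) \<alpha> f g}
      {\<beta>. cell (Loose (TAlg_F w T)) \<beta> (FArr (Incl (TAlg_F w T)) f) (FArr (Incl (TAlg_F w T)) g)}"
    if "arr (Tight (TAlg_F w T)) f x y" "arr (Tight (TAlg_F w T)) g x y" for f g x y
  proof -
    have fg: "weak_mor Strict T f" "weak_mor Strict T g" using that by (simp_all add: arr_def)
    have "cell (TAlg Strict T) \<alpha> f g \<longleftrightarrow> cell (TAlg w T) \<alpha> f g" for \<alpha>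
      unfolding cell_TAlg_iff using strict_cell_iff[OF fg] by blast
    then show ?thesis by (simp add: bij_betw_def inj_on_def)
  qed
qed (simp_all add: inj_on_def)

end

section \<open>Unique extension of a lift to strict algebras\<close>

text \<open>
  A 2-functor \<open>E\<close> from the tight part to strict algebras whose underlying 2-functor is the tight
  part of \<open>H\<close>.
\<close>

locale strict_lift = f_category A + two_monad T + H: two_functor "Loose A" "Base T" H
    + E: two_functor "Tight A" "TAlg Strict T" E
  for A :: "('o, 'm, 'c, 'n, 'd) f_cat"
    and T :: "('p, 'k, 'e) monad_data"
    and H :: "('o, 'n, 'd, 'p, 'k, 'e) two_map"
    and E :: "('o, 'm, 'c, ('p, 'k) alg, ('p, 'k, 'e) alg_mor, ('p, 'k, 'e) alg_cell) two_map" +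
  assumes over_base: "two_map_eq (Tight A) (forgetful \<circ>\<circ> E) (tight_part A H)"
begin

definition e :: "'o \<Rightarrow> 'k" where "e x = snd (FObj E x)"

lemma E_obj: "x \<in> Obj (Loose A) \<Longrightarrow> FObj E x = (FObj H x, e x) \<and> is_alg T (FObj E x)"
  using over_base E.FObj_Obj[of x] Obj_eq Incl_Obj[of x]
  by (auto simp: two_map_eq_def tight_part_def e_def prod_eq_iff)

lemma E_mor:
  assumes "f0 \<in> Arr (Tight A)" "f = FArr (Incl A) f0"
  shows "weak_mor Strict T (FArr E f0)"
    "alg_dom (FArr E f0) = (FObj H (Dom (Loose A) f), e (Dom (Loose A) f))"
    "alg_cod (FArr E f0) = (FObj H (Cod (Loose A) f), e (Cod (Loose A) f))"
    "und_arr (FArr E f0) = FArr H f"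
proof -
  have "Dom (Tight A) f0 = Dom (Loose A) f" "Cod (Tight A) f0 = Cod (Loose A) f" "f \<in> Arr (Loose A)"
    using assms by (simp_all add: Incl_Obj)
  then show "weak_mor Strict T (FArr E f0)"
    "alg_dom (FArr E f0) = (FObj H (Dom (Loose A) f), e (Dom (Loose A) f))"
    "alg_cod (FArr E f0) = (FObj H (Cod (Loose A) f), e (Cod (Loose A) f))"
    using E.FArr_simps[OF assms(1)] E_obj[of "Dom (Loose A) f"] E_obj[of "Cod (Loose A) f"]
    by (simp_all del: weak_mor.simps)
  show "und_arr (FArr E f0) = FArr H f"
    using over_base assms by (auto simp: two_map_eq_def tight_part_def)
qed

lemma E_cell:
  assumes "\<gamma>0 \<in> Cel (Tight A)"
  shows "FCel E \<gamma>0 = AlgCell (FArr E (Src (Tight A) \<gamma>0)) (FArr E (Tgt (Tight A) \<gamma>0)) (FCel H (FCel (Incl A) \<gamma>0))"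
    and "weak_cell Strict T (FCel E \<gamma>0)"
  using E.FCel_simps[OF assms] over_base assms
  by (auto simp: two_map_eq_def tight_part_def simp del: weak_cell.simps intro!: alg_cell.expand)

text \<open>
  Local full faithfulness: a 2-cell between tight morphisms comes from the tight part, where
  \<open>E\<close> is defined.
\<close>

lemma tight_cell:
  assumes "\<gamma> \<in> Cel (Loose A)" "tight A (Src (Loose A) \<gamma>)" "tight A (Tgt (Loose A) \<gamma>)"
  obtains \<gamma>0 where "\<gamma>0 \<in> Cel (Tight A)" "\<gamma> = FCel (Incl A) \<gamma>0"
proof -
  obtain f0 g0 where fg: "f0 \<in> Arr (Tight A)" "Src (Loose A) \<gamma> = FArr (Incl A) f0"
      "g0 \<in> Arr (Tight A)" "Tgt (Loose A) \<gamma> = FArr (Incl A) g0"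
    using assms by (auto simp: tight_def)
  have "Dom (Tight A) g0 = Dom (Tight A) f0" "Cod (Tight A) g0 = Cod (Tight A) f0"
    using fg assms(1) incl.FArr_simps[of f0] incl.FArr_simps[of g0] incl.D.Dom_Tgt[of \<gamma>] incl.D.Cod_Tgt[of \<gamma>]
    by (simp_all add: Incl_Obj)
  then have "bij_betw (FCel (Incl A)) {\<alpha>. cell (Tight A) \<alpha> f0 g0}
      {\<beta>. cell (Loose A) \<beta> (FArr (Incl A) f0) (FArr (Incl A) g0)}"
    using Incl_locally_fully_faithful[of f0 "Dom (Tight A) f0" "Cod (Tight A) f0" g0] fg
    by (simp add: arr_def)
  moreover have "\<gamma> \<in> {\<beta>. cell (Loose A) \<beta> (FArr (Incl A) f0) (FArr (Incl A) g0)}"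
    using assms(1) fg by (simp add: cell_def)
  ultimately obtain \<gamma>0 where "cell (Tight A) \<gamma>0 f0 g0" "\<gamma> = FCel (Incl A) \<gamma>0"
    unfolding bij_betw_def by blast
  then show thesis using that by (auto simp: cell_def)
qed

sublocale algebra_lift A T H e
proof
  show "is_alg T (FObj H x, e x)" if "x \<in> Obj (Loose A)" for x
    using E_obj[OF that] by metis
  show "FArr H f \<odot>\<^bsub>B\<^esub> e (Dom (Loose A) f) = e (Cod (Loose A) f) \<odot>\<^bsub>B\<^esub> TA (FArr H f)"
    if f: "tight A f" for f
  proof -
    obtain f0 where f0: "f0 \<in> Arr (Tight A)" "f = FArr (Incl A) f0" using f by (auto simp: tight_def)
    show ?thesis using E_mor[OF f0] unfolding strict_mor_iff by simp
  qed
  show "FCel H \<gamma> \<lhd>\<^bsub>B\<^esub> e (Dom (Loose A) (Src (Loose A) \<gamma>))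
      = e (Cod (Loose A) (Src (Loose A) \<gamma>)) \<rhd>\<^bsub>B\<^esub> TC (FCel H \<gamma>)"
    if \<gamma>: "\<gamma> \<in> Cel (Loose A)" "tight A (Src (Loose A) \<gamma>)" "tight A (Tgt (Loose A) \<gamma>)" for \<gamma>
  proof -
    obtain \<gamma>0 where g: "\<gamma>0 \<in> Cel (Tight A)" "\<gamma> = FCel (Incl A) \<gamma>0"
      by (rule tight_cell[OF \<gamma>])
    let ?f = "Src (Tight A) \<gamma>0" and ?g = "Tgt (Tight A) \<gamma>0"
    have fg: "?f \<in> Arr (Tight A)" "Src (Loose A) \<gamma> = FArr (Incl A) ?f" "?g \<in> Arr (Tight A)"
      using g by simp_all
    have c: "weak_cell Strict T (AlgCell (FArr E ?f) (FArr E ?g) (FCel H \<gamma>))"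
      using E_cell[OF g(1)] g(2) by metis
    show ?thesis
      using c[unfolded strict_cell_iff[OF E_mor(1)[OF fg(1) refl] E_mor(1)[OF fg(3) refl]]]
      by (simp add: E_mor(2,3)[OF fg(1,2)])
  qed
qed

lemma E_eq_lift_mor:
  assumes "f0 \<in> Arr (Tight A)" "coherent w A T H e str"
  shows "FArr E f0 = lift_mor A H e str (FArr (Incl A) f0)"
proof (rule alg_mor.expand)
  have "tight A (FArr (Incl A) f0)" using assms(1) by (simp add: tight_def)
  then have "str (FArr (Incl A) f0)
      = Id2 B (FArr H (FArr (Incl A) f0) \<odot>\<^bsub>B\<^esub> e (Dom (Loose A) (FArr (Incl A) f0)))"
    using assms(2) by (simp add: coherent_def)
  then show "alg_dom (FArr E f0) = alg_dom (lift_mor A H e str (FArr (Incl A) f0)) \<and>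
      alg_cod (FArr E f0) = alg_cod (lift_mor A H e str (FArr (Incl A) f0)) \<and>
      und_arr (FArr E f0) = und_arr (lift_mor A H e str (FArr (Incl A) f0)) \<and>
      str_cell (FArr E f0) = str_cell (lift_mor A H e str (FArr (Incl A) f0))"
    using E_mor[OF assms(1) refl] unfolding strict_mor_iff by simp
qed

definition extension :: "('n \<Rightarrow> 'e) \<Rightarrow> ('o, 'n, 'd, ('p, 'k) alg, ('p, 'k, 'e) alg_mor, ('p, 'k, 'e) alg_cell) two_map"
  where "extension str = \<lparr>FObj = lift_obj H e, FArr = lift_mor A H e str, FCel = lift_cel A H e str\<rparr>"

lemma extension_sel [simp]:
  "FObj (extension str) x = (FObj H x, e x)" "FArr (extension str) = lift_mor A H e str"
  "FCel (extension str) = lift_cel A H e str"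
  by (simp_all add: extension_def lift_obj_def)

lemma is_extension_lift:
  assumes coh: "coherent w A T H e str"
  shows "is_extension_over_base w T A H E (extension str)"
proof -
  note [simp del] = weak_mor.simps weak_cell.simps
  note c = coh[unfolded coherent_def]
  have Comp: "lift_mor A H e str (g \<odot>\<^bsub>Loose A\<^esub> f) = alg_mor_comp w T (lift_mor A H e str g) (lift_mor A H e str f)"
    if "f \<in> Arr (Loose A)" "g \<in> Arr (Loose A)" "Cod (Loose A) f = Dom (Loose A) g" for f g
    using c that by blast
  have F: "two_functor (Loose A) (TAlg w T) (extension str)"
  proof (intro two_functor.intro two_functor_axioms.intro two_category_TAlg incl.D.two_category_axioms)
    show "FArr (extension str) (Id1 (Loose A) x) = Id1 (TAlg w T) (FObj (extension str) x)"
      if "x \<in> Obj (Loose A)" for x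
    proof -
      have "str (Id1 (Loose A) x) = Id2 B (e x)"
        using c tight_Id1[OF that] that by simp
      then show ?thesis using that by (simp add: alg_mor_id_def lift_mor_def lift_obj_def)
    qed
    show "FCel (extension str) (\<beta> \<star>\<^bsub>Loose A\<^esub> \<alpha>) = FCel (extension str) \<beta> \<star>\<^bsub>TAlg w T\<^esub> FCel (extension str) \<alpha>"
      if "cell (Loose A) \<alpha> f f'" "cell (Loose A) \<beta> g g'" "Cod (Loose A) f = Dom (Loose A) g" for \<alpha> \<beta> f f' g g'
    proof -
      have "\<alpha> \<in> Cel (Loose A)" "\<beta> \<in> Cel (Loose A)" "Cod (Loose A) (Src (Loose A) \<alpha>) = Dom (Loose A) (Src (Loose A) \<beta>)"
        using that by (auto simp: cell_def)
      then show ?thesis by (simp add: lift_cel_def Comp)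
    qed
  qed (use c lift_alg Comp in \<open>auto simp: arr_def cell_def lift_cel_def\<close>)
  have "weak_mor Strict T (lift_mor A H e str f)" if "tight A f" for f
    using that c lift_alg lift_strict[OF that] unfolding strict_mor_iff by simp
  then have ff: "f_functor A (TAlg_F w T) (extension str)"
    by (intro f_functor.intro f_functor_axioms.intro f_category_axioms f_category_TAlg_F)
      (simp_all add: F tight_TAlg_F)
  have "two_map_eq (Tight A) (extension str \<circ>\<circ> Incl A) (Incl (TAlg_F w T) \<circ>\<circ> E)"
    unfolding two_map_eq_def
  proof (intro conjI ballI)
    show "FObj (extension str \<circ>\<circ> Incl A) x = FObj (Incl (TAlg_F w T) \<circ>\<circ> E) x" if "x \<in> Obj (Tight A)" for x
      using that E_obj[of x] by (simp add: Incl_Obj Obj_eq)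
    show "FArr (extension str \<circ>\<circ> Incl A) f = FArr (Incl (TAlg_F w T) \<circ>\<circ> E) f" if "f \<in> Arr (Tight A)" for f
      using E_eq_lift_mor[OF that coh] by simp
    show "FCel (extension str \<circ>\<circ> Incl A) \<alpha> = FCel (Incl (TAlg_F w T) \<circ>\<circ> E) \<alpha>" if "\<alpha> \<in> Cel (Tight A)" for \<alpha>
      using E_cell(1)[OF that] that by (simp add: E_eq_lift_mor[OF _ coh] lift_cel_def)
  qed
  with ff show ?thesis
    by (simp add: is_extension_over_base_def two_map_eq_def)
qed

text \<open>
  Lying over the base and restricting to \<open>E\<close> leaves an extension no freedom but the structure
  2-cells, and 2-functoriality makes these coherent.
\<close>

lemma extension_coherent:
  assumes ext: "is_extension_over_base w T A H E E'"
  defines "str' \<equiv> \<lambda>f. str_cell (FArr E' f)"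
  shows "coherent w A T H e str'" and "two_map_eq (Loose A) E' (extension str')"
proof -
  note [simp del] = weak_mor.simps weak_cell.simps
  interpret E': f_functor A "TAlg_F w T" E'
    using ext by (simp add: is_extension_over_base_def)
  interpret L: two_functor "Loose A" "TAlg w T" E'
    using E'.loose.two_functor_axioms by simp
  have obj: "FObj E' x = (FObj H x, e x)" if "x \<in> Obj (Loose A)" for x
    using ext that E_obj[OF that] by (auto simp: is_extension_over_base_def two_map_eq_def Obj_eq Incl_Obj)
  have mor: "FArr E' f = lift_mor A H e str' f" if "f \<in> Arr (Loose A)" for f
    using L.FArr_simps[OF that] that ext obj
    by (auto simp: is_extension_over_base_def two_map_eq_def str'_def intro!: alg_mor.expand)
  have cel: "FCel E' \<alpha> = lift_cel A H e str' \<alpha>" if "\<alpha> \<in> Cel (Loose A)" for \<alpha>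
    using L.FCel_simps[OF that] that ext mor
    by (auto simp: is_extension_over_base_def two_map_eq_def intro!: alg_cell.expand)
  show "two_map_eq (Loose A) E' (extension str')"
    by (simp add: two_map_eq_def obj mor cel)
  have "str' f = Id2 B (FArr H f \<odot>\<^bsub>B\<^esub> e (Dom (Loose A) f))" if f: "tight A f" for f
  proof -
    obtain f0 where f0: "f0 \<in> Arr (Tight A)" "f = FArr (Incl A) f0" using f by (auto simp: tight_def)
    then have "FArr E' f = FArr E f0"
      using ext by (auto simp: is_extension_over_base_def two_map_eq_def)
    then show ?thesis using E_mor[OF f0] unfolding str'_def strict_mor_iff by simp
  qed
  moreover have "lift_mor A H e str' (g \<odot>\<^bsub>Loose A\<^esub> f) = alg_mor_comp w T (lift_mor A H e str' g) (lift_mor A H e str' f)"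
    if "f \<in> Arr (Loose A)" "g \<in> Arr (Loose A)" "Cod (Loose A) f = Dom (Loose A) g" for f g
    using L.FArr_Comp_simp[OF that] mor that by simp
  moreover have "weak_mor w T (lift_mor A H e str' f)" if "f \<in> Arr (Loose A)" for f
    using L.FArr_simps(1)[OF that] mor[OF that] by simp
  moreover have "weak_cell w T (lift_cel A H e str' \<alpha>)" if "\<alpha> \<in> Cel (Loose A)" for \<alpha>
    using L.FCel_simps(1)[OF that] cel[OF that] by simp
  ultimately show "coherent w A T H e str'"
    by (simp add: coherent_def)
qed

theorem unique_extension:
  assumes "w \<in> {Lax, Pseudo, Colax}" "has_limits_of_loose_morphisms (dual_weakness w) A"
  shows "\<exists>E\<^sub>w. is_extension_over_base w T A H E E\<^sub>w \<and>
    (\<forall>E'. is_extension_over_base w T A H E E' \<longrightarrow> two_map_eq (Loose A) E' E\<^sub>w)"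
proof -
  obtain str where coh: "coherent w A T H e str"
    and uniq: "\<And>str' f. coherent w A T H e str' \<Longrightarrow> f \<in> Arr (Loose A) \<Longrightarrow> str' f = str f"
    using unique_coherent[OF assms] by blast
  have "two_map_eq (Loose A) E' (extension str)" if E': "is_extension_over_base w T A H E E'" for E'
  proof -
    note u = uniq[OF extension_coherent(1)[OF E']]
    have "lift_mor A H e (\<lambda>f. str_cell (FArr E' f)) f = lift_mor A H e str f" if "f \<in> Arr (Loose A)" for f
      using u[OF that] by (simp add: lift_mor_def)
    then show ?thesis
      using extension_coherent(2)[OF E'] by (simp add: two_map_eq_def lift_cel_def)
  qed
  with is_extension_lift[OF coh] show ?thesis by blast
qed

end

section \<open>The Eilenberg--Moore comparison\<close>

lemma induced_monad_sel [simp]: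
  "Base (induced_monad B L R \<eta> \<epsilon>) = B" "Fun (induced_monad B L R \<eta> \<epsilon>) = R \<circ>\<circ> L"
  "Mult (induced_monad B L R \<eta> \<epsilon>) b = FArr R (\<epsilon> (FObj L b))" "Unit (induced_monad B L R \<eta> \<epsilon>) = \<eta>"
  by (simp_all add: induced_monad_def)

lemma EM_comparison_sel [simp]:
  "FObj (EM_comparison A B R \<epsilon>) x = (FObj R x, FArr R (\<epsilon> x))"
  "FArr (EM_comparison A B R \<epsilon>) = EM_arr A B R \<epsilon>"
  "FCel (EM_comparison A B R \<epsilon>) \<alpha>
    = AlgCell (EM_arr A B R \<epsilon> (Src A \<alpha>)) (EM_arr A B R \<epsilon> (Tgt A \<alpha>)) (FCel R \<alpha>)"
  by (simp_all add: EM_comparison_def EM_obj_def)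

lemma EM_arr_sel [simp]:
  "alg_dom (EM_arr A B R \<epsilon> f) = (FObj R (Dom A f), FArr R (\<epsilon> (Dom A f)))"
  "alg_cod (EM_arr A B R \<epsilon> f) = (FObj R (Cod A f), FArr R (\<epsilon> (Cod A f)))"
  "und_arr (EM_arr A B R \<epsilon> f) = FArr R f"
  "str_cell (EM_arr A B R \<epsilon> f) = Id2 B (FArr R f \<odot>\<^bsub>B\<^esub> FArr R (\<epsilon> (Dom A f)))"
  by (simp_all add: EM_arr_def EM_obj_def)

text \<open>
  Naturality of the counit says that the image of each 1-cell commutes with the algebra structures
  \<open>R(\<epsilon> x)\<close>, and its 2-naturality that the image of each 2-cell is an algebra 2-cell.
\<close>

lemma (in two_adjunction) two_functor_EM_comparison:
  "two_functor A (TAlg Strict (induced_monad B L R \<eta> \<epsilon>)) (EM_comparison A B R \<epsilon>)"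
proof -
  let ?T = "induced_monad B L R \<eta> \<epsilon>"
  interpret T: two_monad ?T by (rule two_monad_induced)
  note [simp del] = weak_mor.simps weak_cell.simps
  have eps [simp]: "\<epsilon> x \<in> Arr A" "Dom A (\<epsilon> x) = FObj L (FObj R x)" "Cod A (\<epsilon> x) = x"
    if "x \<in> Obj A" for x
    using counit.component_simps[OF that] by simp_all
  have nat: "FArr R f \<odot>\<^bsub>B\<^esub> FArr R (\<epsilon> (Dom A f)) = FArr R (\<epsilon> (Cod A f)) \<odot>\<^bsub>B\<^esub> FArr R (FArr L (FArr R f))"
    if "f \<in> Arr A" for f
    using arg_cong[OF counit.naturality_1[OF that], of "FArr R"] that by simp
  have alg: "is_alg ?T (FObj R x, FArr R (\<epsilon> x))" if "x \<in> Obj A" for x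
    using that nat[of "\<epsilon> x"] triangle_R[OF that] by (simp add: is_alg_def arr_def)
  have mor: "weak_mor Strict ?T (EM_arr A B R \<epsilon> f)" if "f \<in> Arr A" for f
    unfolding T.strict_mor_iff using that alg nat by simp
  have cel: "weak_cell Strict ?T (AlgCell (EM_arr A B R \<epsilon> (Src A \<alpha>)) (EM_arr A B R \<epsilon> (Tgt A \<alpha>)) (FCel R \<alpha>))"
    if "\<alpha> \<in> Cel A" for \<alpha>
    unfolding T.strict_cell_iff[OF mor[OF L.D.Src_Arr[OF that]] mor[OF L.D.Tgt_Arr[OF that]]]
    using arg_cong[OF counit.naturality_2[OF that], of "FCel R"] that by (simp add: cell_def)
  have Comp: "EM_arr A B R \<epsilon> (g \<odot>\<^bsub>A\<^esub> f) = alg_mor_comp Strict ?T (EM_arr A B R \<epsilon> g) (EM_arr A B R \<epsilon> f)"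
    if "f \<in> Arr A" "g \<in> Arr A" "Cod A f = Dom A g" for f g
    using T.strict_comp_eq[OF mor mor, of f g Strict] that by (simp add: EM_arr_def EM_obj_def)
  show ?thesis
  proof (intro two_functor.intro two_functor_axioms.intro T.two_category_TAlg L.D.two_category_axioms)
    show "FArr (EM_comparison A B R \<epsilon>) (Id1 A x) = Id1 (TAlg Strict ?T) (FObj (EM_comparison A B R \<epsilon>) x)"
      if "x \<in> Obj A" for x
      using that by (simp add: EM_arr_def EM_obj_def alg_mor_id_def)
    show "FCel (EM_comparison A B R \<epsilon>) (\<beta> \<star>\<^bsub>A\<^esub> \<alpha>)
        = FCel (EM_comparison A B R \<epsilon>) \<beta> \<star>\<^bsub>TAlg Strict ?T\<^esub> FCel (EM_comparison A B R \<epsilon>) \<alpha>"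
      if "cell A \<alpha> f f'" "cell A \<beta> g g'" "Cod A f = Dom A g" for \<alpha> \<beta> f f' g g'
    proof -
      have "\<alpha> \<in> Cel A" "\<beta> \<in> Cel A" "Cod A (Src A \<alpha>) = Dom A (Src A \<beta>)"
        using that by (auto simp: cell_def)
      then show ?thesis by (simp add: Comp)
    qed
  qed (use alg mor cel Comp in \<open>auto simp: arr_def cell_def\<close>)
qed

theorem theorem23:
  fixes A :: "('o, 'm, 'c, 'n, 'd) f_cat"
    and B :: "('p, 'k, 'e) two_cat"
    and H :: "('o, 'n, 'd, 'p, 'k, 'e) two_map"
    and L :: "('p, 'k, 'e, 'o, 'm, 'c) two_map"
    and \<eta> :: "'p \<Rightarrow> 'k"
    and \<epsilon> :: "'o \<Rightarrow> 'm"
    and w :: weakness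
  assumes "f_category A"
    and "two_category B"
    and "f_functor A (all_tight B) H"
    and "two_adjunction (Tight A) B L (tight_part A H) \<eta> \<epsilon>"
    and "w \<in> {Lax, Pseudo, Colax}"
    and "has_limits_of_loose_morphisms (dual_weakness w) A"
  defines "T \<equiv> induced_monad B L (tight_part A H) \<eta> \<epsilon>"
    and "E \<equiv> EM_comparison (Tight A) B (tight_part A H) \<epsilon>"
  shows "\<exists>E\<^sub>w. is_extension_over_base w T A H E E\<^sub>w \<and>
           (\<forall>E'. is_extension_over_base w T A H E E' \<longrightarrow> two_map_eq (Loose A) E' E\<^sub>w)"
proof -
  interpret adj: two_adjunction "Tight A" B L "tight_part A H" \<eta> \<epsilon> by (rule assms(4))
  have "two_functor (Loose A) B H"
    using assms(3) unfolding f_functor_def by (simp add: all_tight_def)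
  then have "strict_lift A T H E"
    using adj.two_monad_induced adj.two_functor_EM_comparison assms(1) unfolding T_def E_def
    by (intro strict_lift.intro strict_lift_axioms.intro) (simp_all add: two_map_eq_def)
  then show ?thesis using strict_lift.unique_extension assms(5,6) by blast
qed

end
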